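(* Let $n\ge1$, $1<p<\infty$, $s>0$, and let $\alpha\in\mathbb{N}_0^n$ be a multi-index with $0\le|\alpha|<s$. Then there exists a constant $c_0>0$, depending only on $s,\alpha,p$ and $n$, such that the following holds: for every $E>0$ and every $0<\delta<E$ there exists $f\in H^{s,p}(\mathbb{R}^n)$ satisfying $\|f\|_{H^{s,p}}\le E$ and $\|f\|_{L^p}<\delta$ for which $$\|\partial^\alpha f\|_{L^p}\ge c_0\,E^{|\alpha|/s}\,\delta^{1-|\alpha|/s}.$$
   Context: $H^{s,p}(\mathbb{R}^n)$ is the Bessel potential space of all tempered distributions $f$ with $\mathcal{F}^{-1}((1+|\xi|^2)^{s/2}\widehat f)\in L^p(\mathbb{R}^n)$, with norm $\|f\|_{H^{s,p}}=\|\mathcal{F}^{-1}((1+|\xi|^2)^{s/2}\widehat f)\|_{L^p}$, where $\widehat f(\xi)=(2\pi)^{-n/2}\int_{\mathbb{R}^n}f(x)e^{-ix\cdot\xi}\,dx$ and $\mathcal{F}^{-1}$ is the inverse Fourier transform. *)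

theory Defs
  imports "HOL-Analysis.Analysis"
begin

section \<open>Multi-indices and partial derivatives\<close>

type_synonym 'n multi_index = "'n \<Rightarrow> nat"

definition mi_order :: "'n::finite multi_index \<Rightarrow> nat" where
  "mi_order \<alpha> = (\<Sum>i\<in>UNIV. \<alpha> i)"

definition mi_monomial :: "'n::finite multi_index \<Rightarrow> real ^ 'n \<Rightarrow> real" where
  "mi_monomial \<alpha> x = (\<Prod>i\<in>UNIV. (x $ i) ^ \<alpha> i)"

definition partial_deriv :: "'n::finite \<Rightarrow> (real ^ 'n \<Rightarrow> complex) \<Rightarrow> real ^ 'n \<Rightarrow> complex" where
  "partial_deriv i f x = vector_derivative (\<lambda>t. f (x + t *\<^sub>R axis i 1)) (at 0)"

text \<open>The class \<open>C\<^sup>\<infinity>\<close>: differentiability of all iterated partial derivatives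
  entails their continuity.\<close>

definition smooth :: "(real ^ 'n::finite \<Rightarrow> complex) \<Rightarrow> bool" where
  "smooth f \<longleftrightarrow> (\<forall>js. foldr partial_deriv js f differentiable_on UNIV)"

text \<open>The index type carries no order, so an arbitrary list containing each \<open>i\<close> exactly
  \<open>\<alpha> i\<close> times is chosen; for smooth functions the choice is irrelevant by the symmetry of
  mixed partial derivatives.\<close>

definition mi_deriv ::
    "'n::finite multi_index \<Rightarrow> (real ^ 'n \<Rightarrow> complex) \<Rightarrow> real ^ 'n \<Rightarrow> complex" where
  "mi_deriv \<alpha> f = foldr partial_deriv (SOME js. \<forall>i. count_list js i = \<alpha> i) f"

section \<open>Schwartz functions and tempered distributions\<close>

definition schwartz_seminorm ::
    "'n::finite multi_index \<Rightarrow> 'n multi_index \<Rightarrow> (real ^ 'n \<Rightarrow> complex) \<Rightarrow> real" where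
  "schwartz_seminorm \<alpha> \<beta> \<phi> = (SUP x. \<bar>mi_monomial \<alpha> x\<bar> * norm (mi_deriv \<beta> \<phi> x))"

definition schwartz :: "(real ^ 'n::finite \<Rightarrow> complex) set" where
  "schwartz = {\<phi>. smooth \<phi> \<and>
     (\<forall>\<alpha> \<beta>. bdd_above (range (\<lambda>x. \<bar>mi_monomial \<alpha> x\<bar> * norm (mi_deriv \<beta> \<phi> x))))}"

definition schwartz_tendsto ::
    "(nat \<Rightarrow> real ^ 'n::finite \<Rightarrow> complex) \<Rightarrow> (real ^ 'n \<Rightarrow> complex) \<Rightarrow> bool" where
  "schwartz_tendsto X \<phi> \<longleftrightarrow>
     (\<forall>\<alpha> \<beta>. (\<lambda>k. schwartz_seminorm \<alpha> \<beta> (\<lambda>x. X k x - \<phi> x)) \<longlonglongrightarrow> 0)"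

type_synonym 'n functional = "(real ^ 'n \<Rightarrow> complex) \<Rightarrow> complex"

text \<open>Functionals are extensional outside the Schwartz space, so that equality of distributions
  is equality in HOL. The Schwartz space is metrizable, hence sequential continuity is
  continuity.\<close>

definition tempered_distributions :: "'n::finite functional set" where
  "tempered_distributions = {u. u \<in> extensional schwartz \<and>
     (\<forall>\<phi>\<in>schwartz. \<forall>\<psi>\<in>schwartz. u (\<lambda>x. \<phi> x + \<psi> x) = u \<phi> + u \<psi>) \<and>
     (\<forall>c. \<forall>\<phi>\<in>schwartz. u (\<lambda>x. c * \<phi> x) = c * u \<phi>) \<and>
     (\<forall>X. \<forall>\<phi>\<in>schwartz. range X \<subseteq> schwartz \<longrightarrow> schwartz_tendsto X \<phi> \<longrightarrow>
        (\<lambda>k. u (X k)) \<longlonglongrightarrow> u \<phi>)}"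

definition distr_of_fun :: "(real ^ 'n::finite \<Rightarrow> complex) \<Rightarrow> 'n functional" where
  "distr_of_fun f = (\<lambda>\<phi>\<in>schwartz. LINT x|lborel. f x * \<phi> x)"

definition distr_deriv :: "'n::finite multi_index \<Rightarrow> 'n functional \<Rightarrow> 'n functional" where
  "distr_deriv \<alpha> u = (\<lambda>\<phi>\<in>schwartz. (- 1) ^ mi_order \<alpha> * u (mi_deriv \<alpha> \<phi>))"

definition distr_mult :: "(real ^ 'n::finite \<Rightarrow> complex) \<Rightarrow> 'n functional \<Rightarrow> 'n functional" where
  "distr_mult m u = (\<lambda>\<phi>\<in>schwartz. u (\<lambda>x. m x * \<phi> x))"

section \<open>Fourier transform\<close>

definition fourier :: "(real ^ 'n::finite \<Rightarrow> complex) \<Rightarrow> real ^ 'n \<Rightarrow> complex" where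
  "fourier f \<xi> = of_real ((2 * pi) powr (- real CARD('n) / 2)) *
     (LINT x|lborel. f x * exp (- (\<i> * of_real (x \<bullet> \<xi>))))"

definition inv_fourier :: "(real ^ 'n::finite \<Rightarrow> complex) \<Rightarrow> real ^ 'n \<Rightarrow> complex" where
  "inv_fourier f x = of_real ((2 * pi) powr (- real CARD('n) / 2)) *
     (LINT \<xi>|lborel. f \<xi> * exp (\<i> * of_real (x \<bullet> \<xi>)))"

definition distr_fourier :: "'n::finite functional \<Rightarrow> 'n functional" where
  "distr_fourier u = (\<lambda>\<phi>\<in>schwartz. u (fourier \<phi>))"

definition distr_inv_fourier :: "'n::finite functional \<Rightarrow> 'n functional" where
  "distr_inv_fourier u = (\<lambda>\<phi>\<in>schwartz. u (inv_fourier \<phi>))"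

section \<open>Lebesgue and Bessel potential spaces\<close>

definition Lp_fun :: "real \<Rightarrow> (real ^ 'n::finite \<Rightarrow> complex) \<Rightarrow> bool" where
  "Lp_fun p f \<longleftrightarrow> f \<in> borel_measurable lborel \<and> integrable lborel (\<lambda>x. norm (f x) powr p)"

definition Lp_fun_norm :: "real \<Rightarrow> (real ^ 'n::finite \<Rightarrow> complex) \<Rightarrow> real" where
  "Lp_fun_norm p f = (LINT x|lborel. norm (f x) powr p) powr (1 / p)"

text \<open>\<open>L\<^sup>p\<close> as a space of distributions, for \<open>p \<ge> 1\<close>. The representing function is unique almost
  everywhere, so its norm is well defined; \<open>Lp_norm\<close> is meaningful only on \<open>Lp\<close>.\<close>

definition Lp :: "real \<Rightarrow> 'n::finite functional set" where
  "Lp p = {distr_of_fun f |f. Lp_fun p f}"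

definition Lp_norm :: "real \<Rightarrow> 'n::finite functional \<Rightarrow> real" where
  "Lp_norm p u = (THE r. \<exists>f. Lp_fun p f \<and> u = distr_of_fun f \<and> r = Lp_fun_norm p f)"

definition bessel_potential :: "real \<Rightarrow> 'n::finite functional \<Rightarrow> 'n functional" where
  "bessel_potential s u = distr_inv_fourier
     (distr_mult (\<lambda>\<xi>. of_real ((1 + (norm \<xi>)\<^sup>2) powr (s / 2))) (distr_fourier u))"

definition bessel_space :: "real \<Rightarrow> real \<Rightarrow> 'n::finite functional set" where
  "bessel_space s p = {u \<in> tempered_distributions. bessel_potential s u \<in> Lp p}"

definition bessel_norm :: "real \<Rightarrow> real \<Rightarrow> 'n::finite functional \<Rightarrow> real" where
  "bessel_norm s p u = Lp_norm p (bessel_potential s u)"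

end

theory Submission
  imports Defs "HOL-Probability.Characteristic_Functions" "HOL-Probability.Sinc_Integral"
begin

text \<open>The extremal functions are modulated Gaussians
  \<open>f\<^sub>R(x) = exp (\<i>R(x\<^sub>1 + \<dots> + x\<^sub>n) - |x|\<^sup>2/2)\<close>. Their \<open>L\<^sup>p\<close> norm does not depend on \<open>R\<close>,
  and \<open>|\<partial>\<^sup>\<alpha> f\<^sub>R| \<ge> 2\<^sup>-\<^sup>n R\<^bsup>|\<alpha>|\<^esup> |f\<^sub>R|\<close> pointwise for large \<open>R\<close>. Translating the Fourier
  transform of \<open>f\<^sub>R\<close> back to the origin, the Bessel potential of \<open>f\<^sub>R\<close> has modulus \<open>R\<^sup>s |F\<^sup>-\<^sup>1 h\<^sub>R|\<close>, where
  \<open>h\<^sub>R(\<xi>) = (R\<^sup>-\<^sup>2(1 + |\<xi> + (R,\<dots>,R)|\<^sup>2))\<^bsup>s/2\<^esup> F f\<^sub>0(\<xi>)\<close> is bounded in the Schwartz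
  space uniformly in \<open>R \<ge> 1\<close>; so its \<open>L\<^sup>p\<close> norm is \<open>O(R\<^sup>s)\<close>. The function \<open>c \<delta> f\<^sub>R\<close> with
  \<open>R\<close> a multiple of \<open>(E/\<delta>)\<^bsup>1/s\<^esup>\<close> and small \<open>c\<close> then has the required properties.\<close>

section \<open>Partial derivatives\<close>

text \<open>The constant c_0 may not depend on E and \<delta>, hence not on R, so the Schwartz
  estimates have to be uniform in a parameter: closure under sums, coordinates, weights and the
  Fourier transform is proved for indexed bounded families, and a single function is a constant
  family. The delicate closure is the one under real powers of the rescaled symbol. Differentiation
  lowers the exponent without end, while the symbol is as small as R^(-2) at (-R,...,-R). But |xi|
  is at least R there, so the symbol times 1 + |xi|^2 stays bounded below, and the loss is paid by
  the decay of the transformed Gaussian. Oscillation along (1,...,1) lets each coordinate derivative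
  gain a factor R, so the same packets serve every multi-index; 2^(-n) is one factor 1/2 per
  coordinate. Since the L^p norm of a distribution is a definite description, the representing
  function must also be shown unique almost everywhere. The test functions for this are exponentials
  of polynomials, covered by the same closure lemma as the Gaussians.\<close>

lemma partial_deriv_eq:
  assumes "(f has_derivative D) (at x)"
  shows "partial_deriv i f x = D (axis i 1)"
proof -
  have "((\<lambda>t::real. x + t *\<^sub>R axis i 1) has_derivative (\<lambda>t. t *\<^sub>R axis i 1)) (at 0)"
    by (auto intro!: derivative_eq_intros)
  moreover have "(f has_derivative D) (at (x + 0 *\<^sub>R axis i 1))" using assms by simp
  ultimately have "((\<lambda>t::real. f (x + t *\<^sub>R axis i 1)) has_derivative (\<lambda>t. D (t *\<^sub>R axis i 1))) (at 0)"
    by (rule has_derivative_compose)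
  moreover have "D (t *\<^sub>R axis i 1) = t *\<^sub>R D (axis i 1)" for t
    using assms by (intro linear_cmul has_derivative_linear)
  ultimately show ?thesis
    unfolding partial_deriv_def by (intro vector_derivative_at) (simp add: has_vector_derivative_def)
qed

lemma has_vector_derivative_partial_deriv:
  assumes "f differentiable_on UNIV"
  shows "((\<lambda>t. f (x + t *\<^sub>R axis i 1)) has_vector_derivative partial_deriv i f (x + t *\<^sub>R axis i 1)) (at t)"
proof -
  have "f differentiable (at (x + t *\<^sub>R axis i 1))"
    using assms by (auto simp: differentiable_on_def)
  then obtain D where D: "(f has_derivative D) (at (x + t *\<^sub>R axis i 1))"
    by (auto simp: differentiable_def)
  have "((\<lambda>t::real. x + t *\<^sub>R axis i 1) has_derivative (\<lambda>t. t *\<^sub>R axis i 1)) (at t)"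
    by (auto intro!: derivative_eq_intros)
  from has_derivative_compose[OF this D]
  have "((\<lambda>t::real. f (x + t *\<^sub>R axis i 1)) has_derivative (\<lambda>t. D (t *\<^sub>R axis i 1))) (at t)" .
  moreover have "D (t *\<^sub>R axis i 1) = t *\<^sub>R D (axis i 1)" for t
    using D by (intro linear_cmul has_derivative_linear)
  ultimately show ?thesis
    by (simp add: has_vector_derivative_def partial_deriv_eq[OF D])
qed

section \<open>Symmetry of second partial derivatives\<close>

lemma norm_increment_le:
  fixes g :: "real \<Rightarrow> complex"
  assumes "0 \<le> h" and "\<And>t. 0 \<le> t \<Longrightarrow> t \<le> h \<Longrightarrow> (g has_vector_derivative g' t) (at t)"
    and "\<And>t. 0 \<le> t \<Longrightarrow> t \<le> h \<Longrightarrow> norm (g' t) \<le> B"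
  shows "norm (g h - g 0) \<le> B * h"
proof (cases "h = 0")
  case False
  have "continuous_on {0..h} g"
    by (meson assms(2) atLeastAtMost_iff continuous_at_imp_continuous_on has_vector_derivative_continuous)
  with False assms have "norm (g h - g 0) \<le> (\<lambda>t. B * t) h - (\<lambda>t. B * t) 0"
    by (intro differentiable_bound_general[where f' = g' and \<phi>' = "\<lambda>_. B"])
       (auto intro!: continuous_intros derivative_eq_intros simp: has_vector_derivative_def)
  then show ?thesis by simp
qed simp

text \<open>The mean value inequality is applied twice, first along axis i to a difference of two
  parallel lines, then along axis j to the derivative of that difference. Subtracting the constant
  \<open>c\<close> turns it into an estimate of the deviation from \<open>c\<close>, which suits
  complex values, where the mean value theorem holds only as an inequality.\<close>

lemma second_difference_bound:
  assumes f: "f differentiable_on UNIV" and fi: "partial_deriv i f differentiable_on UNIV"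
    and h: "0 \<le> h"
    and B: "\<And>t u. 0 \<le> t \<Longrightarrow> t \<le> h \<Longrightarrow> 0 \<le> u \<Longrightarrow> u \<le> h \<Longrightarrow>
      norm (partial_deriv j (partial_deriv i f) (x + t *\<^sub>R axis i 1 + u *\<^sub>R axis j 1) - c) \<le> B"
  shows "norm (f (x + h *\<^sub>R axis i 1 + h *\<^sub>R axis j 1) - f (x + h *\<^sub>R axis i 1)
      - f (x + h *\<^sub>R axis j 1) + f x - h\<^sup>2 *\<^sub>R c) \<le> B * h * h"
proof -
  define g where "g t = f ((x + h *\<^sub>R axis j 1) + t *\<^sub>R axis i 1) - f (x + t *\<^sub>R axis i 1) - (t * h) *\<^sub>R c" for t
  define g' where "g' t = partial_deriv i f ((x + h *\<^sub>R axis j 1) + t *\<^sub>R axis i 1)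
      - partial_deriv i f (x + t *\<^sub>R axis i 1) - h *\<^sub>R c" for t
  have d: "(g has_vector_derivative g' t) (at t)" for t
  proof -
    have "((\<lambda>t. (t * h) *\<^sub>R c) has_vector_derivative h *\<^sub>R c) (at t)"
      by (auto intro!: derivative_eq_intros simp: has_vector_derivative_def)
    then show ?thesis
      unfolding g_def g'_def
      by (intro has_vector_derivative_diff has_vector_derivative_partial_deriv f)
  qed
  have "norm (g' t) \<le> B * h" if t: "0 \<le> t" "t \<le> h" for t
  proof -
    define k where "k u = partial_deriv i f ((x + t *\<^sub>R axis i 1) + u *\<^sub>R axis j 1) - u *\<^sub>R c" for u
    have "(k has_vector_derivative
       (partial_deriv j (partial_deriv i f) ((x + t *\<^sub>R axis i 1) + u *\<^sub>R axis j 1) - c)) (at u)" for u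
    proof -
      have "((\<lambda>u. u *\<^sub>R c) has_vector_derivative c) (at u)"
        by (auto intro!: derivative_eq_intros simp: has_vector_derivative_def)
      then show ?thesis
        unfolding k_def by (intro has_vector_derivative_diff has_vector_derivative_partial_deriv fi)
    qed
    then have "norm (k h - k 0) \<le> B * h"
      using h B t by (intro norm_increment_le) auto
    also have "k h - k 0 = g' t"
      by (simp add: k_def g'_def algebra_simps)
    finally show ?thesis .
  qed
  then have "norm (g h - g 0) \<le> B * h * h"
    using d h by (intro norm_increment_le) auto
  also have "g h - g 0 = f (x + h *\<^sub>R axis i 1 + h *\<^sub>R axis j 1) - f (x + h *\<^sub>R axis i 1)
      - f (x + h *\<^sub>R axis j 1) + f x - h\<^sup>2 *\<^sub>R c"
    by (simp add: g_def power2_eq_square algebra_simps)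
  finally show ?thesis .
qed

text \<open>The second difference over a square of side h is symmetric in i and j. Divided by h^2 it
  lies within e of either mixed derivative at x, so the two agree.\<close>

lemma partial_deriv_commute:
  assumes f: "f differentiable_on UNIV" and fi: "partial_deriv i f differentiable_on UNIV"
    and fj: "partial_deriv j f differentiable_on UNIV"
    and cij: "continuous_on UNIV (partial_deriv i (partial_deriv j f))"
    and cji: "continuous_on UNIV (partial_deriv j (partial_deriv i f))"
  shows "partial_deriv i (partial_deriv j f) = partial_deriv j (partial_deriv i f)"
proof
  fix x
  let ?a = "partial_deriv i (partial_deriv j f)" and ?b = "partial_deriv j (partial_deriv i f)"
  have near: "\<exists>d>0. \<forall>y. dist y x < d \<longrightarrow> norm (k y - k x) < e"
    if "continuous_on UNIV k" "e > 0" for k :: "real^'a \<Rightarrow> complex" and e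
    using that by (metis UNIV_I continuous_on_iff dist_norm)
  have "norm (?a x - ?b x) \<le> 2 * e" if e: "e > 0" for e
  proof -
    obtain d1 where d1: "d1 > 0" "\<And>y. dist y x < d1 \<Longrightarrow> norm (?a y - ?a x) < e"
      using near[OF cij e] by auto
    obtain d2 where d2: "d2 > 0" "\<And>y. dist y x < d2 \<Longrightarrow> norm (?b y - ?b x) < e"
      using near[OF cji e] by auto
    \<comment> \<open>A corner of the square is at most 2h away from x; dividing by 3 keeps this
      strictly inside both radii.\<close>
    define h where "h = min d1 d2 / 3"
    have h: "h > 0" "3 * h \<le> d1" "3 * h \<le> d2" using d1 d2 by (auto simp: h_def)
    have close: "dist (x + t *\<^sub>R axis k 1 + u *\<^sub>R axis l 1) x < min d1 d2"
      if "0 \<le> t" "t \<le> h" "0 \<le> u" "u \<le> h" for t u :: real and k l :: 'a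
    proof -
      have "dist (x + t *\<^sub>R axis k 1 + u *\<^sub>R axis l 1) x
        \<le> norm (t *\<^sub>R axis k (1::real)) + norm (u *\<^sub>R axis l (1::real))"
        using norm_triangle_ineq[of "t *\<^sub>R axis k (1::real)" "u *\<^sub>R axis l 1"]
        by (simp add: dist_norm add.assoc)
      also have "\<dots> \<le> h + h" using that by simp
      finally show ?thesis using h by linarith
    qed
    let ?\<Delta> = "f (x + h *\<^sub>R axis i 1 + h *\<^sub>R axis j 1) - f (x + h *\<^sub>R axis i 1) - f (x + h *\<^sub>R axis j 1) + f x"
    have 1: "norm (?\<Delta> - h\<^sup>2 *\<^sub>R ?b x) \<le> e * h * h"
      using h close d2(2)
      by (intro second_difference_bound f fi) (auto intro!: less_imp_le)
    have "norm (f (x + h *\<^sub>R axis j 1 + h *\<^sub>R axis i 1) - f (x + h *\<^sub>R axis j 1)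
      - f (x + h *\<^sub>R axis i 1) + f x - h\<^sup>2 *\<^sub>R ?a x) \<le> e * h * h"
      using h close d1(2)
      by (intro second_difference_bound f fj) (auto intro!: less_imp_le)
    then have 2: "norm (?\<Delta> - h\<^sup>2 *\<^sub>R ?a x) \<le> e * h * h"
      by (simp add: algebra_simps)
    have "norm (h\<^sup>2 *\<^sub>R (?a x - ?b x)) \<le> e * h * h + e * h * h"
      using norm_triangle_ineq4[of "?\<Delta> - h\<^sup>2 *\<^sub>R ?b x" "?\<Delta> - h\<^sup>2 *\<^sub>R ?a x"] 1 2
      by (simp add: algebra_simps)
    then have "h\<^sup>2 * norm (?a x - ?b x) \<le> h\<^sup>2 * (2 * e)"
      by (simp only: norm_scaleR) (simp add: power2_eq_square algebra_simps)
    then show ?thesis using h by simp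
  qed
  then have "norm (?a x - ?b x) \<le> 0 + e" if "e > 0" for e
    using that \<open>\<And>e. 0 < e \<Longrightarrow> norm (?a x - ?b x) \<le> 2 * e\<close>[of "e / 2"] by simp
  then have "norm (?a x - ?b x) \<le> 0" by (rule field_le_epsilon)
  then show "?a x = ?b x" by simp
qed

section \<open>Iterated derivatives and their independence of the order\<close>

lemma smooth_foldr: "smooth f \<Longrightarrow> smooth (foldr partial_deriv js f)"
  by (simp add: smooth_def flip: foldr_append)

lemma smooth_partial_deriv: "smooth f \<Longrightarrow> smooth (partial_deriv i f)"
  using smooth_foldr[of f "[i]"] by simp

lemma smooth_differentiable: "smooth f \<Longrightarrow> f differentiable_on UNIV"
  unfolding smooth_def by (metis foldr.simps(1) id_apply)

lemma smooth_continuous: "smooth f \<Longrightarrow> continuous_on UNIV f"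
  by (intro differentiable_imp_continuous_on smooth_differentiable)

lemma smooth_commute:
  "smooth f \<Longrightarrow> partial_deriv i (partial_deriv j f) = partial_deriv j (partial_deriv i f)"
  by (intro partial_deriv_commute smooth_differentiable smooth_continuous smooth_partial_deriv)

lemma foldr_partial_deriv_swap:
  "smooth f \<Longrightarrow> partial_deriv j (foldr partial_deriv as f) = foldr partial_deriv as (partial_deriv j f)"
  by (induction as) (simp_all add: smooth_commute smooth_foldr)

text \<open>\<open>mi_deriv\<close> picks its list of directions by choice, so it can be computed
  with a convenient list only once the order is known to be irrelevant. The head of one list is
  located in the other and commuted to the front.\<close>

lemma foldr_partial_deriv_mset_cong:
  assumes "smooth f" "mset js = mset ks"
  shows "foldr partial_deriv js f = foldr partial_deriv ks f"
  using assms(2)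
proof (induction js arbitrary: ks)
  case (Cons j js)
  then have "j \<in> set ks" by (metis list.set_intros(1) mset_eq_setD)
  then obtain a b where ks: "ks = a @ j # b" by (meson split_list)
  with Cons.prems have "mset js = mset (a @ b)" by simp
  then have "foldr partial_deriv js f = foldr partial_deriv (a @ b) f" by (rule Cons.IH)
  then show ?case
    using foldr_partial_deriv_swap[OF smooth_foldr[OF assms(1), of b], of j a] by (simp add: ks)
qed simp

lemma mset_eq_iff_count_list: "mset js = mset ks \<longleftrightarrow> (\<forall>i. count_list js i = count_list ks i)"
  by (simp add: multiset_eq_iff count_mset)

text \<open>The choice inside \<open>mi_deriv\<close> has a witness: over a finite index type every
  multi-index is the count function of a multiset.\<close>

lemma ex_count_list:
  fixes \<alpha> :: "'n::finite multi_index"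
  shows "\<exists>js. \<forall>i. count_list js i = \<alpha> i"
proof -
  obtain js where "mset js = Abs_multiset \<alpha>" by (meson ex_mset)
  then have "count (mset js) i = \<alpha> i" for i by (simp add: Abs_multiset_inverse)
  then show ?thesis by (auto simp: count_mset intro!: exI[of _ js])
qed

lemma mi_deriv_eq_foldr:
  assumes "smooth f"
  obtains js where "mi_deriv \<alpha> f = foldr partial_deriv js f" "\<And>i. count_list js i = \<alpha> i"
  using someI_ex[OF ex_count_list[of \<alpha>]] unfolding mi_deriv_def by blast

lemma mi_deriv_eq:
  assumes "smooth f" "\<And>i. count_list js i = \<alpha> i"
  shows "mi_deriv \<alpha> f = foldr partial_deriv js f"
proof -
  obtain ks where "mi_deriv \<alpha> f = foldr partial_deriv ks f" "\<And>i. count_list ks i = \<alpha> i"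
    using mi_deriv_eq_foldr[OF assms(1)] by metis
  with assms show ?thesis
    by (metis foldr_partial_deriv_mset_cong mset_eq_iff_count_list)
qed

section \<open>Uniformly bounded families of Schwartz functions\<close>

lemma has_derivative_frechet:
  "f differentiable_on UNIV \<Longrightarrow> (f has_derivative frechet_derivative f (at x)) (at x)"
  by (simp add: differentiable_on_def frechet_derivative_works)

lemma partial_deriv_add:
  assumes "f differentiable_on UNIV" "g differentiable_on UNIV"
  shows "partial_deriv i (\<lambda>x. f x + g x) = (\<lambda>x. partial_deriv i f x + partial_deriv i g x)"
proof
  fix x
  note d = has_derivative_frechet[OF assms(1), of x] has_derivative_frechet[OF assms(2), of x]
  show "partial_deriv i (\<lambda>x. f x + g x) x = partial_deriv i f x + partial_deriv i g x"
    using partial_deriv_eq[OF has_derivative_add[OF d]] d[THEN partial_deriv_eq] by simp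
qed

lemma partial_deriv_mult:
  assumes "f differentiable_on UNIV" "g differentiable_on UNIV"
  shows "partial_deriv i (\<lambda>x. f x * g x) = (\<lambda>x. f x * partial_deriv i g x + partial_deriv i f x * g x)"
proof
  fix x
  note d = has_derivative_frechet[OF assms(1), of x] has_derivative_frechet[OF assms(2), of x]
  show "partial_deriv i (\<lambda>x. f x * g x) x = f x * partial_deriv i g x + partial_deriv i f x * g x"
    using partial_deriv_eq[OF has_derivative_mult[OF d]] d[THEN partial_deriv_eq] by simp
qed

lemma partial_deriv_const: "partial_deriv i (\<lambda>x. c) = (\<lambda>x. 0)"
  by (rule ext) (simp add: partial_deriv_eq[OF has_derivative_const])

lemma partial_deriv_cmult:
  assumes "f differentiable_on UNIV"
  shows "partial_deriv i (\<lambda>x. c * f x) = (\<lambda>x. c * partial_deriv i f x)"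
  using partial_deriv_mult[of "\<lambda>_. c" f i] assms by (simp add: partial_deriv_const)

lemma has_derivative_coord: "((\<lambda>x. of_real (x $ i) :: complex) has_derivative (\<lambda>h. of_real (h $ i))) F"
  by (intro bounded_linear_imp_has_derivative bounded_linear_compose[OF bounded_linear_of_real]
      bounded_linear_vec_nth)

lemma differentiable_coord: "(\<lambda>x. of_real (x $ i) :: complex) differentiable_on S"
  using has_derivative_coord by (auto simp: differentiable_on_def differentiable_def)

lemma partial_deriv_coord:
  "partial_deriv i (\<lambda>x. of_real (x $ j)) = (\<lambda>x. if i = j then 1 else 0)"
  by (rule ext, subst partial_deriv_eq[OF has_derivative_coord]) (auto simp: axis_def)

text \<open>The square of the Japanese bracket. It is a polynomial in the coordinates, and its power
  s/2 is the Bessel symbol, so one weight measures decay and also carries the potential.\<close>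

definition jap :: "'a::real_normed_vector \<Rightarrow> real" where
  "jap x = 1 + (norm x)\<^sup>2"

lemma jap_ge_1: "1 \<le> jap x" and jap_pos: "0 < jap x"
  by (auto simp: jap_def add_pos_nonneg)

lemma jap_vec: "jap (x :: real^'n::finite) = 1 + (\<Sum>i\<in>UNIV. (x $ i)\<^sup>2)"
  by (simp add: jap_def norm_vec_def L2_set_def sum_nonneg)

lemma jap_coord: "1 + (x $ i)\<^sup>2 \<le> jap (x :: real^'n::finite)"
  unfolding jap_vec by (intro add_left_mono member_le_sum) auto

lemma abs_coord_le_jap: "\<bar>x $ i\<bar> \<le> jap (x :: real^'n::finite)"
proof -
  have "0 \<le> (\<bar>x $ i\<bar> - 1)\<^sup>2" "0 \<le> (x $ i)\<^sup>2" by simp_all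
  then have "2 * \<bar>x $ i\<bar> \<le> 1 + (x $ i)\<^sup>2" by (simp add: power2_eq_square algebra_simps)
  then show ?thesis using jap_coord[of x i] abs_ge_zero[of "x $ i"] by linarith
qed

lemma continuous_on_jap[continuous_intros]: "continuous_on S jap"
  unfolding jap_def by (intro continuous_intros)

text \<open>Each of the n factors 1/\<open>jap x\<close> is at most 1/(1 + x_i^2) for a different
  coordinate, so the function lies below a tensor product of one-dimensional Cauchy densities, whose
  integral factorises.\<close>

lemma integrable_inverse_jap_power:
  "integrable lborel (\<lambda>x::real^'n::finite. inverse (jap x ^ CARD('n)))"
proof -
  have r: "integrable lborel (\<lambda>x::real. inverse (1 + x\<^sup>2))"
    using integrable_inverse_1_plus_square by (simp add: set_integrable_def)
  then have "(\<integral>\<^sup>+(x::real). ennreal (inverse (1 + x\<^sup>2)) \<partial>lborel) < \<infinity>"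
    by (subst (asm) integrable_iff_bounded) (simp add: add_nonneg_nonneg)
  then have "(\<Prod>b\<in>(Basis::(real^'n) set). \<integral>\<^sup>+(x::real). ennreal (inverse (1 + x\<^sup>2)) \<partial>lborel) < \<infinity>"
    by (auto simp: less_top[symmetric] ennreal_prod_eq_top power_eq_top_ennreal)
  then have fin: "(\<integral>\<^sup>+(x::real^'n). (\<Prod>b\<in>Basis. ennreal (inverse (1 + (x \<bullet> b)\<^sup>2))) \<partial>lborel) < \<infinity>"
    by (subst nn_integral_lborel_prod) auto
  have "inverse (jap x ^ CARD('n)) \<le> (\<Prod>b\<in>Basis. inverse (1 + (x \<bullet> b)\<^sup>2))" for x :: "real^'n"
  proof -
    have "(x \<bullet> b)\<^sup>2 \<le> (norm x)\<^sup>2" if "b \<in> Basis" for b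
      using Basis_le_norm[OF that, of x] abs_le_square_iff[of "x \<bullet> b" "norm x"] by simp
    then have "inverse (jap x) \<le> inverse (1 + (x \<bullet> b)\<^sup>2)" if "b \<in> Basis" for b
      using that by (intro le_imp_inverse_le) (auto simp: jap_def add_pos_nonneg)
    then have "(\<Prod>b\<in>(Basis :: (real^'n) set). inverse (jap x)) \<le> (\<Prod>b\<in>Basis. inverse (1 + (x \<bullet> b)\<^sup>2))"
      using jap_pos[of x] by (intro prod_mono) (auto intro: less_imp_le)
    then show ?thesis by (simp add: power_inverse)
  qed
  then have "ennreal (norm (inverse (jap x ^ CARD('n)))) \<le> (\<Prod>b\<in>Basis. ennreal (inverse (1 + (x \<bullet> b)\<^sup>2)))"
    for x :: "real^'n"
    using jap_pos[of x] by (subst prod_ennreal) (auto simp: add_nonneg_nonneg ennreal_leI abs_of_pos)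
  then have "(\<integral>\<^sup>+(x::real^'n). ennreal (norm (inverse (jap x ^ CARD('n)))) \<partial>lborel) < \<infinity>"
    by (intro le_less_trans[OF nn_integral_mono fin])
  moreover have "(\<lambda>x::real^'n. inverse (jap x ^ CARD('n))) \<in> borel_measurable borel"
    unfolding jap_def by measurable
  ultimately show ?thesis by (intro integrableI_bounded) auto
qed

abbreviation jap_integral :: "'n::finite itself \<Rightarrow> real" where
  "jap_integral _ \<equiv> LINT x::real^'n|lborel. inverse (jap x ^ CARD('n))"

lemma
  fixes f :: "real^'n::finite \<Rightarrow> 'b::{banach, second_countable_topology}"
  assumes "f \<in> borel_measurable borel" "\<And>x. jap x ^ CARD('n) * norm (f x) \<le> C"
  shows integrable_jap_bound: "integrable lborel f"
    and norm_integral_jap_bound: "norm (LINT x|lborel. f x) \<le> C * jap_integral TYPE('n)"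
proof -
  have le: "norm (f x) \<le> C * inverse (jap x ^ CARD('n))" for x
    using assms(2)[of x] jap_pos[of x] by (simp add: field_simps)
  have i: "integrable lborel (\<lambda>x::real^'n. C * inverse (jap x ^ CARD('n)))"
    by (intro integrable_mult_right integrable_inverse_jap_power)
  show "integrable lborel f"
    by (rule Bochner_Integration.integrable_bound[OF i]) (use assms(1) le in \<open>auto intro: order_trans[OF _ abs_ge_self]\<close>)
  have "norm (LINT x|lborel. f x) \<le> (LINT x::real^'n|lborel. C * inverse (jap x ^ CARD('n)))"
    by (rule Bochner_Integration.integral_norm_bound_integral[OF \<open>integrable lborel f\<close> i le])
  then show "norm (LINT x|lborel. f x) \<le> C * jap_integral TYPE('n)"
    by simp
qed

text \<open>The bound \<open>C\<close> is chosen before the index \<open>r\<close>: decay is uniform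
  over the family.\<close>

definition rapid :: "('r \<Rightarrow> real^'n::finite \<Rightarrow> complex) \<Rightarrow> bool" where
  "rapid \<Phi> \<longleftrightarrow> (\<forall>N. \<exists>C. \<forall>r x. jap x ^ N * norm (\<Phi> r x) \<le> C)"

lemma rapid_add: "rapid \<Phi> \<Longrightarrow> rapid \<Psi> \<Longrightarrow> rapid (\<lambda>r x. \<Phi> r x + \<Psi> r x)"
  unfolding rapid_def
proof
  fix N
  assume "\<forall>N. \<exists>C. \<forall>r x. jap x ^ N * norm (\<Phi> r x) \<le> C" "\<forall>N. \<exists>C. \<forall>r x. jap x ^ N * norm (\<Psi> r x) \<le> C"
  then obtain C D where C: "\<And>r x. jap x ^ N * norm (\<Phi> r x) \<le> C" "\<And>r x. jap x ^ N * norm (\<Psi> r x) \<le> D"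
    by metis
  have "jap x ^ N * norm (\<Phi> r x + \<Psi> r x) \<le> jap x ^ N * (norm (\<Phi> r x) + norm (\<Psi> r x))" for r x
    using jap_pos[of x] by (intro mult_left_mono norm_triangle_ineq) auto
  then have "jap x ^ N * norm (\<Phi> r x + \<Psi> r x) \<le> C + D" for r x
    using C[of x r] by (smt (verit) distrib_left)
  then show "\<exists>C. \<forall>r x. jap x ^ N * norm (\<Phi> r x + \<Psi> r x) \<le> C" by blast
qed

text \<open>A multiplier of polynomial growth of order \<open>k\<close> is absorbed by asking for
  \<open>k\<close> more powers of decay.\<close>

lemma rapid_mult:
  assumes m: "\<And>r x. norm (m r x) \<le> K * jap x ^ k" and \<Phi>: "rapid \<Phi>"
  shows "rapid (\<lambda>r x. m r x * \<Phi> r x)"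
  unfolding rapid_def
proof
  fix N
  from \<Phi> obtain C where C: "\<And>r x. jap x ^ (N + k) * norm (\<Phi> r x) \<le> C"
    unfolding rapid_def by blast
  have K: "0 \<le> K" using order_trans[OF norm_ge_zero m[of undefined 0]] by (simp add: jap_def)
  have "jap x ^ N * norm (m r x * \<Phi> r x) \<le> jap x ^ N * (K * jap x ^ k * norm (\<Phi> r x))" for r x
    using m[of r x] jap_pos[of x] by (auto simp: norm_mult simp flip: mult.assoc intro!: mult_left_mono mult_right_mono)
  also have "jap x ^ N * (K * jap x ^ k * norm (\<Phi> r x)) \<le> K * C" for r x
    using mult_left_mono[OF C[of x r] K] by (simp add: power_add algebra_simps)
  finally show "\<exists>C. \<forall>r x. jap x ^ N * norm (m r x * \<Phi> r x) \<le> C" by blast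
qed

text \<open>An indexed bounded subset of the Schwartz space. Ranging over lists of directions rather
  than multi-indices makes closure under one more derivative immediate.\<close>

definition schwartz_family :: "('r \<Rightarrow> real^'n::finite \<Rightarrow> complex) set" where
  "schwartz_family = {\<Phi>. (\<forall>r. smooth (\<Phi> r)) \<and> (\<forall>js. rapid (\<lambda>r. foldr partial_deriv js (\<Phi> r)))}"

text \<open>To place a family it suffices to find a set of families around it that is stable under
  every partial derivative and whose members are differentiable and rapid. Derivatives of all orders
  are thus controlled by a single first-order computation.\<close>

lemma schwartz_family_coinduct:
  assumes "\<Phi> \<in> S"
    and diff: "\<And>\<Psi> r. \<Psi> \<in> S \<Longrightarrow> \<Psi> r differentiable_on UNIV"
    and pd: "\<And>\<Psi> i. \<Psi> \<in> S \<Longrightarrow> (\<lambda>r. partial_deriv i (\<Psi> r)) \<in> S"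
    and rapid: "\<And>\<Psi>. \<Psi> \<in> S \<Longrightarrow> rapid \<Psi>"
  shows "\<Phi> \<in> schwartz_family"
proof -
  have "(\<lambda>r. foldr partial_deriv js (\<Phi> r)) \<in> S" for js
    using \<open>\<Phi> \<in> S\<close> by (induction js) (auto intro: pd)
  with diff[of "\<lambda>r. foldr partial_deriv _ (\<Phi> r)"] rapid show ?thesis
    by (simp add: schwartz_family_def smooth_def)
qed

lemma schwartz_family_partial_deriv:
  "\<Phi> \<in> schwartz_family \<Longrightarrow> (\<lambda>r. partial_deriv i (\<Phi> r)) \<in> schwartz_family"
proof -
  assume \<Phi>: "\<Phi> \<in> schwartz_family"
  then have "rapid (\<lambda>r. foldr partial_deriv (js @ [i]) (\<Phi> r))" for js
    unfolding schwartz_family_def by blast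
  with \<Phi> show ?thesis
    by (simp add: schwartz_family_def smooth_partial_deriv)
qed

lemma schwartz_family_rapid: "\<Phi> \<in> schwartz_family \<Longrightarrow> rapid \<Phi>"
  unfolding schwartz_family_def by (auto dest!: spec[of _ "[]"])

lemma schwartz_family_smooth: "\<Phi> \<in> schwartz_family \<Longrightarrow> smooth (\<Phi> r)"
  unfolding schwartz_family_def by blast

lemma schwartz_family_differentiable: "\<Phi> \<in> schwartz_family \<Longrightarrow> \<Phi> r differentiable_on UNIV"
  by (intro smooth_differentiable schwartz_family_smooth)

lemma schwartz_family_add:
  fixes \<Phi> \<Psi> :: "'r \<Rightarrow> real^'n::finite \<Rightarrow> complex"
  assumes "\<Phi> \<in> schwartz_family" "\<Psi> \<in> schwartz_family"
  shows "(\<lambda>r x. \<Phi> r x + \<Psi> r x) \<in> schwartz_family"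
proof (rule schwartz_family_coinduct)
  let ?S = "{(\<lambda>(r::'r) (x::real^'n). \<Phi> r x + \<Psi> r x) |\<Phi> \<Psi>. \<Phi> \<in> schwartz_family \<and> \<Psi> \<in> schwartz_family}"
  show "(\<lambda>r x. \<Phi> r x + \<Psi> r x) \<in> ?S" using assms by blast
  fix \<Theta> :: "'r \<Rightarrow> real^'n \<Rightarrow> complex" assume "\<Theta> \<in> ?S"
  then obtain \<Phi> \<Psi> where \<Theta>: "\<Theta> = (\<lambda>r x. \<Phi> r x + \<Psi> r x)" "\<Phi> \<in> schwartz_family" "\<Psi> \<in> schwartz_family"
    by blast
  show "\<Theta> r differentiable_on UNIV" for r
    unfolding \<Theta>(1) by (intro differentiable_on_add schwartz_family_differentiable \<Theta>)
  show "rapid \<Theta>" unfolding \<Theta>(1) by (intro rapid_add schwartz_family_rapid \<Theta>)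
  show "(\<lambda>r. partial_deriv i (\<Theta> r)) \<in> ?S" for i
  proof -
    have "(\<lambda>r. partial_deriv i (\<Theta> r)) = (\<lambda>r x. partial_deriv i (\<Phi> r) x + partial_deriv i (\<Psi> r) x)"
      unfolding \<Theta>(1) by (intro ext) (simp add: partial_deriv_add schwartz_family_differentiable \<Theta>)
    then show ?thesis
      by (intro CollectI exI[of _ "\<lambda>r. partial_deriv i (\<Phi> r)"] exI[of _ "\<lambda>r. partial_deriv i (\<Psi> r)"])
         (simp add: schwartz_family_partial_deriv \<Theta>(2,3))
  qed
qed

text \<open>The factor may vary with the index, as the rescaling parameter does later; only a
  uniform bound matters.\<close>

lemma schwartz_family_scale:
  fixes \<Phi> :: "'r \<Rightarrow> real^'n::finite \<Rightarrow> complex"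
  assumes "\<Phi> \<in> schwartz_family" and c: "\<And>r. norm (c r) \<le> K"
  shows "(\<lambda>r x. c r * \<Phi> r x) \<in> schwartz_family"
proof (rule schwartz_family_coinduct)
  let ?S = "{(\<lambda>(r::'r) (x::real^'n). c r * \<Phi> r x) |\<Phi>. \<Phi> \<in> schwartz_family}"
  show "(\<lambda>r x. c r * \<Phi> r x) \<in> ?S" using assms by blast
  fix \<Theta> :: "'r \<Rightarrow> real^'n \<Rightarrow> complex" assume "\<Theta> \<in> ?S"
  then obtain \<Phi> where \<Theta>: "\<Theta> = (\<lambda>r x. c r * \<Phi> r x)" "\<Phi> \<in> schwartz_family"
    by blast
  show "\<Theta> r differentiable_on UNIV" for r
    unfolding \<Theta>(1) by (intro differentiable_on_mult schwartz_family_differentiable \<Theta> differentiable_on_const)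
  show "rapid \<Theta>" unfolding \<Theta>(1)
    using c by (intro rapid_mult[where k = 0 and K = K] schwartz_family_rapid \<Theta>) simp
  show "(\<lambda>r. partial_deriv i (\<Theta> r)) \<in> ?S" for i
  proof -
    have "(\<lambda>r. partial_deriv i (\<Theta> r)) = (\<lambda>r x. c r * partial_deriv i (\<Phi> r) x)"
      unfolding \<Theta>(1) by (intro ext) (simp add: partial_deriv_cmult schwartz_family_differentiable \<Theta>)
    then show ?thesis
      by (intro CollectI exI[of _ "\<lambda>r. partial_deriv i (\<Phi> r)"])
         (simp add: schwartz_family_partial_deriv \<Theta>(2))
  qed
qed

lemma schwartz_family_cmult:
  "\<Phi> \<in> schwartz_family \<Longrightarrow> (\<lambda>r x. c * \<Phi> r x) \<in> schwartz_family"
  by (rule schwartz_family_scale[where K = "norm c"]) auto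

lemma schwartz_family_zero: "(\<lambda>r x. 0) \<in> schwartz_family"
  by (rule schwartz_family_coinduct[where S = "{\<lambda>r x. 0}"]) (auto simp: partial_deriv_const rapid_def)

lemma schwartz_family_diff:
  assumes "\<Phi> \<in> schwartz_family" "\<Psi> \<in> schwartz_family"
  shows "(\<lambda>r x. \<Phi> r x - \<Psi> r x) \<in> schwartz_family"
  using schwartz_family_add[OF assms(1) schwartz_family_cmult[OF assms(2), of "-1"]] by simp

lemma schwartz_family_sum:
  assumes "\<And>j. j \<in> A \<Longrightarrow> (\<lambda>r. F j r) \<in> schwartz_family"
  shows "(\<lambda>r x. \<Sum>j\<in>A. F j r x) \<in> schwartz_family"
  using assms
  by (induction A rule: infinite_finite_induct)
     (auto intro: schwartz_family_zero schwartz_family_add)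

lemma schwartz_family_coord:
  fixes \<Phi> :: "'r \<Rightarrow> real^'n::finite \<Rightarrow> complex"
  assumes "\<Phi> \<in> schwartz_family"
  shows "(\<lambda>r x. of_real (x $ k) * \<Phi> r x) \<in> schwartz_family"
proof (rule schwartz_family_coinduct)
  \<comment> \<open>Differentiating x_k \<Phi> leaves an extra multiple of \<Phi>. The free summand
    \<Psi> absorbs it and makes the set stable.\<close>
  let ?S = "{(\<lambda>(r::'r) (x::real^'n). of_real (x $ k) * \<Phi> r x + \<Psi> r x) |\<Phi> \<Psi>. \<Phi> \<in> schwartz_family \<and> \<Psi> \<in> schwartz_family}"
  show "(\<lambda>r x. of_real (x $ k) * \<Phi> r x) \<in> ?S"
    by (rule CollectI, rule exI[of _ \<Phi>], rule exI[of _ "\<lambda>r x. 0"]) (simp add: assms schwartz_family_zero)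
  fix \<Theta> :: "'r \<Rightarrow> real^'n \<Rightarrow> complex" assume "\<Theta> \<in> ?S"
  then obtain \<Phi> \<Psi> where \<Theta>: "\<Theta> = (\<lambda>r x. of_real (x $ k) * \<Phi> r x + \<Psi> r x)"
    "\<Phi> \<in> schwartz_family" "\<Psi> \<in> schwartz_family"
    by blast
  note d = schwartz_family_differentiable[OF \<Theta>(2)] schwartz_family_differentiable[OF \<Theta>(3)]
     differentiable_coord
  show "\<Theta> r differentiable_on UNIV" for r
    unfolding \<Theta>(1) by (intro differentiable_on_add differentiable_on_mult d)
  show "rapid \<Theta>" unfolding \<Theta>(1)
    by (intro rapid_add schwartz_family_rapid \<Theta> rapid_mult[where k = 1 and K = 1]) (simp add: abs_coord_le_jap)
  show "(\<lambda>r. partial_deriv i (\<Theta> r)) \<in> ?S" for i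
  proof -
    have "(\<lambda>r. partial_deriv i (\<Theta> r)) = (\<lambda>r x. of_real (x $ k) * partial_deriv i (\<Phi> r) x +
      ((if i = k then 1 else 0) * \<Phi> r x + partial_deriv i (\<Psi> r) x))"
      unfolding \<Theta>(1)
      by (intro ext) (simp add: partial_deriv_add partial_deriv_mult partial_deriv_coord d differentiable_on_mult)
    moreover have "(\<lambda>r x. (if i = k then 1 else 0) * \<Phi> r x + partial_deriv i (\<Psi> r) x) \<in> schwartz_family"
      by (intro schwartz_family_add schwartz_family_cmult schwartz_family_partial_deriv \<Theta>)
    ultimately show ?thesis
      by (intro CollectI exI[of _ "\<lambda>r. partial_deriv i (\<Phi> r)"] exI[of _ "\<lambda>r x. (if i = k then 1 else 0) * \<Phi> r x + partial_deriv i (\<Psi> r) x"])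
         (simp add: schwartz_family_partial_deriv \<Theta>(2))
  qed
qed

section \<open>Schwartz functions of product form\<close>

lemma abs_mi_monomial_le: "\<bar>mi_monomial \<alpha> x\<bar> \<le> jap x ^ mi_order \<alpha>"
proof -
  have "\<bar>mi_monomial \<alpha> x\<bar> = (\<Prod>i\<in>UNIV. \<bar>x $ i\<bar> ^ \<alpha> i)"
    by (simp add: mi_monomial_def abs_prod power_abs)
  also have "\<dots> \<le> (\<Prod>i\<in>UNIV. jap x ^ \<alpha> i)"
    by (intro prod_mono) (auto intro!: power_mono abs_coord_le_jap)
  also have "\<dots> = jap x ^ mi_order \<alpha>"
    by (simp add: mi_order_def power_sum)
  finally show ?thesis .
qed

lemma mi_monomial_add2:
  fixes \<alpha> :: "'n::finite multi_index"
  shows "mi_monomial (\<alpha>(j := \<alpha> j + 2)) x = (x $ j)\<^sup>2 * mi_monomial \<alpha> x"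
proof -
  have "mi_monomial (\<alpha>(j := \<alpha> j + 2)) x = (x $ j) ^ (\<alpha> j + 2) * (\<Prod>i\<in>UNIV-{j}. (x $ i) ^ (\<alpha>(j := \<alpha> j + 2)) i)"
    unfolding mi_monomial_def by (subst prod.remove[of _ j]) auto
  also have "(\<Prod>i\<in>UNIV-{j}. (x $ i) ^ (\<alpha>(j := \<alpha> j + 2)) i) = (\<Prod>i\<in>UNIV-{j}. (x $ i) ^ \<alpha> i)"
    by (intro prod.cong) auto
  also have "(x $ j) ^ (\<alpha> j + 2) * \<dots> = (x $ j)\<^sup>2 * mi_monomial \<alpha> x"
    unfolding mi_monomial_def by (subst prod.remove[of UNIV j]) (auto simp: power_add power2_eq_square)
  finally show ?thesis .
qed

text \<open>Since \<open>jap x\<close> is 1 plus the sum of the x_j^2, each further power of it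
  costs n + 1 monomial bounds: the old one and those with one exponent raised by two. The induction
  therefore needs \<alpha> arbitrary.\<close>

lemma monomial_bounds_imp_jap_bounds:
  fixes g :: "real^'n::finite \<Rightarrow> complex"
  assumes "\<And>\<alpha>. \<exists>C. \<forall>x. \<bar>mi_monomial \<alpha> x\<bar> * norm (g x) \<le> C"
  shows "\<exists>C. \<forall>x. jap x ^ N * (\<bar>mi_monomial \<alpha> x\<bar> * norm (g x)) \<le> C"
proof (induction N arbitrary: \<alpha>)
  case 0
  then show ?case using assms by simp
next
  case (Suc N)
  obtain C where C: "\<And>x. jap x ^ N * (\<bar>mi_monomial \<alpha> x\<bar> * norm (g x)) \<le> C"
    using Suc by blast
  have "\<forall>j. \<exists>C. \<forall>x. jap x ^ N * (\<bar>mi_monomial (\<alpha>(j := \<alpha> j + 2)) x\<bar> * norm (g x)) \<le> C"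
    using Suc by blast
  then obtain D where D: "\<And>j x. jap x ^ N * (\<bar>mi_monomial (\<alpha>(j := \<alpha> j + 2)) x\<bar> * norm (g x)) \<le> D j"
    by metis
  have "jap x ^ Suc N * (\<bar>mi_monomial \<alpha> x\<bar> * norm (g x)) \<le> C + (\<Sum>j\<in>UNIV. D j)" for x
  proof -
    have "jap x ^ Suc N * (\<bar>mi_monomial \<alpha> x\<bar> * norm (g x))
      = (1 + (\<Sum>j\<in>UNIV. (x $ j)\<^sup>2)) * (jap x ^ N * (\<bar>mi_monomial \<alpha> x\<bar> * norm (g x)))"
      by (simp add: jap_vec)
    also have "\<dots> = jap x ^ N * (\<bar>mi_monomial \<alpha> x\<bar> * norm (g x))
      + (\<Sum>j\<in>UNIV. jap x ^ N * (\<bar>mi_monomial (\<alpha>(j := \<alpha> j + 2)) x\<bar> * norm (g x)))"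
      by (simp add: mi_monomial_add2 abs_mult del: add_2_eq_Suc' add: sum_distrib_left sum_distrib_right distrib_left distrib_right mult_ac)
    also have "\<dots> \<le> C + (\<Sum>j\<in>UNIV. D j)"
      by (intro add_mono C sum_mono D)
    finally show ?thesis .
  qed
  then show ?case by blast
qed

text \<open>The bridge between the two descriptions: monomial weights and chosen lists in
  \<open>schwartz\<close>, powers of \<open>jap\<close> and all lists in
  \<open>schwartz_family\<close>. The index type is free; it is taken as \<open>unit\<close> for
  single functions and as the reals for the packets.\<close>

lemma schwartz_iff_family: "\<phi> \<in> schwartz \<longleftrightarrow> (\<lambda>r::'b. \<phi>) \<in> schwartz_family"
proof
  assume \<phi>: "\<phi> \<in> schwartz"
  then have s: "smooth \<phi>" by (simp add: schwartz_def)
  have "rapid (\<lambda>r::'b. foldr partial_deriv js \<phi>)" for js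
  proof -
    have "\<exists>C. \<forall>x. \<bar>mi_monomial \<alpha> x\<bar> * norm (foldr partial_deriv js \<phi> x) \<le> C" for \<alpha>
    proof -
      have "bdd_above (range (\<lambda>x. \<bar>mi_monomial \<alpha> x\<bar> * norm (mi_deriv (count_list js) \<phi> x)))"
        using \<phi> by (simp add: schwartz_def)
      then show ?thesis
        by (simp add: mi_deriv_eq[OF s, of js] bdd_above_def)
    qed
    \<comment> \<open>The zero exponent turns the monomial into 1 and leaves a pure
      \<open>jap\<close> bound.\<close>
    from monomial_bounds_imp_jap_bounds[OF this, of _ "\<lambda>_. 0"] show ?thesis
      by (simp add: rapid_def mi_monomial_def)
  qed
  with s show "(\<lambda>r::'b. \<phi>) \<in> schwartz_family" by (simp add: schwartz_family_def)
next
  assume "(\<lambda>r::'b. \<phi>) \<in> schwartz_family"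
  then have s: "smooth \<phi>" and r: "\<And>js. rapid (\<lambda>r::'b. foldr partial_deriv js \<phi>)"
    by (auto simp: schwartz_family_def)
  have "bdd_above (range (\<lambda>x. \<bar>mi_monomial \<alpha> x\<bar> * norm (mi_deriv \<beta> \<phi> x)))" for \<alpha> \<beta>
  proof -
    obtain js where js: "mi_deriv \<beta> \<phi> = foldr partial_deriv js \<phi>"
      using mi_deriv_eq_foldr[OF s] by metis
    obtain C where "\<And>x. jap x ^ mi_order \<alpha> * norm (foldr partial_deriv js \<phi> x) \<le> C"
      using r[of js] unfolding rapid_def by blast
    then have "\<bar>mi_monomial \<alpha> x\<bar> * norm (mi_deriv \<beta> \<phi> x) \<le> C" for x
      using mult_right_mono[OF abs_mi_monomial_le[of \<alpha> x] norm_ge_zero[of "mi_deriv \<beta> \<phi> x"]]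
      by (simp add: js) (meson order_trans)
    then show ?thesis by (auto intro!: bdd_aboveI[of _ C])
  qed
  with s show "\<phi> \<in> schwartz" by (simp add: schwartz_def)
qed

lemma has_derivative_prod_coord:
  fixes u :: "'n::finite \<Rightarrow> real \<Rightarrow> complex"
  assumes "\<And>i t. (u i has_vector_derivative u' i t) (at t)"
  shows "((\<lambda>x. \<Prod>i\<in>UNIV. u i (x $ i)) has_derivative
     (\<lambda>h. \<Sum>i\<in>UNIV. (h $ i) *\<^sub>R u' i (x $ i) * (\<Prod>j\<in>UNIV-{i}. u j (x $ j)))) (at x)"
proof (rule has_derivative_prod)
  fix i
  have "((\<lambda>x. x $ i) has_derivative (\<lambda>h. h $ i)) (at x)"
    by (intro bounded_linear_imp_has_derivative bounded_linear_vec_nth)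
  from has_derivative_compose[OF this assms[of i "x $ i", unfolded has_vector_derivative_def]]
  show "((\<lambda>x. u i (x $ i)) has_derivative (\<lambda>h. h $ i *\<^sub>R u' i (x $ i))) (at x)" .
qed

text \<open>\<open>u i k\<close> stands for the k-th derivative of the i-th one-variable factor, and
  \<kappa> records how often each coordinate has been differentiated. A derivative then only
  increments one entry of \<kappa>.\<close>

lemma partial_deriv_prod_coord:
  fixes u :: "'n::finite \<Rightarrow> nat \<Rightarrow> real \<Rightarrow> complex"
  assumes "\<And>i k t. (u i k has_vector_derivative u i (Suc k) t) (at t)"
  shows "partial_deriv j (\<lambda>x. \<Prod>i\<in>UNIV. u i (\<kappa> i) (x $ i))
    = (\<lambda>x. \<Prod>i\<in>UNIV. u i ((\<kappa>(j := Suc (\<kappa> j))) i) (x $ i))"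
proof
  fix x
  have "(\<Sum>i\<in>UNIV. (axis j (1::real) $ i) *\<^sub>R u i (Suc (\<kappa> i)) (x $ i) * (\<Prod>k\<in>UNIV-{i}. u k (\<kappa> k) (x $ k)))
    = (\<Sum>i\<in>UNIV. if j = i then u i (Suc (\<kappa> i)) (x $ i) * (\<Prod>k\<in>UNIV-{i}. u k (\<kappa> k) (x $ k)) else 0)"
    by (intro sum.cong) (auto simp: axis_def)
  also have "\<dots> = u j (Suc (\<kappa> j)) (x $ j) * (\<Prod>k\<in>UNIV-{j}. u k (\<kappa> k) (x $ k))"
    by simp
  also have "\<dots> = (\<Prod>i\<in>UNIV. u i ((\<kappa>(j := Suc (\<kappa> j))) i) (x $ i))"
    using prod.remove[of UNIV j "\<lambda>i. u i ((\<kappa>(j := Suc (\<kappa> j))) i) (x $ i)"]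
    by (simp cong: prod.cong_simp)
  finally show "partial_deriv j (\<lambda>x. \<Prod>i\<in>UNIV. u i (\<kappa> i) (x $ i)) x = \<dots>"
    by (simp add: partial_deriv_eq[OF has_derivative_prod_coord[OF assms]])
qed

lemma foldr_partial_deriv_prod_coord:
  fixes u :: "'n::finite \<Rightarrow> nat \<Rightarrow> real \<Rightarrow> complex"
  assumes "\<And>i k t. (u i k has_vector_derivative u i (Suc k) t) (at t)"
  shows "foldr partial_deriv js (\<lambda>x. \<Prod>i\<in>UNIV. u i 0 (x $ i)) = (\<lambda>x. \<Prod>i\<in>UNIV. u i (count_list js i) (x $ i))"
proof (induction js)
  case (Cons j js)
  have "count_list (j # js) = (count_list js)(j := Suc (count_list js j))" by auto
  with Cons partial_deriv_prod_coord[of u, OF assms, where \<kappa> = "count_list js" and j = j] show ?case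
    by simp
qed simp

text \<open>With f x = (x_i)^2 it bounds the joint weight by a product of one-variable weights, so
  that decay can be checked coordinate by coordinate.\<close>

lemma one_plus_sum_le_prod:
  fixes f :: "'a \<Rightarrow> real"
  assumes "finite A" "\<And>x. x \<in> A \<Longrightarrow> 0 \<le> f x"
  shows "1 + (\<Sum>x\<in>A. f x) \<le> (\<Prod>x\<in>A. 1 + f x)"
  using assms
proof (induction A rule: finite_induct)
  case (insert a A)
  have "(1 + f a) * (1 + (\<Sum>x\<in>A. f x)) \<le> (1 + f a) * (\<Prod>x\<in>A. 1 + f x)"
    using insert by (intro mult_left_mono) auto
  moreover have "0 \<le> f a * (\<Sum>x\<in>A. f x)"
    using insert by (intro mult_nonneg_nonneg sum_nonneg) auto
  ultimately show ?case using insert by (simp add: algebra_simps)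
qed simp

lemma schwartz_prod_coord:
  fixes u :: "'n::finite \<Rightarrow> nat \<Rightarrow> real \<Rightarrow> complex"
  assumes d: "\<And>i k t. (u i k has_vector_derivative u i (Suc k) t) (at t)"
    and b: "\<And>i k N. \<exists>C. \<forall>t. (1 + t\<^sup>2) ^ N * norm (u i k t) \<le> C"
  shows "(\<lambda>x. \<Prod>i\<in>UNIV. u i 0 (x $ i)) \<in> schwartz"
  unfolding schwartz_iff_family[where 'b=unit]
proof (rule schwartz_family_coinduct)
  let ?S = "range (\<lambda>\<kappa> (r::unit) (x::real^'n). \<Prod>i\<in>UNIV. u i (\<kappa> i) (x $ i))"
  show "(\<lambda>r x. \<Prod>i\<in>UNIV. u i 0 (x $ i)) \<in> ?S" by (rule image_eqI[of _ _ "\<lambda>_. 0"]) auto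
  fix \<Theta> assume "\<Theta> \<in> ?S"
  then obtain \<kappa> where \<Theta>: "\<Theta> = (\<lambda>r x. \<Prod>i\<in>UNIV. u i (\<kappa> i) (x $ i))" by blast
  show "\<Theta> r differentiable_on UNIV" for r
    unfolding \<Theta> differentiable_on_def differentiable_def
    using has_derivative_prod_coord[of "\<lambda>i. u i (\<kappa> i)" "\<lambda>i. u i (Suc (\<kappa> i))", OF d] by blast
  show "(\<lambda>r. partial_deriv i (\<Theta> r)) \<in> ?S" for i
    unfolding \<Theta> partial_deriv_prod_coord[of u, OF d] by (rule rangeI)
  show "rapid \<Theta>"
    unfolding rapid_def
  proof
    fix N
    have "\<forall>i. \<exists>C. \<forall>t. (1 + t\<^sup>2) ^ N * norm (u i (\<kappa> i) t) \<le> C" using b by blast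
    then obtain C where C: "\<And>i t. (1 + t\<^sup>2) ^ N * norm (u i (\<kappa> i) t) \<le> C i" by metis
    have "jap x ^ N * norm (\<Theta> r x) \<le> (\<Prod>i\<in>UNIV. C i)" for r and x :: "real^'n"
    proof -
      have "jap x \<le> (\<Prod>i\<in>UNIV. 1 + (x $ i)\<^sup>2)"
        unfolding jap_vec by (intro one_plus_sum_le_prod) simp_all
      then have "jap x ^ N \<le> (\<Prod>i\<in>UNIV. (1 + (x $ i)\<^sup>2) ^ N)"
        using jap_pos[of x] by (auto simp: prod_power_distrib[symmetric] intro: power_mono)
      then have "jap x ^ N * norm (\<Theta> r x) \<le> (\<Prod>i\<in>UNIV. (1 + (x $ i)\<^sup>2) ^ N) * norm (\<Theta> r x)"
        by (rule mult_right_mono) simp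
      also have "\<dots> = (\<Prod>i\<in>UNIV. (1 + (x $ i)\<^sup>2) ^ N * norm (u i (\<kappa> i) (x $ i)))"
        by (simp add: \<Theta> prod.distrib flip: prod_norm)
      also have "\<dots> \<le> (\<Prod>i\<in>UNIV. C i)"
        by (intro prod_mono) (auto intro: C)
      finally show ?thesis .
    qed
    then show "\<exists>C. \<forall>r x. jap x ^ N * norm (\<Theta> r x) \<le> C" by blast
  qed
qed

lemma norm_poly_of_real_le:
  "\<exists>K m. 0 \<le> K \<and> (\<forall>t. norm (poly P (complex_of_real t)) \<le> K * (1 + t\<^sup>2) ^ m)"
proof (induction P)
  case (pCons a P)
  then obtain K m where K: "0 \<le> K" "\<And>t. norm (poly P (complex_of_real t)) \<le> K * (1 + t\<^sup>2) ^ m" by blast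
  have "norm (poly (pCons a P) (complex_of_real t)) \<le> (norm a + K) * (1 + t\<^sup>2) ^ Suc m" for t
  proof -
    \<comment> \<open>The coordinate bound is reused in dimension one, with a vector indexed by
      \<open>unit\<close>.\<close>
    have t: "\<bar>t\<bar> \<le> 1 + t\<^sup>2"
      using abs_coord_le_jap[of "\<chi> i::unit. t" "()"] by (simp add: jap_vec)
    have 1: "1 \<le> (1 + t\<^sup>2) ^ Suc m" by (intro one_le_power) simp
    have "norm (poly (pCons a P) (complex_of_real t)) \<le> norm a + \<bar>t\<bar> * norm (poly P (complex_of_real t))"
      by (simp add: norm_mult order_trans[OF norm_triangle_ineq])
    also have "\<dots> \<le> norm a * (1 + t\<^sup>2) ^ Suc m + (1 + t\<^sup>2) * (K * (1 + t\<^sup>2) ^ m)"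
      using mult_left_mono[OF 1 norm_ge_zero[of a]] by (intro add_mono mult_mono K t) (auto simp: add_nonneg_nonneg)
    finally show ?thesis by (simp add: algebra_simps)
  qed
  then show ?case using K(1) by (intro exI[of _ "norm a + K"] exI[of _ "Suc m"]) (auto intro: add_nonneg_nonneg)
qed auto

text \<open>A single term of the exponential series is at most its sum.\<close>

lemma power_le_exp:
  assumes "0 < a" "0 \<le> (y::real)"
  shows "y ^ m \<le> fact m / a ^ m * exp (a * y)"
proof -
  have "(\<Sum>n\<in>{m}. (a * y) ^ n /\<^sub>R fact n) \<le> exp (a * y)"
    unfolding exp_def using assms by (intro sum_le_suminf summable_exp_generic) auto
  then show ?thesis using assms by (simp add: field_simps power_mult_distrib)
qed

text \<open>The polynomial factor in the k-th derivative of exp Q, from (P exp Q)' = (P' + P Q') exp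
  Q. For quadratic Q these are Hermite-type polynomials.\<close>

definition exp_poly_step :: "complex poly \<Rightarrow> nat \<Rightarrow> complex poly" where
  "exp_poly_step Q k = ((\<lambda>P. pderiv P + P * pderiv Q) ^^ k) 1"

lemma exp_poly_step_simps [simp]:
  "exp_poly_step Q 0 = 1"
  "exp_poly_step Q (Suc k) = pderiv (exp_poly_step Q k) + exp_poly_step Q k * pderiv Q"
  by (simp_all add: exp_poly_step_def)

text \<open>The Gaussian upper bound on the real part of each exponent beats any polynomial factor
  created by differentiation. General polynomials are allowed because two uses follow: quadratic
  exponents for the packets, and exponents of high degree for the approximation of boxes.\<close>

lemma
  fixes Q :: "'n::finite \<Rightarrow> complex poly"
  assumes "0 < a" and Q: "\<And>i t. Re (poly (Q i) (of_real t)) \<le> - a * t\<^sup>2"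
  defines "f \<equiv> (\<lambda>x::real^'n. \<Prod>i\<in>UNIV. exp (poly (Q i) (of_real (x $ i))))"
  shows schwartz_exp_poly: "f \<in> schwartz"
    and foldr_partial_deriv_exp_poly: "foldr partial_deriv js f =
      (\<lambda>x. (\<Prod>i\<in>UNIV. poly (exp_poly_step (Q i) (count_list js i)) (of_real (x $ i))) * f x)"
proof -
  define u where "u i k t = poly (exp_poly_step (Q i) k) (of_real t) * exp (poly (Q i) (of_real t))" for i k t
  have f: "f = (\<lambda>x. \<Prod>i\<in>UNIV. u i 0 (x $ i))" by (simp add: f_def u_def)
  have d: "(u i k has_vector_derivative u i (Suc k) t) (at t)" for i k t
  proof -
    have "((\<lambda>z. poly (exp_poly_step (Q i) k) z * exp (poly (Q i) z)) has_field_derivative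
        u i (Suc k) t) (at (of_real t))"
      unfolding u_def by (auto intro!: derivative_eq_intros simp: algebra_simps)
    then have "((\<lambda>z. poly (exp_poly_step (Q i) k) z * exp (poly (Q i) z)) \<circ> of_real has_vector_derivative
        1 * u i (Suc k) t) (at t)"
      by (intro field_vector_diff_chain_at) (auto intro!: derivative_eq_intros simp: has_vector_derivative_def scaleR_conv_of_real)
    then show ?thesis unfolding u_def o_def by simp
  qed
  have b: "\<exists>C. \<forall>t. (1 + t\<^sup>2) ^ N * norm (u i k t) \<le> C" for i k N
  proof -
    obtain K m where K: "0 \<le> K" "\<And>t. norm (poly (exp_poly_step (Q i) k) (complex_of_real t)) \<le> K * (1 + t\<^sup>2) ^ m"
      using norm_poly_of_real_le by metis
    have "(1 + t\<^sup>2) ^ N * norm (u i k t) \<le> K * (fact (N + m) / a ^ (N + m) * exp a)" for t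
    proof -
      have "norm (u i k t) \<le> (K * (1 + t\<^sup>2) ^ m) * exp (- a * t\<^sup>2)"
        unfolding u_def norm_mult using K Q[of i t] by (intro mult_mono) (auto simp: norm_exp_eq_Re)
      then have "(1 + t\<^sup>2) ^ N * norm (u i k t) \<le> (1 + t\<^sup>2) ^ N * ((K * (1 + t\<^sup>2) ^ m) * exp (- a * t\<^sup>2))"
        by (intro mult_left_mono) auto
      also have "\<dots> = K * ((1 + t\<^sup>2) ^ (N + m) * exp (- a * t\<^sup>2))"
        by (simp add: power_add)
      \<comment> \<open>The power is compared with exp of a (1 + t^2); the Gaussian cancels all of
        it but the constant exp a.\<close>
      also have "\<dots> \<le> K * (fact (N + m) / a ^ (N + m) * exp (a * (1 + t\<^sup>2)) * exp (- a * t\<^sup>2))"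
        using \<open>0 < a\<close> K by (intro mult_left_mono mult_right_mono power_le_exp) auto
      also have "exp (a * (1 + t\<^sup>2)) = exp a * exp (a * t\<^sup>2)"
        by (simp add: distrib_left exp_add)
      finally show ?thesis by (simp add: mult.assoc flip: exp_add)
    qed
    then show ?thesis by blast
  qed
  show "f \<in> schwartz" unfolding f by (intro schwartz_prod_coord d b)
  show "foldr partial_deriv js f =
      (\<lambda>x. (\<Prod>i\<in>UNIV. poly (exp_poly_step (Q i) (count_list js i)) (of_real (x $ i))) * f x)"
    unfolding f foldr_partial_deriv_prod_coord[of u, OF d] by (simp add: u_def prod.distrib)
qed

section \<open>Real powers of quadratic weights\<close>

text \<open>Each differentiation lowers the exponent of W by one, so bounds are needed for all real
  exponents. Positive powers use \<open>upper\<close>; negative ones use \<open>lower\<close>, which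
  allows W to be small as long as 1/W grows at most like \<open>jap\<close>. The stable set of
  families lets the exponent vary.\<close>

lemma schwartz_family_weight_powr:
  fixes W :: "'r \<Rightarrow> real^'n::finite \<Rightarrow> real" and \<Phi> :: "'r \<Rightarrow> real^'n \<Rightarrow> complex"
  assumes pos: "\<And>r x. 0 < W r x" and K: "1 \<le> K"
    and upper: "\<And>r x. W r x \<le> K * jap x" and lower: "\<And>r x. 1 \<le> K * jap x * W r x"
    and diff: "\<And>r. W r differentiable_on UNIV"
    and mult: "\<And>\<Phi>. \<Phi> \<in> schwartz_family \<Longrightarrow> (\<lambda>r x. of_real (W r x) * \<Phi> r x) \<in> schwartz_family"
    and dmult: "\<And>\<Phi> i. \<Phi> \<in> schwartz_family \<Longrightarrow>
      (\<lambda>r x. of_real (frechet_derivative (W r) (at x) (axis i 1)) * \<Phi> r x) \<in> schwartz_family"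
    and \<Phi>: "\<Phi> \<in> schwartz_family"
  shows "(\<lambda>r x. of_real (W r x powr t) * \<Phi> r x) \<in> schwartz_family"
proof (rule schwartz_family_coinduct)
  let ?S = "{(\<lambda>(r::'r) (x::real^'n). complex_of_real (W r x powr t) * \<Phi> r x) |\<Phi> t. \<Phi> \<in> schwartz_family}"
  show "(\<lambda>r x. of_real (W r x powr t) * \<Phi> r x) \<in> ?S" using \<Phi> by blast
  fix \<Theta> :: "'r \<Rightarrow> real^'n \<Rightarrow> complex" assume "\<Theta> \<in> ?S"
  then obtain \<Phi> t where \<Theta>: "\<Theta> = (\<lambda>r x. of_real (W r x powr t) * \<Phi> r x)" "\<Phi> \<in> schwartz_family"
    by blast
  have D: "((\<lambda>x. complex_of_real (W r x powr t)) has_derivative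
     (\<lambda>h. of_real (t * W r x powr (t - 1) * frechet_derivative (W r) (at x) h))) (at x)" for r x
  proof -
    have "((\<lambda>z. z powr t) has_derivative (*) (t * W r x powr (t - 1))) (at (W r x))"
      using has_real_derivative_powr[OF pos] unfolding has_field_derivative_def .
    from has_derivative_compose[OF has_derivative_frechet[OF diff] this]
    show ?thesis
      by (intro bounded_linear.has_derivative[OF bounded_linear_of_real]) (simp add: mult.assoc)
  qed
  then have diffp: "(\<lambda>x. complex_of_real (W r x powr t)) differentiable_on UNIV" for r
    unfolding differentiable_on_def differentiable_def by blast
  show "\<Theta> r differentiable_on UNIV" for r
    unfolding \<Theta>(1) by (intro differentiable_on_mult diffp schwartz_family_differentiable \<Theta>(2))
  show "rapid \<Theta>"
    unfolding \<Theta>(1)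
  proof (rule rapid_mult)
    show "rapid \<Phi>" by (intro schwartz_family_rapid \<Theta>(2))
    define m where "m = nat \<lceil>\<bar>t\<bar>\<rceil>"
    show "norm (complex_of_real (W r x powr t)) \<le> K ^ m * jap x ^ m" for r x
    proof -
      have Kj: "1 \<le> K * jap x" using mult_mono[OF K jap_ge_1[of x]] K by simp
      have "W r x powr t \<le> (K * jap x) powr \<bar>t\<bar>"
      proof (cases "0 \<le> t")
        case True
        then show ?thesis using upper[of r x] pos[of r x] by (simp add: powr_mono2)
      next
        case False
        have "inverse (W r x) \<le> K * jap x" using lower[of x r] pos[of r x] by (simp add: field_simps)
        then have "inverse (W r x) powr - t \<le> (K * jap x) powr - t"
          using False pos[of r x] by (intro powr_mono2) (auto intro: less_imp_le)
        then show ?thesis using False pos[of r x] by (simp add: inverse_powr powr_minus)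
      qed
      also have "\<dots> \<le> (K * jap x) powr real m"
        using Kj by (intro powr_mono) (auto simp: m_def)
      also have "\<dots> = K ^ m * jap x ^ m"
        using Kj by (subst powr_realpow) (auto simp: power_mult_distrib)
      finally show ?thesis by simp
    qed
  qed
  show "(\<lambda>r. partial_deriv i (\<Theta> r)) \<in> ?S" for i
  proof -
    \<comment> \<open>The derivative is brought to the common factor W^(t-1): the undifferentiated
      power is split as W^(t-1) W, and the spare W goes into \<Psi>, where \<open>mult\<close>
      handles it.\<close>
    define \<Psi> where "\<Psi> = (\<lambda>r x. of_real (W r x) * partial_deriv i (\<Phi> r) x +
       of_real t * (of_real (frechet_derivative (W r) (at x) (axis i 1)) * \<Phi> r x))"
    have "partial_deriv i (\<Theta> r) x = of_real (W r x powr (t - 1)) * \<Psi> r x" for r x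
    proof -
      have "W r x powr t = W r x powr (t - 1) * W r x"
        using pos[of r x] by (simp add: powr_diff)
      then show ?thesis
        unfolding \<Theta>(1) \<Psi>_def
        by (subst partial_deriv_mult[OF diffp schwartz_family_differentiable[OF \<Theta>(2)]])
           (simp add: partial_deriv_eq[OF D] algebra_simps)
    qed
    moreover have "\<Psi> \<in> schwartz_family"
      unfolding \<Psi>_def
      by (intro schwartz_family_add schwartz_family_cmult mult dmult schwartz_family_partial_deriv \<Theta>(2))
    ultimately show ?thesis
      by (intro CollectI exI[of _ \<Psi>] exI[of _ "t - 1"]) auto
  qed
qed

text \<open>Common form of two weights: parameters (1, 1, 0) give \<open>jap\<close>, and (R^(-2),
  1/R, 1) give the symbol base translated by (R,...,R) and divided by R^2.\<close>

definition quad_weight :: "real \<Rightarrow> real \<Rightarrow> real \<Rightarrow> real^'n::finite \<Rightarrow> real" where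
  "quad_weight a b c x = a + (\<Sum>i\<in>UNIV. (b * x $ i + c)\<^sup>2)"

lemma quad_weight_has_derivative:
  "(quad_weight a b c has_derivative (\<lambda>h. \<Sum>i\<in>UNIV. 2 * (b * x $ i + c) * (b * h $ i))) (at x)"
proof -
  have "((\<lambda>x. x $ i) has_derivative (\<lambda>h. h $ i)) (at x)" for i
    by (intro bounded_linear_imp_has_derivative bounded_linear_vec_nth)
  then show ?thesis
    unfolding quad_weight_def[abs_def]
    by (auto intro!: derivative_eq_intros simp: power2_eq_square algebra_simps)
qed

lemma frechet_derivative_quad_weight:
  "frechet_derivative (quad_weight a b c) (at x) (axis i 1) = 2 * (b * x $ i + c) * b"
proof -
  have "(\<Sum>j\<in>UNIV. 2 * (b * x $ j + c) * (b * axis i 1 $ j)) =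
      (\<Sum>j\<in>UNIV. if i = j then 2 * (b * x $ i + c) * b else 0)"
    by (intro sum.cong) (auto simp: axis_def)
  then show ?thesis
    by (simp add: frechet_derivative_at[OF quad_weight_has_derivative, symmetric])
qed

lemma schwartz_family_quad_weight_powr:
  fixes a b c :: "'r \<Rightarrow> real" and \<Phi> :: "'r \<Rightarrow> real^'n::finite \<Rightarrow> complex"
  assumes a: "\<And>r. 0 < a r" "\<And>r. \<bar>a r\<bar> \<le> 1" and b: "\<And>r. \<bar>b r\<bar> \<le> 1" and c: "\<And>r. \<bar>c r\<bar> \<le> 1"
    and K: "1 \<le> K" and lower: "\<And>r x. 1 \<le> K * jap x * quad_weight (a r) (b r) (c r) (x::real^'n)"
    and \<Phi>: "\<Phi> \<in> schwartz_family"
  shows "(\<lambda>r x. of_real (quad_weight (a r) (b r) (c r) x powr t) * \<Phi> r x) \<in> schwartz_family"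
\<comment> \<open>One constant for both bounds: \<open>K\<close> serves the lower one; the upper one
  is at most 2 \<open>jap x\<close> + 2n, from (b x_i + c)^2 \<le> 2 x_i^2 + 2.\<close>
proof (rule schwartz_family_weight_powr[where K = "K + 2 + 2 * CARD('n)"])
  show "0 < quad_weight (a r) (b r) (c r) x" for r and x :: "real^'n"
    using a by (simp add: quad_weight_def add_pos_nonneg sum_nonneg)
  then show "1 \<le> (K + 2 + 2 * CARD('n)) * jap x * quad_weight (a r) (b r) (c r) x" for r and x :: "real^'n"
    using jap_pos[of x] by (intro order_trans[OF lower[of x r]] mult_right_mono) (auto intro: less_imp_le)
  show "1 \<le> K + 2 + 2 * CARD('n)" using K by simp
  show "quad_weight (a r) (b r) (c r) x \<le> (K + 2 + 2 * CARD('n)) * jap x" for r and x :: "real^'n"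
  proof -
    have "(b r * x $ i + c r)\<^sup>2 \<le> 2 * (x $ i)\<^sup>2 + 2" for i
    proof -
      have "(b r * x $ i + c r)\<^sup>2 \<le> 2 * (b r * x $ i)\<^sup>2 + 2 * (c r)\<^sup>2"
        using zero_le_power2[of "b r * x $ i - c r"] by (simp add: power2_eq_square algebra_simps)
      moreover have "(c r)\<^sup>2 \<le> 1" using c[of r] by (simp add: abs_square_le_1)
      moreover have "(b r)\<^sup>2 * (x $ i)\<^sup>2 \<le> 1 * (x $ i)\<^sup>2"
        using b[of r] by (intro mult_right_mono) (simp_all add: abs_square_le_1)
      ultimately show ?thesis by (simp add: power_mult_distrib)
    qed
    then have "(\<Sum>i\<in>UNIV. (b r * x $ i + c r)\<^sup>2) \<le> (\<Sum>i\<in>UNIV. 2 * (x $ i)\<^sup>2 + 2)"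
      by (intro sum_mono)
    also have "\<dots> = 2 * (jap x - 1) + 2 * CARD('n)"
      by (simp add: jap_vec sum.distrib sum_distrib_left)
    finally have "quad_weight (a r) (b r) (c r) x \<le> 2 * jap x + 2 * CARD('n) * 1"
      using a(2)[of r] by (simp add: quad_weight_def)
    also have "\<dots> \<le> 2 * jap x + 2 * CARD('n) * jap x"
      using jap_ge_1[of x] by (intro add_left_mono mult_left_mono) auto
    also have "\<dots> \<le> (K + 2 + 2 * CARD('n)) * jap x"
      using K jap_pos[of x] by (simp add: algebra_simps)
    finally show ?thesis .
  qed
  show "quad_weight (a r) (b r) (c r) differentiable_on UNIV" for r
    unfolding differentiable_on_def differentiable_def using quad_weight_has_derivative by blast
  have lin: "(\<lambda>r x. (of_real (b r) * of_real (x $ i) + of_real (c r)) * \<Psi> r x) \<in> schwartz_family"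
    if \<Psi>: "\<Psi> \<in> schwartz_family" for \<Psi> :: "'r \<Rightarrow> real^'n \<Rightarrow> complex" and i
  proof -
    have "(\<lambda>r x. of_real (b r) * (of_real (x $ i) * \<Psi> r x) + of_real (c r) * \<Psi> r x) \<in> schwartz_family"
      using b c by (intro schwartz_family_add schwartz_family_scale[where K = 1] schwartz_family_coord \<Psi>) auto
    then show ?thesis by (simp add: algebra_simps)
  qed
  show "(\<lambda>r x. of_real (quad_weight (a r) (b r) (c r) x) * \<Psi> r x) \<in> schwartz_family"
    if \<Psi>: "\<Psi> \<in> schwartz_family" for \<Psi> :: "'r \<Rightarrow> real^'n \<Rightarrow> complex"
  proof -
    have "(\<lambda>r x. of_real (a r) * \<Psi> r x + (\<Sum>i\<in>UNIV. (of_real (b r) * of_real (x $ i) + of_real (c r)) *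
        ((of_real (b r) * of_real (x $ i) + of_real (c r)) * \<Psi> r x))) \<in> schwartz_family"
      using a by (intro schwartz_family_add schwartz_family_scale[where K = 1] schwartz_family_sum lin \<Psi>) auto
    then show ?thesis
      by (simp add: quad_weight_def distrib_right sum_distrib_right power2_eq_square mult.assoc)
  qed
  show "(\<lambda>r x. of_real (frechet_derivative (quad_weight (a r) (b r) (c r)) (at x) (axis i 1)) * \<Psi> r x) \<in> schwartz_family"
    if \<Psi>: "\<Psi> \<in> schwartz_family" for \<Psi> :: "'r \<Rightarrow> real^'n \<Rightarrow> complex" and i
  proof -
    have "(\<lambda>r x. of_real (2 * b r) * ((of_real (b r) * of_real (x $ i) + of_real (c r)) * \<Psi> r x)) \<in> schwartz_family"
      using b by (intro schwartz_family_scale[where K = 2] lin \<Psi>) (simp add: norm_mult)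
    then show ?thesis
      by (simp add: frechet_derivative_quad_weight algebra_simps)
  qed
  show "\<Phi> \<in> schwartz_family" by (rule \<Phi>)
qed

lemma schwartz_family_jap_powr:
  fixes \<Phi> :: "'r \<Rightarrow> real^'n::finite \<Rightarrow> complex"
  assumes "\<Phi> \<in> schwartz_family"
  shows "(\<lambda>r x. of_real (jap x powr t) * \<Phi> r x) \<in> schwartz_family"
proof -
  have j: "quad_weight 1 1 0 x = jap x" for x :: "real^'n"
    by (simp add: quad_weight_def jap_vec)
  have "1 \<le> 1 * jap x * jap x" for x :: "real^'n"
    using mult_mono[OF jap_ge_1 jap_ge_1, of x x] jap_pos[of x] by simp
  then show ?thesis
    using schwartz_family_quad_weight_powr[of "\<lambda>_. 1" "\<lambda>_. 1" "\<lambda>_. 0" 1 \<Phi> t] assms by (simp add: j)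
qed

text \<open>The weight falls to l^2 at the point with all coordinates -1/l, so it has no positive
  lower bound uniform in l. But \<open>jap\<close> exceeds 1/l^2 there, and the product of the two
  stays above 1/4 everywhere.\<close>

lemma schwartz_family_shifted_weight_powr:
  fixes l :: "'r \<Rightarrow> real" and \<Phi> :: "'r \<Rightarrow> real^'n::finite \<Rightarrow> complex"
  assumes l: "\<And>r. 0 < l r" "\<And>r. l r \<le> 1" and "\<Phi> \<in> schwartz_family"
  shows "(\<lambda>r x. of_real (quad_weight ((l r)\<^sup>2) (l r) 1 x powr t) * \<Phi> r x) \<in> schwartz_family"
proof (rule schwartz_family_quad_weight_powr[where K = 4])
  show "1 \<le> 4 * jap x * quad_weight ((l r)\<^sup>2) (l r) 1 x" for r and x :: "real^'n"
  proof -
    \<comment> \<open>A single coordinate already yields the lower bound; one exists because types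
      are nonempty.\<close>
    fix i :: 'n
    let ?y = "l r * x $ i + 1"
    have "?y\<^sup>2 \<le> (\<Sum>i\<in>UNIV. (l r * x $ i + 1)\<^sup>2)" by (intro member_le_sum) auto
    then have q: "(l r)\<^sup>2 + ?y\<^sup>2 \<le> quad_weight ((l r)\<^sup>2) (l r) 1 x" by (simp add: quad_weight_def)
    have "1 \<le> (1 + (x $ i)\<^sup>2) * (4 * ((l r)\<^sup>2 + ?y\<^sup>2))"
    proof -
      text \<open>As \<open>1 = (l x\<^sub>i + 1) - l x\<^sub>i\<close>, one has \<open>1 \<le> 2 (l x\<^sub>i + 1)\<^sup>2 + 2 l\<^sup>2 x\<^sub>i\<^sup>2\<close>.\<close>
      have "1 \<le> 2 * ?y\<^sup>2 + 2 * ((l r)\<^sup>2 * (x $ i)\<^sup>2)"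
        using zero_le_power2[of "2 * (l r * x $ i) + 1"] by (simp add: power2_eq_square algebra_simps)
      moreover have "0 \<le> (x $ i)\<^sup>2 * ?y\<^sup>2" "0 \<le> (l r)\<^sup>2 * (x $ i)\<^sup>2" "0 \<le> (l r)\<^sup>2" "0 \<le> ?y\<^sup>2" by auto
      ultimately have "1 \<le> 4 * (l r)\<^sup>2 + 4 * ?y\<^sup>2 + 4 * ((l r)\<^sup>2 * (x $ i)\<^sup>2) + 4 * ((x $ i)\<^sup>2 * ?y\<^sup>2)"
        by linarith
      also have "\<dots> = (1 + (x $ i)\<^sup>2) * (4 * ((l r)\<^sup>2 + ?y\<^sup>2))"
        by (simp add: algebra_simps)
      finally show ?thesis .
    qed
    also have "\<dots> \<le> jap x * (4 * quad_weight ((l r)\<^sup>2) (l r) 1 x)"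
      using jap_pos[of x] q by (intro mult_mono jap_coord mult_left_mono) auto
    finally show ?thesis by simp
  qed
qed (use assms in \<open>auto simp: abs_square_le_1 less_imp_le l(1)[THEN less_imp_neq, symmetric]\<close>)

section \<open>Integration by parts\<close>

lemma continuous_borel: "continuous_on UNIV f \<Longrightarrow> f \<in> borel_measurable borel"
  by (rule borel_measurable_continuous_onI)

lemma schwartz_family_measurable:
  "\<Phi> \<in> schwartz_family \<Longrightarrow> \<Phi> r \<in> borel_measurable borel"
  by (intro continuous_borel smooth_continuous schwartz_family_smooth)

lemma schwartz_family_bound:
  assumes "\<Phi> \<in> schwartz_family"
  obtains C where "0 \<le> C" "\<And>r x. jap x ^ N * norm (\<Phi> r x) \<le> C"
proof -
  obtain C where "\<And>r x. jap x ^ N * norm (\<Phi> r x) \<le> C"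
    using schwartz_family_rapid[OF assms] unfolding rapid_def by blast
  then show ?thesis
    by (intro that[of "\<bar>C\<bar>"]) (auto intro: order_trans[OF _ abs_ge_self])
qed

lemma schwartz_family_integrable:
  fixes \<Phi> :: "'r \<Rightarrow> real^'n::finite \<Rightarrow> complex"
  assumes "\<Phi> \<in> schwartz_family"
  shows "integrable lborel (\<Phi> r)"
proof -
  obtain C where "\<And>r x. jap x ^ CARD('n) * norm (\<Phi> r x) \<le> C"
    using schwartz_family_bound[OF assms] by metis
  then show ?thesis by (intro integrable_jap_bound schwartz_family_measurable assms)
qed

lemma integrable_bounded_mult:
  fixes f g :: "'a \<Rightarrow> complex"
  assumes "integrable M f" "g \<in> borel_measurable M" "\<And>x. norm (g x) \<le> K"
  shows "integrable M (\<lambda>x. f x * g x)"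
proof (rule Bochner_Integration.integrable_bound)
  show "integrable M (\<lambda>x. K * norm (f x))" using assms by auto
  show "(\<lambda>x. f x * g x) \<in> borel_measurable M" using assms by auto
  have "norm (f x * g x) \<le> norm (K * norm (f x))" for x
    using mult_left_mono[OF assms(3)[of x] norm_ge_zero[of "f x"]]
    by (simp add: norm_mult mult.commute)
  then show "AE x in M. norm (f x * g x) \<le> norm (K * norm (f x))" by simp
qed

lemma lborel_integral_shift:
  fixes f :: "'a::euclidean_space \<Rightarrow> 'b::{banach, second_countable_topology}"
  assumes "f \<in> borel_measurable borel"
  shows "(LINT x|lborel. f (x + c)) = (LINT x|lborel. f x)"
    and "integrable lborel (\<lambda>x. f (x + c)) \<longleftrightarrow> integrable lborel f"
proof -
  have "(LINT x|lborel. f x) = (LINT x|distr lborel borel ((+) c). f x)"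
    by (simp add: lborel_distr_plus)
  also have "\<dots> = (LINT x|lborel. f (c + x))"
    using assms by (subst integral_distr) auto
  finally show "(LINT x|lborel. f (x + c)) = (LINT x|lborel. f x)" by (simp add: add.commute)
  have "integrable lborel f \<longleftrightarrow> integrable (distr lborel borel ((+) c)) f"
    by (simp add: lborel_distr_plus)
  also have "\<dots> \<longleftrightarrow> integrable lborel (\<lambda>x. f (c + x))"
    using assms by (subst integrable_distr_eq) auto
  finally show "integrable lborel (\<lambda>x. f (x + c)) \<longleftrightarrow> integrable lborel f" by (simp add: add.commute)
qed

text \<open>Weights at points of distance at most 1 are comparable. This gives the difference
  quotients below a majorant independent of the step length.\<close>

lemma jap_le_shift:
  assumes "norm y \<le> 1"
  shows "jap x \<le> 3 * jap (x + y)"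
proof -
  have "norm x \<le> norm (x + y) + norm y" by (metis add_diff_cancel norm_triangle_ineq4)
  then have "norm x \<le> norm (x + y) + 1" using assms by linarith
  then have "(norm x)\<^sup>2 \<le> (norm (x + y) + 1)\<^sup>2" by (intro power_mono) auto
  also have "\<dots> \<le> 2 * (norm (x + y))\<^sup>2 + 2"
    using zero_le_power2[of "norm (x + y) - 1"] by (simp add: power2_eq_square algebra_simps)
  also have "\<dots> \<le> 3 * (norm (x + y))\<^sup>2 + 2" by simp
  finally show ?thesis by (simp add: jap_def)
qed

text \<open>By translation invariance all difference quotients have integral zero; pass to the limit.\<close>

lemma integral_partial_deriv_eq_0:
  fixes F :: "real^'n::finite \<Rightarrow> complex"
  assumes F: "F differentiable_on UNIV" "integrable lborel F"
    and bound: "\<And>x. jap x ^ CARD('n) * norm (partial_deriv i F x) \<le> C"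
  shows "(LINT x|lborel. partial_deriv i F x) = 0"
proof -
  define e :: "real^'n" where "e = axis i 1"
  define h where "h n = inverse (real (Suc n))" for n
  have h: "0 < h n" "h n \<le> 1" for n by (auto simp: h_def inverse_le_1_iff)
  define q where "q n x = (F (x + h n *\<^sub>R e) - F x) /\<^sub>R h n" for n x
  have m [measurable]: "F \<in> borel_measurable borel"
    by (intro continuous_borel differentiable_imp_continuous_on F)
  have lim: "(\<lambda>n. q n x) \<longlonglongrightarrow> partial_deriv i F x" for x
  proof -
    have "((\<lambda>t. F (x + t *\<^sub>R e)) has_vector_derivative partial_deriv i F x) (at 0)"
      using has_vector_derivative_partial_deriv[OF F(1), of x i 0] by (simp add: e_def)
    then have l: "((\<lambda>t. norm ((F (x + t *\<^sub>R e) - F x - t *\<^sub>R partial_deriv i F x) /\<^sub>R \<bar>t\<bar>)) \<longlongrightarrow> 0) (at 0)"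
      by (intro tendsto_norm_zero) (simp add: has_vector_derivative_def has_derivative_def)
    \<comment> \<open>The derivative as unfolded divides by |t|; under the norm this is the same as
      dividing by t.\<close>
    have eq: "norm ((F (x + t *\<^sub>R e) - F x - t *\<^sub>R partial_deriv i F x) /\<^sub>R \<bar>t\<bar>)
        = norm ((F (x + t *\<^sub>R e) - F x) /\<^sub>R t - partial_deriv i F x)" if "t \<noteq> 0" for t
    proof -
      have "(F (x + t *\<^sub>R e) - F x) /\<^sub>R t - partial_deriv i F x
          = (F (x + t *\<^sub>R e) - F x - t *\<^sub>R partial_deriv i F x) /\<^sub>R t"
        using that by (simp add: scaleR_diff_right)
      then show ?thesis by simp
    qed
    have "((\<lambda>t. norm ((F (x + t *\<^sub>R e) - F x) /\<^sub>R t - partial_deriv i F x)) \<longlongrightarrow> 0) (at 0)"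
      by (rule Lim_transform_eventually[OF l], rule eventually_mono[OF eventually_neq_at_within[of 0]]) (rule eq)
    then have "((\<lambda>t. (F (x + t *\<^sub>R e) - F x) /\<^sub>R t) \<longlongrightarrow> partial_deriv i F x) (at 0)"
      by (rule LIM_zero_cancel[OF tendsto_norm_zero_cancel])
    moreover have "filterlim h (at 0) sequentially"
      using LIMSEQ_inverse_real_of_nat h unfolding filterlim_at h_def by auto
    ultimately show "(\<lambda>n. q n x) \<longlonglongrightarrow> partial_deriv i F x"
      unfolding q_def by (rule filterlim_compose)
  qed
  have "(\<lambda>n. LINT x|lborel. q n x) \<longlonglongrightarrow> (LINT x|lborel. partial_deriv i F x)"
  proof (rule integral_dominated_convergence)
    show "AE x in lborel. (\<lambda>n. q n x) \<longlonglongrightarrow> partial_deriv i F x" using lim by simp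
    show "q n \<in> borel_measurable lborel" for n unfolding q_def by measurable
    show "partial_deriv i F \<in> borel_measurable lborel"
      unfolding measurable_lborel2
    \<comment> \<open>F is only assumed differentiable, so the derivative is measurable as a
      pointwise limit of difference quotients.\<close>
    proof (rule borel_measurable_LIMSEQ_metric)
      show "q n \<in> borel_measurable borel" for n unfolding q_def by measurable
    qed (use lim in auto)
    show "integrable lborel (\<lambda>x::real^'n. 3 ^ CARD('n) * C * inverse (jap x ^ CARD('n)))"
      by (intro integrable_mult_right integrable_inverse_jap_power)
    show "AE x in lborel. norm (q n x) \<le> 3 ^ CARD('n) * C * inverse (jap x ^ CARD('n))" for n
    proof (rule AE_I2)
      fix x :: "real^'n"
      \<comment> \<open>The derivative on the whole segment is bounded in terms of its starting
        point, so the mean value inequality passes the bound to the quotient.\<close>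
      have "norm (partial_deriv i F (x + t *\<^sub>R e)) \<le> 3 ^ CARD('n) * C * inverse (jap x ^ CARD('n))"
        if "0 \<le> t" "t \<le> h n" for t
      proof -
        have "norm (t *\<^sub>R e) \<le> 1" using that h(2)[of n] by (simp add: e_def)
        then have "jap x ^ CARD('n) \<le> (3 * jap (x + t *\<^sub>R e)) ^ CARD('n)"
          using jap_pos[of x] by (intro power_mono jap_le_shift) auto
        then have "jap x ^ CARD('n) * norm (partial_deriv i F (x + t *\<^sub>R e))
          \<le> (3 * jap (x + t *\<^sub>R e)) ^ CARD('n) * norm (partial_deriv i F (x + t *\<^sub>R e))"
          by (intro mult_right_mono) auto
        also have "\<dots> \<le> 3 ^ CARD('n) * C"
          using bound[of "x + t *\<^sub>R e"] by (simp add: power_mult_distrib mult.assoc)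
        finally show ?thesis using jap_pos[of x] by (simp add: field_simps)
      qed
      then have "norm (F (x + h n *\<^sub>R e) - F (x + 0 *\<^sub>R e)) \<le> 3 ^ CARD('n) * C * inverse (jap x ^ CARD('n)) * h n"
        using h(1)[of n] has_vector_derivative_partial_deriv[OF F(1)]
        by (intro norm_increment_le) (auto simp: e_def)
      then show "norm (q n x) \<le> 3 ^ CARD('n) * C * inverse (jap x ^ CARD('n))"
        using h(1)[of n] by (simp add: q_def divide_le_eq flip: divide_inverse_commute)
    qed
  qed
  moreover have "(LINT x|lborel. q n x) = 0" for n
    unfolding q_def using F(2) lborel_integral_shift[OF m, of "h n *\<^sub>R e"]
    by (simp add: Bochner_Integration.integral_diff)
  ultimately show ?thesis by (simp add: LIMSEQ_const_iff)
qed

text \<open>Decay is asked of the products rather than of the factors, so that one factor may be a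
  plane wave, which does not decay.\<close>

lemma integral_by_parts:
  fixes f g :: "real^'n::finite \<Rightarrow> complex"
  assumes f: "f differentiable_on UNIV" and g: "g differentiable_on UNIV"
    and b: "\<And>x. jap x ^ CARD('n) * norm (f x * g x) \<le> A"
    and bf: "\<And>x. jap x ^ CARD('n) * norm (partial_deriv i f x * g x) \<le> B"
    and bg: "\<And>x. jap x ^ CARD('n) * norm (f x * partial_deriv i g x) \<le> C"
    and cf: "partial_deriv i f \<in> borel_measurable borel" and cg: "partial_deriv i g \<in> borel_measurable borel"
  shows "(LINT x|lborel. partial_deriv i f x * g x) = - (LINT x|lborel. f x * partial_deriv i g x)"
proof -
  have [measurable]: "f \<in> borel_measurable borel" "g \<in> borel_measurable borel"
    by (intro continuous_borel differentiable_imp_continuous_on f g)+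
  note [measurable] = cf cg
  have i1: "integrable lborel (\<lambda>x. partial_deriv i f x * g x)"
    by (rule integrable_jap_bound[OF _ bf]) measurable
  have i2: "integrable lborel (\<lambda>x. f x * partial_deriv i g x)"
    by (rule integrable_jap_bound[OF _ bg]) measurable
  have "(LINT x|lborel. partial_deriv i (\<lambda>x. f x * g x) x) = 0"
  proof (rule integral_partial_deriv_eq_0)
    show "(\<lambda>x. f x * g x) differentiable_on UNIV" by (intro differentiable_on_mult f g)
    show "integrable lborel (\<lambda>x. f x * g x)"
      by (rule integrable_jap_bound[OF _ b]) measurable
    fix x
    have "jap x ^ CARD('n) * norm (partial_deriv i (\<lambda>x. f x * g x) x)
      \<le> jap x ^ CARD('n) * (norm (f x * partial_deriv i g x) + norm (partial_deriv i f x * g x))"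
      using jap_pos[of x] by (simp add: partial_deriv_mult f g norm_triangle_ineq)
    also have "\<dots> \<le> C + B" using bf[of x] bg[of x] by (simp add: distrib_left)
    finally show "jap x ^ CARD('n) * norm (partial_deriv i (\<lambda>x. f x * g x) x) \<le> C + B" .
  qed
  then show ?thesis using i1 i2 by (simp add: partial_deriv_mult f g eq_neg_iff_add_eq_0 add.commute)
qed

section \<open>The Fourier transform on Schwartz functions\<close>

text \<open>Both transforms at once: c = -1 is the forward one, c = 1 the inverse one.\<close>

definition fourier_kernel :: "real \<Rightarrow> (real^'n::finite \<Rightarrow> complex) \<Rightarrow> real^'n \<Rightarrow> complex" where
  "fourier_kernel c f \<xi> = of_real ((2 * pi) powr (- real CARD('n) / 2)) *
     (LINT x|lborel. f x * exp (\<i> * of_real (c * (x \<bullet> \<xi>))))"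

lemma fourier_eq_kernel: "fourier = fourier_kernel (- 1)"
  by (intro ext) (simp add: fourier_def fourier_kernel_def)

lemma inv_fourier_eq_kernel: "inv_fourier = fourier_kernel 1"
  by (intro ext) (simp add: inv_fourier_def fourier_kernel_def inner_commute)

lemma norm_exp_i [simp]: "norm (exp (\<i> * of_real y)) = 1"
  by (simp add: norm_exp_eq_Re)

lemma measurable_exp_inner [measurable]:
  "(\<lambda>x. exp (\<i> * of_real (c * (x \<bullet> \<xi>)))) \<in> borel_measurable borel"
  by (intro continuous_borel continuous_intros)

lemma integrable_exp_inner:
  "integrable lborel f \<Longrightarrow> integrable lborel (\<lambda>x. f x * exp (\<i> * of_real (c * (x \<bullet> \<xi>))))"
  by (rule integrable_bounded_mult[where K = 1]) auto

lemma fourier_kernel_add: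
  "integrable lborel f \<Longrightarrow> integrable lborel g \<Longrightarrow>
    fourier_kernel c (\<lambda>x. f x + g x) \<xi> = fourier_kernel c f \<xi> + fourier_kernel c g \<xi>"
  using integrable_exp_inner[of f c \<xi>] integrable_exp_inner[of g c \<xi>]
  by (simp add: fourier_kernel_def distrib_right Bochner_Integration.integral_add distrib_left)

lemma fourier_kernel_cmult: "fourier_kernel c (\<lambda>x. a * f x) \<xi> = a * fourier_kernel c f \<xi>"
  by (simp add: fourier_kernel_def mult.assoc mult.left_commute)

lemma fourier_kernel_zero: "fourier_kernel c (\<lambda>x. 0) \<xi> = 0"
  by (simp add: fourier_kernel_def)

lemma fourier_kernel_sum:
  assumes "\<And>i. i \<in> A \<Longrightarrow> integrable lborel (f i)"
  shows "fourier_kernel c (\<lambda>x. \<Sum>i\<in>A. f i x) \<xi> = (\<Sum>i\<in>A. fourier_kernel c (f i) \<xi>)"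
  using assms
  by (induction A rule: infinite_finite_induct) (simp_all add: fourier_kernel_zero fourier_kernel_add)

lemma norm_exp_i_taylor: "norm (exp (\<i> * of_real y) - 1 - \<i> * of_real y) \<le> y\<^sup>2"
proof -
  have "norm (exp (\<i> * of_real y) - (\<Sum>k\<le>1. (\<i> * of_real y) ^ k / fact k)) \<le> \<bar>y\<bar> ^ Suc 1 / fact (Suc 1)"
    by (rule iexp_approx1)
  also have "\<bar>y\<bar> ^ Suc 1 / fact (Suc 1) = y\<^sup>2 / 2" by (simp add: power2_eq_square)
  also have "\<dots> \<le> y\<^sup>2" by simp
  finally show ?thesis by (simp add: atMost_Suc algebra_simps)
qed

text \<open>The increment of the plane wave is expanded to first order under the integral. Its
  remainder is at most (c (x . h))^2, and the decay of \<Phi> integrates this to a multiple of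
  |h|^2.\<close>

lemma fourier_kernel_has_derivative:
  fixes \<Phi> :: "'r \<Rightarrow> real^'n::finite \<Rightarrow> complex"
  assumes \<Phi>: "\<Phi> \<in> schwartz_family"
  shows "(fourier_kernel c (\<Phi> r) has_derivative (\<lambda>h. \<Sum>i\<in>UNIV. (h $ i) *\<^sub>R
     fourier_kernel c (\<lambda>x. \<i> * of_real c * (of_real (x $ i) * \<Phi> r x)) \<xi>)) (at \<xi>)"
proof -
  define d where "d h = (\<Sum>i\<in>UNIV. (h $ i) *\<^sub>R
     fourier_kernel c (\<lambda>x. \<i> * of_real c * (of_real (x $ i) * \<Phi> r x)) \<xi>)" for h :: "real^'n"
  define K where "K = (of_real ((2 * pi) powr (- real CARD('n) / 2)) :: complex)"
  define e where "e x = exp (\<i> * of_real (c * (x \<bullet> \<xi>)))" for x :: "real^'n"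
  have [measurable]: "\<Phi> r \<in> borel_measurable borel" by (rule schwartz_family_measurable[OF \<Phi>])
  have ix: "integrable lborel (\<lambda>x. of_real (x $ i) * \<Phi> r x)" for i
    using schwartz_family_integrable[OF schwartz_family_coord[OF \<Phi>]] .
  have i0: "integrable lborel (\<Phi> r)" by (rule schwartz_family_integrable[OF \<Phi>])
  \<comment> \<open>n powers of decay give integrability; the additional one absorbs |x|^2 from the
    remainder.\<close>
  obtain C where C: "0 \<le> C" "\<And>x. jap x ^ Suc CARD('n) * norm (\<Phi> r x) \<le> C"
    using schwartz_family_bound[OF \<Phi>] by metis
  define M where "M = norm K * (c\<^sup>2 * C * jap_integral TYPE('n))"
  have d_eq: "d h = K * (LINT x|lborel. \<Phi> r x * e x * (\<i> * of_real (c * (x \<bullet> h))))" for h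
  proof -
    have "d h = fourier_kernel c (\<lambda>x. \<Sum>i\<in>UNIV. (of_real (h $ i) * (\<i> * of_real c)) * (of_real (x $ i) * \<Phi> r x)) \<xi>"
      unfolding d_def using ix
      by (subst fourier_kernel_sum) (auto simp: fourier_kernel_cmult scaleR_conv_of_real mult.assoc)
    also have "(\<lambda>x. \<Sum>i\<in>UNIV. (of_real (h $ i) * (\<i> * of_real c)) * (of_real (x $ i) * \<Phi> r x))
      = (\<lambda>x. \<Phi> r x * (\<i> * of_real (c * (x \<bullet> h))))"
      by (simp add: inner_vec_def sum_distrib_left sum_distrib_right mult_ac)
    finally show ?thesis by (simp add: fourier_kernel_def K_def e_def mult_ac)
  qed
  have rem: "norm (fourier_kernel c (\<Phi> r) (\<xi> + h) - fourier_kernel c (\<Phi> r) \<xi> - d h) \<le> M * (norm h)\<^sup>2" for h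
  proof -
    have lin: "integrable lborel (\<lambda>x. \<Phi> r x * e x * (\<i> * of_real (c * (x \<bullet> h))))"
    proof -
      have "integrable lborel (\<lambda>x. (\<Sum>i\<in>UNIV. (of_real (h $ i) * (\<i> * of_real c)) * (of_real (x $ i) * \<Phi> r x)) * e x)"
        unfolding e_def by (intro integrable_exp_inner Bochner_Integration.integrable_sum integrable_mult_right ix)
      then show ?thesis
        by (simp add: inner_vec_def sum_distrib_left sum_distrib_right mult_ac)
    qed
    have "fourier_kernel c (\<Phi> r) (\<xi> + h) - fourier_kernel c (\<Phi> r) \<xi> - d h
      = K * ((LINT x|lborel. \<Phi> r x * exp (\<i> * of_real (c * (x \<bullet> (\<xi> + h))))) - (LINT x|lborel. \<Phi> r x * e x)
          - (LINT x|lborel. \<Phi> r x * e x * (\<i> * of_real (c * (x \<bullet> h)))))"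
      by (simp add: d_eq fourier_kernel_def K_def e_def algebra_simps)
    also have "\<dots> = K * (LINT x|lborel. \<Phi> r x * exp (\<i> * of_real (c * (x \<bullet> (\<xi> + h)))) - \<Phi> r x * e x
          - \<Phi> r x * e x * (\<i> * of_real (c * (x \<bullet> h))))"
      using lin integrable_exp_inner[OF i0, of c \<xi>] integrable_exp_inner[OF i0, of c "\<xi> + h"]
      by (simp add: e_def)
    also have "\<dots> = K * (LINT x|lborel. \<Phi> r x * e x * (exp (\<i> * of_real (c * (x \<bullet> h))) - 1 - \<i> * of_real (c * (x \<bullet> h))))"
      by (simp add: e_def inner_add_right distrib_left exp_add algebra_simps)
    finally have eq: "norm (fourier_kernel c (\<Phi> r) (\<xi> + h) - fourier_kernel c (\<Phi> r) \<xi> - d h) =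
      norm K * norm (LINT x|lborel. \<Phi> r x * e x * (exp (\<i> * of_real (c * (x \<bullet> h))) - 1 - \<i> * of_real (c * (x \<bullet> h))))"
      by (simp add: norm_mult)
    have "norm (LINT x|lborel. \<Phi> r x * e x * (exp (\<i> * of_real (c * (x \<bullet> h))) - 1 - \<i> * of_real (c * (x \<bullet> h))))
      \<le> (c\<^sup>2 * C * (norm h)\<^sup>2) * jap_integral TYPE('n)"
    proof (rule norm_integral_jap_bound)
      show "(\<lambda>x. \<Phi> r x * e x * (exp (\<i> * of_real (c * (x \<bullet> h))) - 1 - \<i> * of_real (c * (x \<bullet> h)))) \<in> borel_measurable borel"
        unfolding e_def by measurable
      fix x :: "real^'n"
      let ?X = "exp (\<i> * of_real (c * (x \<bullet> h))) - 1 - \<i> * of_real (c * (x \<bullet> h)) :: complex"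
      have "(x \<bullet> h)\<^sup>2 \<le> (norm x * norm h)\<^sup>2"
        using Cauchy_Schwarz_ineq2[of x h] by (simp add: abs_le_square_iff[symmetric])
      also have "\<dots> \<le> jap x * (norm h)\<^sup>2"
        by (simp add: power_mult_distrib jap_def mult_right_mono)
      finally have "(c * (x \<bullet> h))\<^sup>2 \<le> c\<^sup>2 * (jap x * (norm h)\<^sup>2)"
        by (simp add: power_mult_distrib mult_left_mono)
      then have "norm ?X \<le> c\<^sup>2 * (jap x * (norm h)\<^sup>2)"
        using norm_exp_i_taylor[of "c * (x \<bullet> h)"] by linarith
      then have "jap x ^ CARD('n) * norm (\<Phi> r x) * norm ?X
        \<le> jap x ^ CARD('n) * norm (\<Phi> r x) * (c\<^sup>2 * (jap x * (norm h)\<^sup>2))"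
        using jap_pos[of x] by (intro mult_left_mono) auto
      also have "\<dots> = (c\<^sup>2 * (norm h)\<^sup>2) * (jap x ^ Suc CARD('n) * norm (\<Phi> r x))"
        by simp
      also have "\<dots> \<le> (c\<^sup>2 * (norm h)\<^sup>2) * C"
        by (intro mult_left_mono C) auto
      finally show "jap x ^ CARD('n) * norm (\<Phi> r x * e x * ?X) \<le> c\<^sup>2 * C * (norm h)\<^sup>2"
        by (simp add: norm_mult e_def mult_ac)
    qed
    then have "norm K * norm (LINT x|lborel. \<Phi> r x * e x * (exp (\<i> * of_real (c * (x \<bullet> h))) - 1 - \<i> * of_real (c * (x \<bullet> h))))
      \<le> norm K * ((c\<^sup>2 * C * (norm h)\<^sup>2) * jap_integral TYPE('n))"
      by (rule mult_left_mono) simp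
    then show ?thesis unfolding eq M_def by (simp add: mult_ac)
  qed
  have "bounded_linear d"
    unfolding d_def
    by (intro bounded_linear_sum bounded_linear_compose[OF bounded_linear_scaleR_left bounded_linear_vec_nth])
  then have "(fourier_kernel c (\<Phi> r) has_derivative d) (at \<xi>)"
  proof (rule has_derivativeI_sandwich[where e = 1 and H = "\<lambda>y. M * norm (y - \<xi>)", rotated])
    show "norm (fourier_kernel c (\<Phi> r) y - fourier_kernel c (\<Phi> r) \<xi> - d (y - \<xi>)) / norm (y - \<xi>) \<le> M * norm (y - \<xi>)"
      if "y \<noteq> \<xi>" for y
      using rem[of "y - \<xi>"] that by (simp add: divide_le_eq power2_eq_square mult.assoc)
    show "((\<lambda>y. M * norm (y - \<xi>)) \<longlongrightarrow> 0) (at \<xi>)"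
      by (auto intro!: tendsto_eq_intros)
  qed simp
  then show ?thesis unfolding d_def .
qed

lemma partial_deriv_fourier_kernel:
  assumes "\<Phi> \<in> schwartz_family"
  shows "partial_deriv i (fourier_kernel c (\<Phi> r)) =
    fourier_kernel c (\<lambda>x. \<i> * of_real c * (of_real (x $ i) * \<Phi> r x))"
proof
  fix \<xi>
  let ?d = "\<lambda>j. fourier_kernel c (\<lambda>x. \<i> * of_real c * (of_real (x $ j) * \<Phi> r x)) \<xi>"
  have "(\<Sum>j\<in>UNIV. (axis i (1::real) $ j) *\<^sub>R ?d j) = (\<Sum>j\<in>UNIV. if i = j then ?d j else 0)"
    by (intro sum.cong) (auto simp: axis_def)
  then show "partial_deriv i (fourier_kernel c (\<Phi> r)) \<xi> = ?d i"
    by (simp add: partial_deriv_eq[OF fourier_kernel_has_derivative[OF assms]])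
qed

lemma exp_inner_has_derivative:
  "((\<lambda>x. exp (\<i> * of_real (c * (x \<bullet> \<xi>)))) has_derivative
     (\<lambda>h. exp (\<i> * of_real (c * (x \<bullet> \<xi>))) * (\<i> * of_real (c * (h \<bullet> \<xi>))))) (at x)"
proof -
  have "((\<lambda>x. \<i> * complex_of_real (c * (x \<bullet> \<xi>))) has_derivative (\<lambda>h. \<i> * complex_of_real (c * (h \<bullet> \<xi>)))) (at x)"
    by (auto intro!: derivative_eq_intros)
  from has_derivative_compose[OF this DERIV_exp[unfolded has_field_derivative_def]]
  show ?thesis .
qed

lemma fourier_kernel_partial_deriv:
  fixes \<Phi> :: "'r \<Rightarrow> real^'n::finite \<Rightarrow> complex"
  assumes \<Phi>: "\<Phi> \<in> schwartz_family"
  shows "fourier_kernel c (partial_deriv i (\<Phi> r)) \<xi> = - (\<i> * of_real (c * \<xi> $ i)) * fourier_kernel c (\<Phi> r) \<xi>"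
proof -
  define e where "e x = exp (\<i> * of_real (c * (x \<bullet> \<xi>)))" for x :: "real^'n"
  have pe: "partial_deriv i e = (\<lambda>x. (\<i> * of_real (c * \<xi> $ i)) * e x)"
    unfolding e_def by (rule ext, subst partial_deriv_eq[OF exp_inner_has_derivative]) (simp add: inner_axis')
  have e1: "norm (e x) = 1" for x by (simp add: e_def)
  note \<Phi>i = schwartz_family_partial_deriv[OF \<Phi>, of i]
  obtain A where A: "\<And>x. jap x ^ CARD('n) * norm (\<Phi> r x) \<le> A"
    using schwartz_family_bound[OF \<Phi>] by metis
  obtain B where B: "\<And>x. jap x ^ CARD('n) * norm (partial_deriv i (\<Phi> r) x) \<le> B"
    using schwartz_family_bound[OF \<Phi>i] by metis
  have "(LINT x|lborel. partial_deriv i (\<Phi> r) x * e x) = - (LINT x|lborel. \<Phi> r x * partial_deriv i e x)"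
  proof (rule integral_by_parts)
    show "\<Phi> r differentiable_on UNIV" by (rule schwartz_family_differentiable[OF \<Phi>])
    show "e differentiable_on UNIV"
      unfolding differentiable_on_def differentiable_def e_def using exp_inner_has_derivative by blast
    show "jap x ^ CARD('n) * norm (\<Phi> r x * e x) \<le> A" for x using A by (simp add: norm_mult e1)
    show "jap x ^ CARD('n) * norm (partial_deriv i (\<Phi> r) x * e x) \<le> B" for x using B by (simp add: norm_mult e1)
    show "jap x ^ CARD('n) * norm (\<Phi> r x * partial_deriv i e x) \<le> \<bar>c * \<xi> $ i\<bar> * A" for x
      using mult_left_mono[OF A[of x] abs_ge_zero[of "c * \<xi> $ i"]]
      by (simp add: norm_mult e1 pe abs_mult mult_ac)
    show "partial_deriv i (\<Phi> r) \<in> borel_measurable borel" by (rule schwartz_family_measurable[OF \<Phi>i])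
    show "partial_deriv i e \<in> borel_measurable borel" unfolding pe e_def by measurable
  qed
  also have "(LINT x|lborel. \<Phi> r x * partial_deriv i e x) = (\<i> * of_real (c * \<xi> $ i)) * (LINT x|lborel. \<Phi> r x * e x)"
  proof -
    have "\<Phi> r x * partial_deriv i e x = (\<i> * of_real (c * \<xi> $ i)) * (\<Phi> r x * e x)" for x
      by (simp add: pe)
    then show ?thesis by (simp only: integral_mult_right_zero)
  qed
  finally show ?thesis
    by (simp add: fourier_kernel_def e_def mult_ac)
qed

lemma fourier_kernel_bounded:
  fixes \<Phi> :: "'r \<Rightarrow> real^'n::finite \<Rightarrow> complex"
  assumes \<Phi>: "\<Phi> \<in> schwartz_family"
  shows "\<exists>C. \<forall>r \<xi>. norm (fourier_kernel c (\<Phi> r) \<xi>) \<le> C"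
proof -
  let ?K = "of_real ((2 * pi) powr (- real CARD('n) / 2)) :: complex"
  obtain C where C: "\<And>r x. jap x ^ CARD('n) * norm (\<Phi> r x) \<le> C"
    using schwartz_family_bound[OF \<Phi>] by metis
  have "norm (fourier_kernel c (\<Phi> r) \<xi>) \<le> norm ?K * (C * jap_integral TYPE('n))" for r \<xi>
    unfolding fourier_kernel_def norm_mult
  proof (intro mult_left_mono norm_integral_jap_bound)
    have [measurable]: "\<Phi> r \<in> borel_measurable borel" by (rule schwartz_family_measurable[OF \<Phi>])
    show "(\<lambda>x. \<Phi> r x * exp (\<i> * of_real (c * (x \<bullet> \<xi>)))) \<in> borel_measurable borel" by measurable
  qed (use C in \<open>auto simp: norm_mult\<close>)
  then show ?thesis by blast
qed

text \<open>For c^2 = 1 the transform of \<Phi> minus its Laplacian is \<open>jap\<close> times the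
  transform of \<Phi>. One power of decay is thus bought by replacing \<Phi> with another family,
  which is why the induction runs over all \<Phi>.\<close>

lemma rapid_fourier_kernel:
  fixes \<Phi> :: "'r \<Rightarrow> real^'n::finite \<Rightarrow> complex"
  assumes c: "c\<^sup>2 = 1" and "\<Phi> \<in> schwartz_family"
  shows "rapid (\<lambda>r. fourier_kernel c (\<Phi> r))"
proof -
  have "\<exists>C. \<forall>r \<xi>. jap \<xi> ^ N * norm (fourier_kernel c (\<Phi> r) \<xi>) \<le> C" for N
    using assms(2)
  proof (induction N arbitrary: \<Phi>)
    case 0
    then show ?case using fourier_kernel_bounded by simp
  next
    case (Suc N)
    note \<Phi> = Suc.prems
    define \<Psi> where "\<Psi> r x = \<Phi> r x - (\<Sum>i\<in>UNIV. partial_deriv i (partial_deriv i (\<Phi> r)) x)" for r x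
    have d2: "(\<lambda>r. partial_deriv i (partial_deriv i (\<Phi> r))) \<in> schwartz_family" for i
      by (intro schwartz_family_partial_deriv \<Phi>)
    have \<Psi>: "\<Psi> \<in> schwartz_family"
      unfolding \<Psi>_def[abs_def] by (intro schwartz_family_diff schwartz_family_sum d2 \<Phi>)
    have "fourier_kernel c (\<Psi> r) \<xi> = of_real (jap \<xi>) * fourier_kernel c (\<Phi> r) \<xi>" for r \<xi>
    proof -
      let ?S = "\<lambda>x. \<Sum>i\<in>UNIV. partial_deriv i (partial_deriv i (\<Phi> r)) x"
      have S: "integrable lborel ?S"
        by (intro Bochner_Integration.integrable_sum schwartz_family_integrable[OF d2])
      have "\<Psi> r = (\<lambda>x. \<Phi> r x + (- 1) * ?S x)" by (simp add: \<Psi>_def fun_eq_iff)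
      then have "fourier_kernel c (\<Psi> r) \<xi> = fourier_kernel c (\<Phi> r) \<xi> + fourier_kernel c (\<lambda>x. (- 1) * ?S x) \<xi>"
        by (simp only: fourier_kernel_add[OF schwartz_family_integrable[OF \<Phi>] integrable_mult_right[OF S]])
      also have "fourier_kernel c (\<lambda>x. (- 1) * ?S x) \<xi> =
          (- 1) * (\<Sum>i\<in>UNIV. fourier_kernel c (partial_deriv i (partial_deriv i (\<Phi> r))) \<xi>)"
        by (simp only: fourier_kernel_cmult fourier_kernel_sum[OF schwartz_family_integrable[OF d2]])
      also have "fourier_kernel c (\<Phi> r) \<xi> + \<dots> = fourier_kernel c (\<Phi> r) \<xi> + (\<Sum>i\<in>UNIV. of_real (c\<^sup>2 * (\<xi> $ i)\<^sup>2) * fourier_kernel c (\<Phi> r) \<xi>)"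
        by (simp add: fourier_kernel_partial_deriv[OF \<Phi>] power2_eq_square
            fourier_kernel_partial_deriv[OF schwartz_family_partial_deriv[OF \<Phi>]] sum_negf mult_ac)
      also have "\<dots> = of_real (jap \<xi>) * fourier_kernel c (\<Phi> r) \<xi>"
        by (simp add: c jap_vec distrib_right sum_distrib_right)
      finally show ?thesis .
    qed
    with Suc.IH[OF \<Psi>] show ?case
      by (simp add: norm_mult mult_ac abs_of_pos[OF jap_pos])
  qed
  then show ?thesis by (simp add: rapid_def)
qed

lemma schwartz_family_fourier_kernel:
  fixes \<Phi> :: "'r \<Rightarrow> real^'n::finite \<Rightarrow> complex"
  assumes c: "c\<^sup>2 = 1" and \<Phi>: "\<Phi> \<in> schwartz_family"
  shows "(\<lambda>r. fourier_kernel c (\<Phi> r)) \<in> schwartz_family"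
proof (rule schwartz_family_coinduct)
  \<comment> \<open>The image of all Schwartz families is stable, because a derivative of a
    transform is the transform of a coordinate multiple.\<close>
  let ?S = "{(\<lambda>(r::'r). fourier_kernel c (\<Phi> r :: real^'n \<Rightarrow> complex)) |\<Phi>. \<Phi> \<in> schwartz_family}"
  show "(\<lambda>r. fourier_kernel c (\<Phi> r)) \<in> ?S" using \<Phi> by blast
  fix \<Theta> :: "'r \<Rightarrow> real^'n \<Rightarrow> complex" assume "\<Theta> \<in> ?S"
  then obtain \<Phi> where \<Theta>: "\<Theta> = (\<lambda>r. fourier_kernel c (\<Phi> r))" "\<Phi> \<in> schwartz_family"
    by blast
  show "\<Theta> r differentiable_on UNIV" for r
    unfolding \<Theta>(1) differentiable_on_def differentiable_def
    using fourier_kernel_has_derivative[OF \<Theta>(2)] by blast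
  show "rapid \<Theta>" unfolding \<Theta>(1) by (rule rapid_fourier_kernel[OF c \<Theta>(2)])
  show "(\<lambda>r. partial_deriv i (\<Theta> r)) \<in> ?S" for i
    unfolding \<Theta>(1) partial_deriv_fourier_kernel[OF \<Theta>(2)]
    by (intro CollectI exI[of _ "\<lambda>r x. \<i> * of_real c * (of_real (x $ i) * \<Phi> r x)"] conjI refl
        schwartz_family_cmult schwartz_family_coord \<Theta>(2))
qed

text \<open>Fubini with a kernel symmetric in its two arguments. This duality turns transforms of
  distributions into transforms of functions.\<close>

lemma integral_fourier_kernel_swap:
  fixes f g :: "real^'n::finite \<Rightarrow> complex"
  assumes f: "integrable lborel f" and g: "integrable lborel g"
  shows "(LINT x|lborel. f x * fourier_kernel c g x) = (LINT x|lborel. fourier_kernel c f x * g x)"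
proof -
  let ?K = "of_real ((2 * pi) powr (- real CARD('n) / 2)) :: complex"
  let ?h = "\<lambda>x y. f x * g y * exp (\<i> * of_real (c * (x \<bullet> y)))"
  have [measurable]: "f \<in> borel_measurable borel" "g \<in> borel_measurable borel" using f g by auto
  have "integrable (lborel \<Otimes>\<^sub>M lborel) (\<lambda>(x, y). ?h x y)"
  proof (rule lborel_pair.Fubini_integrable)
    show "(\<lambda>(x, y). ?h x y) \<in> borel_measurable (lborel \<Otimes>\<^sub>M lborel)" by measurable
    show "integrable lborel (\<lambda>x. LINT y|lborel. norm (case (x, y) of (x, y) \<Rightarrow> ?h x y))"
      using f g by (simp add: norm_mult)
    show "AE x in lborel. integrable lborel (\<lambda>y. case (x, y) of (x, y) \<Rightarrow> ?h x y)"
    proof (rule AE_I2)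
      fix x
      have "integrable lborel (\<lambda>y. f x * (g y * exp (\<i> * of_real (c * (y \<bullet> x)))))"
        by (intro integrable_mult_right integrable_exp_inner g)
      then show "integrable lborel (\<lambda>y. case (x, y) of (x, y) \<Rightarrow> ?h x y)"
        by (simp add: inner_commute mult.assoc)
    qed
  qed
  then have "(LINT y|lborel. LINT x|lborel. ?h x y) = (LINT x|lborel. LINT y|lborel. ?h x y)"
    by (rule lborel_pair.Fubini_integral)
  moreover have "f x * fourier_kernel c g x = ?K * (LINT y|lborel. ?h x y)" for x
    by (simp add: fourier_kernel_def inner_commute mult_ac)
  moreover have "fourier_kernel c f y * g y = ?K * (LINT x|lborel. ?h x y)" for y
  proof -
    have "(LINT x|lborel. ?h x y) = (LINT x|lborel. f x * exp (\<i> * of_real (c * (x \<bullet> y))) * g y)"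
      by (simp add: mult_ac)
    then show ?thesis by (simp add: fourier_kernel_def)
  qed
  ultimately show ?thesis by simp
qed

section \<open>Uniqueness of the representing function\<close>

text \<open>A Dynkin class argument: open boxes are stable under intersection and generate the Borel
  sets. The vanishing total integral supplies the step to complements.\<close>

lemma AE_zero_if_zero_on_boxes:
  fixes H :: "'a::euclidean_space \<Rightarrow> real"
  assumes H: "integrable lborel H" and H0: "(LINT x|lborel. H x) = 0"
    and box: "\<And>a b. (LINT x:box a b|lborel. H x) = 0"
  shows "AE x in lborel. H x = 0"
proof -
  have si: "set_integrable lborel A H" if "A \<in> sets borel" for A
    using H that unfolding set_integrable_def by (intro integrable_mult_indicator) auto
  let ?G = "range (\<lambda>(a, b). box a b :: 'a set)"
  have "(LINT x:A|lborel. H x) = 0" if "A \<in> sets borel" for A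
  proof -
    have A: "A \<in> sigma_sets UNIV ?G" using that by (simp add: borel_eq_box)
    have sets: "B \<in> sets borel" if "B \<in> sigma_sets UNIV ?G" for B
      using that by (simp add: borel_eq_box)
    have "Int_stable ?G"
      by (auto simp: Int_stable_def box_Int_box)
    then show ?thesis
    proof (rule sigma_sets_induct_disjoint[OF _ _ A])
      show "?G \<subseteq> Pow UNIV" by simp
    next
      fix B assume "B \<in> ?G" then show "(LINT x:B|lborel. H x) = 0" using box by auto
    next
      show "(LINT x:{}|lborel. H x) = 0" by (simp add: set_lebesgue_integral_def)
    next
      fix B assume 4: "B \<in> sigma_sets UNIV ?G" "(LINT x:B|lborel. H x) = 0"
      then have B: "B \<in> sets borel" using sets by blast
      have "(LINT x:B \<union> (UNIV - B)|lborel. H x) = (LINT x:B|lborel. H x) + (LINT x:(UNIV - B)|lborel. H x)"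
        using B by (intro set_integral_Un si) auto
      with 4 H0 show "(LINT x:(UNIV - B)|lborel. H x) = 0" by (simp add: set_lebesgue_integral_def)
    next
      fix B :: "nat \<Rightarrow> 'a set"
      assume 5: "disjoint_family B" "range B \<subseteq> sigma_sets UNIV ?G" "\<And>i. (LINT x:(B i)|lborel. H x) = 0"
      then have B: "B i \<in> sets borel" for i using sets by blast
      have "(LINT x:(\<Union>i. B i)|lborel. H x) = (\<Sum>i. (LINT x:(B i)|lborel. H x))"
        using 5(1) B by (intro lebesgue_integral_countable_add si) (auto simp: disjoint_family_on_def)
      with 5(3) show "(LINT x:(\<Union>i. B i)|lborel. H x) = 0" by simp
    qed
  qed
  \<comment> \<open>Equal integrals over every Borel set identify \<open>H\<close> with the zero
    density.\<close>
  then show ?thesis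
    using density_unique_real[OF H, of "\<lambda>_. 0"] by (simp add: set_lebesgue_integral_def)
qed

section \<open>Closure properties of single Schwartz functions, read off from constant
  families\<close>

lemma schwartz_integrable: "\<phi> \<in> schwartz \<Longrightarrow> integrable lborel \<phi>"
  using schwartz_family_integrable[of "\<lambda>_::unit. \<phi>"] by (simp add: schwartz_iff_family[where 'b=unit])

lemma schwartz_bound:
  assumes "\<phi> \<in> schwartz"
  obtains C where "0 \<le> C" "\<And>x. jap x ^ N * norm (\<phi> x) \<le> C"
  using assms schwartz_family_bound[of "\<lambda>_::unit. \<phi>"] by (metis schwartz_iff_family)

lemma schwartz_smooth: "\<phi> \<in> schwartz \<Longrightarrow> smooth \<phi>"
  by (simp add: schwartz_def)

lemma schwartz_measurable: "\<phi> \<in> schwartz \<Longrightarrow> \<phi> \<in> borel_measurable borel"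
  by (intro continuous_borel smooth_continuous schwartz_smooth)

lemma schwartz_partial_deriv: "\<phi> \<in> schwartz \<Longrightarrow> partial_deriv i \<phi> \<in> schwartz"
  using schwartz_family_partial_deriv[of "\<lambda>_::unit. \<phi>"] by (simp add: schwartz_iff_family[where 'b=unit])

lemma schwartz_foldr: "\<phi> \<in> schwartz \<Longrightarrow> foldr partial_deriv js \<phi> \<in> schwartz"
  by (induction js) (auto intro: schwartz_partial_deriv)

lemma schwartz_mi_deriv: "\<phi> \<in> schwartz \<Longrightarrow> mi_deriv \<alpha> \<phi> \<in> schwartz"
  using mi_deriv_eq_foldr[OF schwartz_smooth, of \<phi> \<alpha>] schwartz_foldr by metis

lemma schwartz_fourier_kernel: "c\<^sup>2 = 1 \<Longrightarrow> \<phi> \<in> schwartz \<Longrightarrow> fourier_kernel c \<phi> \<in> schwartz"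
  using schwartz_family_fourier_kernel[of c "\<lambda>_::unit. \<phi>"] by (simp add: schwartz_iff_family[where 'b=unit])

lemma schwartz_jap_powr: "\<phi> \<in> schwartz \<Longrightarrow> (\<lambda>x. of_real (jap x powr t) * \<phi> x) \<in> schwartz"
  using schwartz_family_jap_powr[of "\<lambda>_::unit. \<phi>" t] by (simp add: schwartz_iff_family[where 'b=unit])

lemma schwartz_diff: "\<phi> \<in> schwartz \<Longrightarrow> \<psi> \<in> schwartz \<Longrightarrow> (\<lambda>x. \<phi> x - \<psi> x) \<in> schwartz"
  using schwartz_family_diff[of "\<lambda>_::unit. \<phi>" "\<lambda>_. \<psi>"] by (simp add: schwartz_iff_family[where 'b=unit])

lemma schwartz_add: "\<phi> \<in> schwartz \<Longrightarrow> \<psi> \<in> schwartz \<Longrightarrow> (\<lambda>x. \<phi> x + \<psi> x) \<in> schwartz"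
  using schwartz_family_add[of "\<lambda>_::unit. \<phi>" "\<lambda>_. \<psi>"] by (simp add: schwartz_iff_family[where 'b=unit])

lemma schwartz_cmult: "\<phi> \<in> schwartz \<Longrightarrow> (\<lambda>x. c * \<phi> x) \<in> schwartz"
  using schwartz_family_cmult[of "\<lambda>_::unit. \<phi>"] by (simp add: schwartz_iff_family[where 'b=unit])

text \<open>Pointwise |f| \<le> 1 + |f|^p; the term 1 is paired with the integrability of \<phi>,
  the term |f|^p with its boundedness.\<close>

lemma integrable_Lp_mult_schwartz:
  fixes f :: "real^'n::finite \<Rightarrow> complex"
  assumes f: "Lp_fun p f" and p: "1 \<le> p" and \<phi>: "\<phi> \<in> schwartz"
  shows "integrable lborel (\<lambda>x. f x * \<phi> x)"
proof -
  obtain K where K: "\<And>x. jap x ^ 0 * norm (\<phi> x) \<le> K" using schwartz_bound[OF \<phi>] by metis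
  have [measurable]: "f \<in> borel_measurable borel" "\<phi> \<in> borel_measurable borel"
    using f schwartz_measurable[OF \<phi>] by (auto simp: Lp_fun_def)
  show ?thesis
  proof (rule Bochner_Integration.integrable_bound)
    show "integrable lborel (\<lambda>x. norm (\<phi> x) + K * norm (f x) powr p)"
      using f schwartz_integrable[OF \<phi>] by (auto simp: Lp_fun_def)
    show "AE x in lborel. norm (f x * \<phi> x) \<le> norm (norm (\<phi> x) + K * norm (f x) powr p)"
    proof (rule AE_I2)
      fix x
      have K': "norm (\<phi> x) \<le> K" using K[of x] by simp
      have "norm (f x) \<le> 1 + norm (f x) powr p"
      proof (cases "norm (f x) \<le> 1")
        case False
        then have "norm (f x) powr 1 \<le> norm (f x) powr p" using p by (intro powr_mono) auto
        then show ?thesis using False by simp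
      qed (simp add: add_increasing2)
      then have "norm (f x) * norm (\<phi> x) \<le> (1 + norm (f x) powr p) * norm (\<phi> x)"
        by (rule mult_right_mono) simp
      also have "\<dots> = norm (\<phi> x) + norm (f x) powr p * norm (\<phi> x)"
        by (simp add: distrib_right)
      also have "\<dots> \<le> norm (\<phi> x) + norm (f x) powr p * K"
        using K' by (intro add_left_mono mult_left_mono) auto
      finally show "norm (f x * \<phi> x) \<le> norm (norm (\<phi> x) + K * norm (f x) powr p)"
        by (simp add: norm_mult mult.commute)
    qed
  qed measurable
qed

text \<open>The extra factor k sends the values at t = 1 and t = -1 to 0 as well, so the limit is
  exactly the indicator of the open interval.\<close>

lemma exp_neg_power_tendsto_indicator:
  "(\<lambda>k. exp (- (real k * t ^ (2 * k)))) \<longlonglongrightarrow> (if \<bar>t\<bar> < 1 then 1 else 0)"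
proof (cases "\<bar>t\<bar> < 1")
  case True
  then have "(\<lambda>k. real k * (t\<^sup>2) ^ k) \<longlonglongrightarrow> 0"
    by (intro powser_times_n_limit_0) (simp add: abs_square_less_1)
  then have "(\<lambda>k. exp (- (real k * (t\<^sup>2) ^ k))) \<longlonglongrightarrow> exp (- 0)" by (intro tendsto_intros)
  with True show ?thesis by (simp add: power_mult)
next
  case False
  then have "1 \<le> t\<^sup>2" by (simp add: abs_square_less_1 flip: not_less)
  then have "real k \<le> real k * t ^ (2 * k)" for k
    using mult_left_mono[OF one_le_power[of "t\<^sup>2" k], of "real k"] by (simp add: power_mult)
  then have "filterlim (\<lambda>k. real k * t ^ (2 * k)) at_top sequentially"
    by (intro filterlim_at_top_mono[OF filterlim_real_sequentially]) auto
  then have "(\<lambda>k. exp (- (real k * t ^ (2 * k)))) \<longlonglongrightarrow> 0"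
    by (intro filterlim_compose[OF exp_at_bot]) (simp add: filterlim_uminus_at_bot)
  with False show ?thesis by simp
qed

text \<open>The exponent is a polynomial, and the even power only lowers it below -t^2. For k = 0
  the function is a Gaussian; for suitable a and b and growing k it approaches that Gaussian cut off
  to a box.\<close>

lemma schwartz_box_approx:
  fixes a b :: "real^'n::finite"
  shows "(\<lambda>x. of_real (\<Prod>i\<in>UNIV. exp (- (x $ i)\<^sup>2 - real k * (a $ i * x $ i + b $ i) ^ (2 * k)))) \<in> schwartz"
proof -
  define Q :: "'n \<Rightarrow> complex poly" where "Q i = - monom 1 2 - smult (of_nat k) ([:of_real (b $ i), of_real (a $ i):] ^ (2 * k))"
    for i :: 'n
  have Q: "poly (Q i) (of_real t) = of_real (- t\<^sup>2 - real k * (a $ i * t + b $ i) ^ (2 * k))" for i t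
    by (simp add: Q_def poly_monom algebra_simps)
  have "(\<lambda>x::real^'n. \<Prod>i\<in>UNIV. exp (poly (Q i) (of_real (x $ i)))) \<in> schwartz"
  proof (rule schwartz_exp_poly[where a = 1])
    show "Re (poly (Q i) (of_real t)) \<le> - 1 * t\<^sup>2" for i t
      unfolding Q Re_complex_of_real by (simp add: power_mult)
  qed simp
  then show ?thesis unfolding Q by (simp flip: exp_of_real)
qed

text \<open>Multiplying h by a Gaussian makes it integrable without changing its zeros. Testing
  against smooth cut-offs of the Gaussian shows that the product integrates to 0 over every
  box.\<close>

lemma AE_zero_if_integral_schwartz_zero:
  fixes h :: "real^'n::finite \<Rightarrow> complex"
  assumes m: "h \<in> borel_measurable borel"
    and int: "\<And>\<phi>. \<phi> \<in> schwartz \<Longrightarrow> integrable lborel (\<lambda>x. h x * \<phi> x)"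
    and zero: "\<And>\<phi>. \<phi> \<in> schwartz \<Longrightarrow> (LINT x|lborel. h x * \<phi> x) = 0"
  shows "AE x in lborel. h x = 0"
proof -
  note [measurable] = m
  define g where "g x = (\<Prod>i\<in>UNIV. exp (- (x $ i)\<^sup>2))" for x :: "real^'n"
  have g0: "0 < g x" for x by (simp add: g_def prod_pos)
  have g: "(\<lambda>x. of_real (g x)) \<in> schwartz"
    using schwartz_box_approx[of 0 0 0] by (simp add: g_def)
  define H where "H x = h x * of_real (g x)" for x
  have iH: "integrable lborel H" and H0: "(LINT x|lborel. H x) = 0"
    unfolding H_def using int[OF g] zero[OF g] by auto
  have box: "(LINT x:box a b|lborel. H x) = 0" for a b :: "real^'n"
  proof (cases "\<forall>i. a $ i < b $ i")
    case False
    then have "box a b = {}" by (auto simp: set_eq_iff mem_box_cart) (meson order_less_trans)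
    then show ?thesis by (simp add: set_lebesgue_integral_def)
  next
    case True
    \<comment> \<open>The affine map t to A_i t + B_i carries the i-th side of the box onto (-1,
      1).\<close>
    define A where "A = (\<chi> i. 2 / (b $ i - a $ i))"
    define B where "B = (\<chi> i. - (a $ i + b $ i) / (b $ i - a $ i))"
    define \<phi> where "\<phi> k x = (\<Prod>i\<in>UNIV. exp (- (x $ i)\<^sup>2 - real k * (A $ i * x $ i + B $ i) ^ (2 * k)))"
      for k and x :: "real^'n"
    have \<phi>: "(\<lambda>x. of_real (\<phi> k x)) \<in> schwartz" for k
      unfolding \<phi>_def by (rule schwartz_box_approx)
    have iff: "\<bar>A $ i * t + B $ i\<bar> < 1 \<longleftrightarrow> a $ i < t \<and> t < b $ i" for i t
    proof -
      have ab: "0 < b $ i - a $ i" using True by simp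
      have "A $ i * t + B $ i = (2 * t - a $ i - b $ i) / (b $ i - a $ i)"
        by (simp add: A_def B_def diff_divide_distrib add_divide_distrib)
      then show ?thesis using ab by (auto simp: abs_less_iff divide_less_eq less_divide_eq)
    qed
    have lim: "(\<lambda>k. \<phi> k x) \<longlonglongrightarrow> g x * indicator (box a b) x" for x
    proof -
      have "(\<lambda>k. \<Prod>i\<in>UNIV. exp (- (x $ i)\<^sup>2) * exp (- (real k * (A $ i * x $ i + B $ i) ^ (2 * k))))
        \<longlonglongrightarrow> (\<Prod>i\<in>UNIV. exp (- (x $ i)\<^sup>2) * (if \<bar>A $ i * x $ i + B $ i\<bar> < 1 then 1 else 0))"
        by (intro tendsto_prod tendsto_mult tendsto_const exp_neg_power_tendsto_indicator)
      also have "(\<lambda>k. \<Prod>i\<in>UNIV. exp (- (x $ i)\<^sup>2) * exp (- (real k * (A $ i * x $ i + B $ i) ^ (2 * k)))) = (\<lambda>k. \<phi> k x)"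
        by (simp add: \<phi>_def flip: exp_add)
      also have "(\<Prod>i\<in>UNIV. exp (- (x $ i)\<^sup>2) * (if \<bar>A $ i * x $ i + B $ i\<bar> < 1 then 1 else 0))
        = g x * (\<Prod>i\<in>UNIV. if a $ i < x $ i \<and> x $ i < b $ i then 1 else 0)"
        by (simp add: iff g_def prod.distrib)
      also have "(\<Prod>i\<in>UNIV. if a $ i < x $ i \<and> x $ i < b $ i then 1 else 0 :: real) = indicator (box a b) x"
        by (auto simp: indicator_def mem_box_cart)
      finally show ?thesis .
    qed
    have dom: "0 \<le> \<phi> k x" "\<phi> k x \<le> g x" for k x
      unfolding \<phi>_def g_def by (auto intro!: prod_nonneg prod_mono simp: power_mult)
    have [measurable]: "g \<in> borel_measurable borel" "\<phi> k \<in> borel_measurable borel" for k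
      unfolding g_def \<phi>_def by measurable
    \<comment> \<open>All approximants lie between 0 and g, so |H| is a majorant.\<close>
    have "(\<lambda>k. LINT x|lborel. h x * of_real (\<phi> k x)) \<longlonglongrightarrow> (LINT x|lborel. h x * of_real (g x * indicator (box a b) x))"
    proof (rule integral_dominated_convergence)
      show "integrable lborel (\<lambda>x. norm (H x))" using iH by simp
      show "AE x in lborel. norm (h x * of_real (\<phi> k x)) \<le> norm (H x)" for k
        using dom g0 by (intro AE_I2) (simp add: H_def norm_mult mult_left_mono abs_of_pos)
      show "AE x in lborel. (\<lambda>k. h x * of_real (\<phi> k x)) \<longlonglongrightarrow> h x * of_real (g x * indicator (box a b) x)"
        by (intro AE_I2 tendsto_mult tendsto_const tendsto_of_real lim)
    qed measurable
    then have "(LINT x|lborel. h x * of_real (g x * indicator (box a b) x)) = 0"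
      using zero[OF \<phi>] by (simp add: LIMSEQ_const_iff)
    also have "(\<lambda>x. h x * of_real (g x * indicator (box a b) x)) = (\<lambda>x. indicator (box a b) x *\<^sub>R H x)"
      by (auto simp: H_def indicator_def)
    finally show ?thesis by (simp add: set_lebesgue_integral_def)
  qed
  have ib: "integrable lborel (\<lambda>x. indicator (box a b) x *\<^sub>R H x)" for a b :: "real^'n"
    using iH by (intro integrable_mult_indicator) auto
  have "AE x in lborel. Re (H x) = 0"
  proof (rule AE_zero_if_zero_on_boxes)
    show "(LINT x:box a b|lborel. Re (H x)) = 0" for a b
      using integral_Re[OF ib[of a b]] box[of a b] by (simp add: set_lebesgue_integral_def)
  qed (use iH H0 in \<open>auto simp: integral_Re\<close>)
  moreover have "AE x in lborel. Im (H x) = 0"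
  proof (rule AE_zero_if_zero_on_boxes)
    show "(LINT x:box a b|lborel. Im (H x)) = 0" for a b
      using integral_Im[OF ib[of a b]] box[of a b] by (simp add: set_lebesgue_integral_def)
  qed (use iH H0 in \<open>auto simp: integral_Im\<close>)
  ultimately show ?thesis
  proof eventually_elim
    case (elim x)
    then have "H x = 0" by (simp add: complex_eq_iff)
    then show ?case using g0[of x] by (simp add: H_def)
  qed
qed

text \<open>Evaluates the definite description in \<open>Lp_norm\<close>: two functions representing
  the same distribution agree almost everywhere, hence have the same norm.\<close>

lemma Lp_norm_distr_of_fun:
  assumes f: "Lp_fun p f" and p: "1 \<le> p"
  shows "Lp_norm p (distr_of_fun f) = Lp_fun_norm p f"
  unfolding Lp_norm_def
proof (rule the_equality)
  show "\<exists>g. Lp_fun p g \<and> distr_of_fun f = distr_of_fun g \<and> Lp_fun_norm p f = Lp_fun_norm p g"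
    using f by blast
  fix r
  assume "\<exists>g. Lp_fun p g \<and> distr_of_fun f = distr_of_fun g \<and> r = Lp_fun_norm p g"
  then obtain g where g: "Lp_fun p g" "distr_of_fun f = distr_of_fun g" and r: "r = Lp_fun_norm p g"
    by blast
  have [measurable]: "f \<in> borel_measurable borel" "g \<in> borel_measurable borel"
    using f g by (auto simp: Lp_fun_def)
  have "AE x in lborel. f x - g x = 0"
  proof (rule AE_zero_if_integral_schwartz_zero)
    fix \<phi> :: "real^'a \<Rightarrow> complex" assume \<phi>: "\<phi> \<in> schwartz"
    note i = integrable_Lp_mult_schwartz[OF f p \<phi>] integrable_Lp_mult_schwartz[OF g(1) p \<phi>]
    show "integrable lborel (\<lambda>x. (f x - g x) * \<phi> x)"
      using i by (simp add: left_diff_distrib)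
    have "distr_of_fun f \<phi> = distr_of_fun g \<phi>" by (simp only: g(2))
    then show "(LINT x|lborel. (f x - g x) * \<phi> x) = 0"
      using \<phi> i by (simp add: left_diff_distrib distr_of_fun_def)
  qed measurable
  then have "(LINT x|lborel. norm (f x) powr p) = (LINT x|lborel. norm (g x) powr p)"
    by (intro integral_cong_AE) auto
  then show "r = Lp_fun_norm p f" by (simp add: r Lp_fun_norm_def)
qed

section \<open>Schwartz functions as distributions\<close>

text \<open>For 0 < v \<le> 1 and p \<ge> 1 one has v^p \<le> v, so the single integrable weight
  \<open>jap\<close>^(-n) serves all exponents p, and the norm bound is linear in
  \<open>C\<close>.\<close>

lemma
  fixes f :: "real^'n::finite \<Rightarrow> complex"
  assumes p: "1 \<le> p" and [measurable]: "f \<in> borel_measurable borel" and C: "0 \<le> C"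
    and bound: "\<And>x. jap x ^ CARD('n) * norm (f x) \<le> C"
  shows Lp_fun_jap_bound: "Lp_fun p f"
    and Lp_fun_norm_jap_bound: "Lp_fun_norm p f \<le> C * jap_integral TYPE('n) powr (1 / p)"
proof -
  have le: "norm (f x) powr p \<le> C powr p * inverse (jap x ^ CARD('n))" for x
  proof -
    define v where "v = inverse (jap x ^ CARD('n))"
    have v: "0 < v" "v \<le> 1"
      using jap_ge_1[of x] jap_pos[of x] by (auto simp: v_def inverse_le_1_iff one_le_power)
    have "norm (f x) \<le> C * v" using bound[of x] jap_pos[of x] by (simp add: v_def field_simps)
    then have "norm (f x) powr p \<le> (C * v) powr p" using p by (intro powr_mono2) auto
    also have "\<dots> = C powr p * v powr p" using C v by (simp add: powr_mult)
    also have "\<dots> \<le> C powr p * v powr 1"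
      using v p by (intro mult_left_mono powr_mono') auto
    finally show ?thesis using v by (simp add: v_def)
  qed
  have i: "integrable lborel (\<lambda>x::real^'n. C powr p * inverse (jap x ^ CARD('n)))"
    by (intro integrable_mult_right integrable_inverse_jap_power)
  have "integrable lborel (\<lambda>x. norm (f x) powr p)"
    by (rule Bochner_Integration.integrable_bound[OF i]) (use le in \<open>auto intro: order_trans[OF _ abs_ge_self]\<close>)
  then show L: "Lp_fun p f" by (simp add: Lp_fun_def)
  have "(LINT x|lborel. norm (f x) powr p) \<le> (LINT x::real^'n|lborel. C powr p * inverse (jap x ^ CARD('n)))"
    using L i le by (intro integral_mono) (auto simp: Lp_fun_def)
  also have "\<dots> = C powr p * jap_integral TYPE('n)" by simp
  finally have "Lp_fun_norm p f \<le> (C powr p * jap_integral TYPE('n)) powr (1 / p)"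
    unfolding Lp_fun_norm_def using p by (intro powr_mono2 integral_nonneg_AE) auto
  also have "\<dots> = C * jap_integral TYPE('n) powr (1 / p)"
    using C p jap_pos by (subst powr_mult) (auto simp: powr_powr intro!: integral_nonneg_AE AE_I2 less_imp_le)
  finally show "Lp_fun_norm p f \<le> C * jap_integral TYPE('n) powr (1 / p)" .
qed

lemma Lp_fun_schwartz:
  fixes \<phi> :: "real^'n::finite \<Rightarrow> complex"
  assumes "1 \<le> p" "\<phi> \<in> schwartz"
  shows "Lp_fun p \<phi>"
  using schwartz_bound[OF assms(2), of "CARD('n)"] Lp_fun_jap_bound[OF assms(1) schwartz_measurable[OF assms(2)]]
  by metis

lemma Lp_fun_norm_cmult:
  assumes "1 \<le> p"
  shows "Lp_fun_norm p (\<lambda>x. a * f x) = norm a * Lp_fun_norm p f"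
  using assms
  by (auto simp: Lp_fun_norm_def norm_mult powr_mult powr_powr intro!: integral_nonneg_AE)

lemma Lp_fun_norm_mono:
  assumes "1 \<le> p" "Lp_fun p f" "Lp_fun p g" "\<And>x. norm (f x) \<le> norm (g x)"
  shows "Lp_fun_norm p f \<le> Lp_fun_norm p g"
  unfolding Lp_fun_norm_def using assms
  by (intro powr_mono2 integral_mono integral_nonneg_AE) (auto simp: Lp_fun_def)

lemma Lp_fun_norm_pos:
  fixes f :: "real^'n::finite \<Rightarrow> complex"
  assumes f: "Lp_fun p f" and nz: "\<And>x. f x \<noteq> 0"
  shows "0 < Lp_fun_norm p f"
proof -
  have "(LINT x|lborel. norm (f x) powr p) \<noteq> 0"
  proof
    assume "(LINT x|lborel. norm (f x) powr p) = 0"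
    then have "AE x in lborel. norm (f x) powr p = 0"
      using f by (subst (asm) integral_nonneg_eq_0_iff_AE) (auto simp: Lp_fun_def)
    then have "AE x in (lborel :: (real^'n) measure). False" using nz by simp
    then show False by (simp add: eventually_False ae_filter_eq_bot_iff)
  qed
  moreover have "0 \<le> (LINT x|lborel. norm (f x) powr p)" by (intro integral_nonneg_AE) auto
  ultimately show ?thesis by (simp add: Lp_fun_norm_def)
qed

section \<open>Schwartz functions as tempered distributions and their derivatives\<close>

lemma mi_deriv_0: "smooth f \<Longrightarrow> mi_deriv (\<lambda>_. 0) f = f"
  using mi_deriv_eq[of f "[]" "\<lambda>_. 0"] by simp

lemma schwartz_seminorm_0_bound:
  assumes "\<phi> \<in> schwartz"
  shows "norm (\<phi> x) \<le> schwartz_seminorm (\<lambda>_. 0) (\<lambda>_. 0) \<phi>"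
proof -
  have "bdd_above (range (\<lambda>x. \<bar>mi_monomial (\<lambda>_. 0) x\<bar> * norm (mi_deriv (\<lambda>_. 0) \<phi> x)))"
    using assms by (simp add: schwartz_def)
  then have "\<bar>mi_monomial (\<lambda>_. 0) x\<bar> * norm (mi_deriv (\<lambda>_. 0) \<phi> x) \<le> schwartz_seminorm (\<lambda>_. 0) (\<lambda>_. 0) \<phi>"
    unfolding schwartz_seminorm_def by (intro cSUP_upper) auto
  then show ?thesis
    by (simp add: mi_monomial_def mi_deriv_0[OF schwartz_smooth[OF assms]])
qed

lemma integrable_schwartz_mult:
  assumes "f \<in> schwartz" "\<phi> \<in> schwartz"
  shows "integrable lborel (\<lambda>x. f x * \<phi> x)"
  using integrable_Lp_mult_schwartz[OF Lp_fun_schwartz[of 1, OF _ assms(1)] _ assms(2)] by simp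

text \<open>Convergence in \<open>schwartz\<close> controls the sup norm through the seminorm with
  both multi-indices zero; an integrable \<open>f\<close> turns this into convergence of the
  pairings.\<close>

lemma distr_of_schwartz_tempered:
  fixes f :: "real^'n::finite \<Rightarrow> complex"
  assumes f: "f \<in> schwartz"
  shows "distr_of_fun f \<in> tempered_distributions"
  unfolding tempered_distributions_def
proof (intro CollectI conjI ballI allI impI)
  show "distr_of_fun f \<in> extensional schwartz" by (simp add: distr_of_fun_def)
next
  fix \<phi> \<psi> :: "real^'n \<Rightarrow> complex" assume "\<phi> \<in> schwartz" "\<psi> \<in> schwartz"
  then show "distr_of_fun f (\<lambda>x. \<phi> x + \<psi> x) = distr_of_fun f \<phi> + distr_of_fun f \<psi>"
    using integrable_schwartz_mult[OF f] by (simp add: distr_of_fun_def schwartz_add distrib_left)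
next
  fix c and \<phi> :: "real^'n \<Rightarrow> complex" assume "\<phi> \<in> schwartz"
  moreover have "(LINT x|lborel. f x * (c * \<phi> x)) = (LINT x|lborel. c * (f x * \<phi> x))"
    by (simp only: mult.left_commute)
  ultimately show "distr_of_fun f (\<lambda>x. c * \<phi> x) = c * distr_of_fun f \<phi>"
    by (simp add: distr_of_fun_def schwartz_cmult)
next
  fix X and \<phi> :: "real^'n \<Rightarrow> complex"
  assume \<phi>: "\<phi> \<in> schwartz" and X: "range X \<subseteq> schwartz" and lim: "schwartz_tendsto X \<phi>"
  have Xk: "X k \<in> schwartz" for k using X by blast
  define N where "N k = schwartz_seminorm (\<lambda>_. 0) (\<lambda>_. 0) (\<lambda>x. X k x - \<phi> x)" for k
  have N: "N \<longlonglongrightarrow> 0" using lim unfolding N_def schwartz_tendsto_def by blast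
  have "norm (distr_of_fun f (X k) - distr_of_fun f \<phi>) \<le> (LINT x|lborel. norm (f x)) * N k" for k
  proof -
    have d: "(\<lambda>x. X k x - \<phi> x) \<in> schwartz" by (intro schwartz_diff Xk \<phi>)
    have "distr_of_fun f (X k) - distr_of_fun f \<phi> = (LINT x|lborel. f x * (X k x - \<phi> x))"
      using integrable_schwartz_mult[OF f Xk] integrable_schwartz_mult[OF f \<phi>] Xk \<phi>
      by (simp add: distr_of_fun_def right_diff_distrib)
    also have "norm \<dots> \<le> (LINT x|lborel. norm (f x) * N k)"
    proof (rule Bochner_Integration.integral_norm_bound_integral)
      show "integrable lborel (\<lambda>x. f x * (X k x - \<phi> x))" by (rule integrable_schwartz_mult[OF f d])
      show "integrable lborel (\<lambda>x. norm (f x) * N k)" using schwartz_integrable[OF f] by simp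
      show "norm (f x * (X k x - \<phi> x)) \<le> norm (f x) * N k" for x
        using schwartz_seminorm_0_bound[OF d, of x] by (simp add: norm_mult N_def mult_left_mono)
    qed
    finally show ?thesis by simp
  qed
  then show "(\<lambda>k. distr_of_fun f (X k)) \<longlonglongrightarrow> distr_of_fun f \<phi>"
    by (intro LIM_zero_cancel[OF Lim_null_comparison[OF always_eventually tendsto_mult_right_zero[OF N]]]) auto
qed

lemma schwartz_by_parts:
  fixes f g :: "real^'n::finite \<Rightarrow> complex"
  assumes f: "f \<in> schwartz" and g: "g \<in> schwartz"
  shows "(LINT x|lborel. f x * partial_deriv i g x) = - (LINT x|lborel. partial_deriv i f x * g x)"
proof -
  note s = schwartz_partial_deriv[OF f, of i] schwartz_partial_deriv[OF g, of i]
  have b: "\<exists>C. \<forall>x. jap x ^ CARD('n) * norm (u x * v x) \<le> C"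
    if u: "u \<in> schwartz" and v: "v \<in> schwartz" for u v :: "real^'n \<Rightarrow> complex"
  proof -
    obtain A where A: "0 \<le> A" "\<And>x. jap x ^ CARD('n) * norm (u x) \<le> A" using schwartz_bound[OF u] by metis
    obtain B where B: "0 \<le> B" "\<And>x. jap x ^ 0 * norm (v x) \<le> B" using schwartz_bound[OF v] by metis
    have "jap x ^ CARD('n) * norm (u x * v x) \<le> A * B" for x
      using mult_mono[OF A(2)[of x] B(2)[of x] A(1)] by (simp add: norm_mult mult_ac)
    then show ?thesis by blast
  qed
  obtain A B C where "\<And>x. jap x ^ CARD('n) * norm (f x * g x) \<le> A"
    "\<And>x. jap x ^ CARD('n) * norm (partial_deriv i f x * g x) \<le> B"
    "\<And>x. jap x ^ CARD('n) * norm (f x * partial_deriv i g x) \<le> C"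
    using b[OF f g] b[OF s(1) g] b[OF f s(2)] by blast
  then have "(LINT x|lborel. partial_deriv i f x * g x) = - (LINT x|lborel. f x * partial_deriv i g x)"
    by (intro integral_by_parts smooth_differentiable schwartz_smooth schwartz_measurable f g s)
  then show ?thesis by simp
qed

text \<open>The outermost derivative of \<open>g\<close> is moved first and thus becomes the
  innermost one on \<open>f\<close>, which reverses the list.\<close>

lemma schwartz_by_parts_foldr:
  assumes "f \<in> schwartz" "g \<in> schwartz"
  shows "(LINT x|lborel. f x * foldr partial_deriv js g x)
    = (- 1) ^ length js * (LINT x|lborel. foldr partial_deriv (rev js) f x * g x)"
  using assms(1)
proof (induction js arbitrary: f)
  case (Cons j js)
  then show ?case
    using schwartz_by_parts[of f "foldr partial_deriv js g" j] schwartz_foldr[OF assms(2), of js]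
      Cons.IH[OF schwartz_partial_deriv[of f j]]
    by simp
qed simp

text \<open>The list chosen for \<phi>, reversed, has the same counts and so also computes the
  derivative of \<open>f\<close>. The sign from integration by parts cancels the sign in
  \<open>distr_deriv\<close>.\<close>

lemma distr_deriv_distr_of_schwartz:
  fixes f :: "real^'n::finite \<Rightarrow> complex"
  assumes f: "f \<in> schwartz"
  shows "distr_deriv \<alpha> (distr_of_fun f) = distr_of_fun (mi_deriv \<alpha> f)"
  unfolding distr_deriv_def distr_of_fun_def
proof (rule restrict_ext)
  fix \<phi> :: "real^'n \<Rightarrow> complex" assume \<phi>: "\<phi> \<in> schwartz"
  obtain js where js: "mi_deriv \<alpha> \<phi> = foldr partial_deriv js \<phi>" "\<And>i. count_list js i = \<alpha> i"
    using mi_deriv_eq_foldr[OF schwartz_smooth[OF \<phi>]] by metis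
  have len: "length js = mi_order \<alpha>"
    using sum_count_set[of js UNIV] by (simp add: mi_order_def js(2))
  have "mi_deriv \<alpha> f = foldr partial_deriv (rev js) f"
    by (intro mi_deriv_eq schwartz_smooth f) (simp add: js(2) count_list_rev)
  then have "(LINT x|lborel. f x * mi_deriv \<alpha> \<phi> x) = (- 1) ^ mi_order \<alpha> * (LINT x|lborel. mi_deriv \<alpha> f x * \<phi> x)"
    using schwartz_by_parts_foldr[OF f \<phi>, of js] by (simp add: js(1) len)
  then show "(- 1) ^ mi_order \<alpha> * (\<lambda>\<phi>\<in>schwartz. LINT x|lborel. f x * \<phi> x) (mi_deriv \<alpha> \<phi>)
      = (LINT x|lborel. mi_deriv \<alpha> f x * \<phi> x)"
    by (simp add: schwartz_mi_deriv[OF \<phi>] flip: mult.assoc power_add mult_2 power_mult)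
qed

section \<open>Bessel potentials of Schwartz functions\<close>

definition bessel_fun :: "real \<Rightarrow> (real^'n::finite \<Rightarrow> complex) \<Rightarrow> real^'n \<Rightarrow> complex" where
  "bessel_fun s f = fourier_kernel 1 (\<lambda>\<xi>. of_real (jap \<xi> powr (s / 2)) * fourier_kernel (- 1) f \<xi>)"

lemma schwartz_bessel_fun: "f \<in> schwartz \<Longrightarrow> bessel_fun s f \<in> schwartz"
  unfolding bessel_fun_def by (intro schwartz_fourier_kernel schwartz_jap_powr) auto

lemma bessel_fun_cmult: "bessel_fun s (\<lambda>x. a * f x) = (\<lambda>x. a * bessel_fun s f x)"
proof -
  have "(\<lambda>\<xi>. complex_of_real (jap \<xi> powr (s / 2)) * fourier_kernel (- 1) (\<lambda>x. a * f x) \<xi>)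
    = (\<lambda>\<xi>. a * (of_real (jap \<xi> powr (s / 2)) * fourier_kernel (- 1) f \<xi>))"
    by (simp add: fourier_kernel_cmult mult_ac)
  then show ?thesis unfolding bessel_fun_def by (intro ext) (simp only: fourier_kernel_cmult)
qed

text \<open>Unfolding moves the inverse transform, the symbol and the forward transform onto the
  test function. Two uses of the Fourier duality bring them back to \<open>f\<close>, with c = -1
  and then c = 1.\<close>

lemma bessel_potential_distr_of_schwartz:
  fixes f :: "real^'n::finite \<Rightarrow> complex"
  assumes f: "f \<in> schwartz"
  shows "bessel_potential s (distr_of_fun f) = distr_of_fun (bessel_fun s f)"
proof
  fix \<phi> :: "real^'n \<Rightarrow> complex"
  show "bessel_potential s (distr_of_fun f) \<phi> = distr_of_fun (bessel_fun s f) \<phi>"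
  proof (cases "\<phi> \<in> schwartz")
    case False
    then show ?thesis by (simp add: bessel_potential_def distr_inv_fourier_def distr_of_fun_def)
  next
    case \<phi>: True
    let ?m = "\<lambda>\<xi>::real^'n. complex_of_real (jap \<xi> powr (s / 2))"
    let ?u = "fourier_kernel 1 \<phi>" and ?v = "fourier_kernel (- 1) f"
    have u: "?u \<in> schwartz" and v: "?v \<in> schwartz"
      by (intro schwartz_fourier_kernel f \<phi>; simp)+
    have mu: "(\<lambda>\<xi>. ?m \<xi> * ?u \<xi>) \<in> schwartz" and mv: "(\<lambda>\<xi>. ?m \<xi> * ?v \<xi>) \<in> schwartz"
      by (intro schwartz_jap_powr u v)+
    have Fmu: "fourier_kernel (- 1) (\<lambda>\<xi>. ?m \<xi> * ?u \<xi>) \<in> schwartz"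
      by (intro schwartz_fourier_kernel mu) simp
    have "bessel_potential s (distr_of_fun f) \<phi> = (LINT x|lborel. f x * fourier_kernel (- 1) (\<lambda>\<xi>. ?m \<xi> * ?u \<xi>) x)"
      using \<phi> u mu Fmu
      by (simp add: bessel_potential_def distr_inv_fourier_def distr_mult_def distr_fourier_def
          distr_of_fun_def fourier_eq_kernel inv_fourier_eq_kernel jap_def)
    also have "\<dots> = (LINT \<xi>|lborel. ?v \<xi> * (?m \<xi> * ?u \<xi>))"
      by (rule integral_fourier_kernel_swap[OF schwartz_integrable[OF f] schwartz_integrable[OF mu]])
    also have "\<dots> = (LINT \<xi>|lborel. (?m \<xi> * ?v \<xi>) * ?u \<xi>)"
      by (simp add: mult_ac)
    also have "\<dots> = (LINT x|lborel. bessel_fun s f x * \<phi> x)"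
      unfolding bessel_fun_def
      by (rule integral_fourier_kernel_swap[OF schwartz_integrable[OF mv] schwartz_integrable[OF \<phi>]])
    finally show ?thesis using \<phi> by (simp add: distr_of_fun_def)
  qed
qed

lemma
  assumes p: "1 \<le> p" and f: "f \<in> schwartz"
  shows distr_of_schwartz_in_Lp: "distr_of_fun f \<in> Lp p"
    and Lp_norm_distr_of_schwartz: "Lp_norm p (distr_of_fun f) = Lp_fun_norm p f"
    and distr_of_schwartz_in_bessel_space: "distr_of_fun f \<in> bessel_space s p"
    and bessel_norm_distr_of_schwartz: "bessel_norm s p (distr_of_fun f) = Lp_fun_norm p (bessel_fun s f)"
proof -
  have in_Lp: "distr_of_fun g \<in> Lp p" if "g \<in> schwartz" for g :: "real^'a \<Rightarrow> complex"
    using Lp_fun_schwartz[OF p that] by (auto simp: Lp_def)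
  note norm = Lp_norm_distr_of_fun[OF Lp_fun_schwartz[OF p] p]
  show "distr_of_fun f \<in> Lp p" "Lp_norm p (distr_of_fun f) = Lp_fun_norm p f"
    by (intro in_Lp norm f)+
  show "distr_of_fun f \<in> bessel_space s p"
    by (simp add: bessel_space_def bessel_potential_distr_of_schwartz distr_of_schwartz_tempered f in_Lp schwartz_bessel_fun)
  show "bessel_norm s p (distr_of_fun f) = Lp_fun_norm p (bessel_fun s f)"
    by (simp add: bessel_norm_def bessel_potential_distr_of_schwartz f norm schwartz_bessel_fun)
qed

section \<open>Wave packets\<close>

text \<open>Written as a product of exponentials of quadratic polynomials, the form for which all
  derivatives are already known explicitly.\<close>

definition wave_packet :: "real \<Rightarrow> real^'n::finite \<Rightarrow> complex" where
  "wave_packet R x = (\<Prod>i\<in>UNIV. exp (poly [:0, \<i> * of_real R, - 1 / 2:] (of_real (x $ i))))"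

lemma Re_wave_packet_exponent:
  "Re (poly [:0, \<i> * of_real R, - 1 / 2:] (of_real t)) \<le> - (1 / 2) * t\<^sup>2"
  by (simp add: power2_eq_square)

lemma schwartz_wave_packet: "wave_packet R \<in> schwartz"
  unfolding wave_packet_def[abs_def] by (rule schwartz_exp_poly[OF _ Re_wave_packet_exponent]) simp

lemma foldr_partial_deriv_wave_packet:
  "foldr partial_deriv js (wave_packet R) =
     (\<lambda>x. (\<Prod>i\<in>UNIV. poly (exp_poly_step [:0, \<i> * of_real R, - 1 / 2:] (count_list js i)) (of_real (x $ i)))
        * wave_packet R x)"
  unfolding wave_packet_def[abs_def]
  by (rule foldr_partial_deriv_exp_poly[OF _ Re_wave_packet_exponent]) simp

lemma wave_packet_modulation:
  "wave_packet R x = wave_packet 0 x * exp (\<i> * of_real (R * (\<Sum>i\<in>UNIV. x $ i)))"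
proof -
  have "exp (poly [:0, \<i> * of_real R, - 1 / 2:] (of_real t))
      = exp (poly [:0, \<i> * of_real 0, - 1 / 2:] (of_real t)) * exp (\<i> * of_real (R * t))" for t
    unfolding exp_add[symmetric] by (simp add: algebra_simps)
  then have "wave_packet R x = wave_packet 0 x * (\<Prod>i\<in>UNIV. exp (\<i> * of_real (R * x $ i)))"
    unfolding wave_packet_def by (simp only: prod.distrib)
  also have "(\<Prod>i\<in>UNIV. exp (\<i> * of_real (R * x $ i))) = exp (\<i> * of_real (R * (\<Sum>i\<in>UNIV. x $ i)))"
    by (simp add: exp_sum sum_distrib_left)
  finally show ?thesis .
qed

lemma norm_wave_packet: "norm (wave_packet R x) = norm (wave_packet 0 x)"
  by (subst wave_packet_modulation) (simp add: norm_mult del: of_real_mult of_real_sum)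

text \<open>Each derivative of the one-dimensional packet is a monic Hermite-type polynomial in \<open>\<i>R - t\<close>
  times the packet, and \<open>\<bar>\<i>R - t\<bar> \<ge> R\<close> on the real line.\<close>

lemma exp_poly_step_wave_packet:
  "\<exists>P. degree P = k \<and> lead_coeff P = 1 \<and>
     (\<forall>R. exp_poly_step [:0, \<i> * of_real R, - 1 / 2:] k = pcompose P [:\<i> * of_real R, -1:])"
proof (induction k)
  case 0
  then show ?case by (intro exI[of _ 1]) (simp add: one_pCons)
next
  case (Suc k)
  then obtain P where P: "degree P = k" "lead_coeff P = 1"
    "\<And>R. exp_poly_step [:0, \<i> * of_real R, - 1 / 2:] k = pcompose P [:\<i> * of_real R, -1:]"
    by blast
  \<comment> \<open>The Hermite recursion: P becomes z P - P', where z = \<i>R - t is the derivative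
    of the exponent and the minus sign comes from dz/dt = -1.\<close>
  define P' where "P' = pCons 0 P + - pderiv P"
  have "P \<noteq> 0" using P(2) by auto
  then have deg: "degree (- pderiv P) < degree (pCons 0 P)"
    by (simp add: degree_pderiv P(1))
  have deg': "degree P' = Suc k"
    unfolding P'_def by (subst degree_add_eq_left[OF deg]) (simp add: \<open>P \<noteq> 0\<close> P(1))
  moreover have "lead_coeff P' = 1"
    unfolding deg' using P(1,2) by (simp add: P'_def coeff_pderiv coeff_eq_0)
  moreover have "exp_poly_step [:0, \<i> * of_real R, - 1 / 2:] (Suc k) = pcompose P' [:\<i> * of_real R, -1:]" for R
    unfolding exp_poly_step_simps P(3) P'_def
    by (simp add: pderiv_pcompose pderiv_pCons pcompose_add pcompose_diff pcompose_uminus pcompose_pCons mult.commute)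
  ultimately show ?case by blast
qed

text \<open>A monic polynomial of degree k has modulus at least |z|^k / 2 outside some disc. The
  line \<i>R - t avoids that disc entirely once R exceeds its radius, so the threshold is
  independent of t.\<close>

lemma wave_packet_factor_lower_bound:
  "\<exists>M\<ge>1. \<forall>R\<ge>M. \<forall>t. R ^ k / 2 \<le> norm (poly (exp_poly_step [:0, \<i> * of_real R, - 1 / 2:] k) (of_real t))"
proof -
  obtain P where P: "degree P = k" "lead_coeff P = 1"
    "\<And>R. exp_poly_step [:0, \<i> * of_real R, - 1 / 2:] k = pcompose P [:\<i> * of_real R, -1:]"
    using exp_poly_step_wave_packet by blast
  have "((\<lambda>z. norm (poly P z / z ^ k)) \<longlongrightarrow> norm (1::complex)) at_infinity"
    using poly_divide_tendsto_aux[of P] P by (intro tendsto_norm) simp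
  then have "eventually (\<lambda>z. norm (poly P z / z ^ k) > 1 / 2) at_infinity"
    by (rule order_tendstoD) simp
  then obtain b where b: "\<And>z. b \<le> norm z \<Longrightarrow> norm (poly P z / z ^ k) > 1 / 2"
    unfolding eventually_at_infinity by blast
  have "R ^ k / 2 \<le> norm (poly (exp_poly_step [:0, \<i> * of_real R, - 1 / 2:] k) (of_real t))"
    if R: "max 1 b \<le> R" for R t
  proof -
    let ?z = "\<i> * of_real R - of_real t :: complex"
    have z: "R \<le> norm ?z" using abs_Im_le_cmod[of ?z] R by simp
    then have "norm (poly P ?z / ?z ^ k) > 1 / 2" using R by (intro b) simp
    then have "norm ?z ^ k / 2 < norm (poly P ?z)"
      using z R by (auto simp: norm_divide norm_power field_simps split: if_splits)
    moreover have "R ^ k \<le> norm ?z ^ k" using z R by (intro power_mono) auto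
    ultimately show ?thesis unfolding P(3) poly_pcompose by simp
  qed
  then show ?thesis by (intro exI[of _ "max 1 b"]) auto
qed

lemma wave_packet_deriv_lower_bound:
  fixes \<alpha> :: "'n::finite multi_index"
  shows "\<exists>M\<ge>1. \<forall>R\<ge>M. \<forall>x::real^'n.
    R ^ mi_order \<alpha> / 2 ^ CARD('n) * norm (wave_packet 0 x) \<le> norm (mi_deriv \<alpha> (wave_packet R) x)"
proof -
  have "\<exists>M. \<forall>i. M i \<ge> 1 \<and> (\<forall>R\<ge>M i. \<forall>t.
      R ^ \<alpha> i / 2 \<le> norm (poly (exp_poly_step [:0, \<i> * of_real R, - 1 / 2:] (\<alpha> i)) (of_real t)))"
    by (rule choice, rule allI, rule wave_packet_factor_lower_bound)
  then obtain M where M: "\<And>i. M i \<ge> 1" "\<And>i R t. M i \<le> R \<Longrightarrow>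
      R ^ \<alpha> i / 2 \<le> norm (poly (exp_poly_step [:0, \<i> * of_real R, - 1 / 2:] (\<alpha> i)) (of_real t))"
    by blast
  \<comment> \<open>The largest of the finitely many coordinate thresholds.\<close>
  define N where "N = Max (range M)"
  have N: "M i \<le> N" for i unfolding N_def by (intro Max_ge) auto
  have "R ^ mi_order \<alpha> / 2 ^ CARD('n) * norm (wave_packet 0 x) \<le> norm (mi_deriv \<alpha> (wave_packet R) x)"
    if R: "N \<le> R" for R and x :: "real^'n"
  proof -
    have R0: "0 \<le> R" using M(1)[of undefined] N[of undefined] R by simp
    obtain js where js: "mi_deriv \<alpha> (wave_packet R :: real^'n \<Rightarrow> complex) = foldr partial_deriv js (wave_packet R)"
        "\<And>i. count_list js i = \<alpha> i"
      using mi_deriv_eq_foldr[OF schwartz_smooth[OF schwartz_wave_packet]] by metis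
    have "R ^ mi_order \<alpha> / 2 ^ CARD('n) = (\<Prod>i\<in>UNIV. R ^ \<alpha> i / 2)"
      by (simp add: mi_order_def power_sum prod_dividef)
    also have "\<dots> \<le> (\<Prod>i\<in>UNIV. norm (poly (exp_poly_step [:0, \<i> * of_real R, - 1 / 2:] (\<alpha> i)) (of_real (x $ i))))"
    proof (intro prod_mono conjI)
      show "0 \<le> R ^ \<alpha> i / 2" for i using R0 by simp
    qed (rule M(2)[OF order_trans[OF N R]])
    finally have "R ^ mi_order \<alpha> / 2 ^ CARD('n) * norm (wave_packet 0 x)
        \<le> (\<Prod>i\<in>UNIV. norm (poly (exp_poly_step [:0, \<i> * of_real R, - 1 / 2:] (\<alpha> i)) (of_real (x $ i)))) * norm (wave_packet 0 x)"
      by (rule mult_right_mono) simp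
    then show ?thesis
      by (simp only: js foldr_partial_deriv_wave_packet norm_mult norm_wave_packet[of R x] prod_norm[symmetric])
  qed
  moreover have "1 \<le> N" using M(1)[of undefined] N[of undefined] by simp
  ultimately show ?thesis by blast
qed

text \<open>Modulation by a frequency becomes translation by it.\<close>

lemma fourier_wave_packet:
  "fourier_kernel (- 1) (wave_packet R) \<xi> = fourier_kernel (- 1) (wave_packet 0) (\<xi> - (\<chi> i. R))"
proof -
  have "wave_packet R x * exp (\<i> * of_real (- 1 * (x \<bullet> \<xi>)))
      = wave_packet 0 x * exp (\<i> * of_real (- 1 * (x \<bullet> (\<xi> - (\<chi> i. R)))))" for x :: "real^'a"
  proof -
    have "R * (\<Sum>i\<in>UNIV. x $ i) + - 1 * (x \<bullet> \<xi>) = - 1 * (x \<bullet> (\<xi> - (\<chi> i. R)))"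
      by (simp only: inner_diff_right) (simp add: inner_vec_def sum_distrib_left sum_negf mult.commute)
    then have "\<i> * of_real (R * (\<Sum>i\<in>UNIV. x $ i)) + \<i> * of_real (- 1 * (x \<bullet> \<xi>))
      = \<i> * complex_of_real (- 1 * (x \<bullet> (\<xi> - (\<chi> i. R))))"
      by (simp only: distrib_left[symmetric] of_real_add[symmetric])
    then show ?thesis
      by (subst wave_packet_modulation) (simp only: mult.assoc exp_add[symmetric])
  qed
  then show ?thesis unfolding fourier_kernel_def by simp
qed

lemma jap_shift_eq_quad_weight:
  assumes "0 < R"
  shows "jap (\<eta> + (\<chi> i. R)) = R\<^sup>2 * quad_weight ((1 / R)\<^sup>2) (1 / R) 1 \<eta>"
proof -
  have "R\<^sup>2 * (1 / R * t + 1)\<^sup>2 = (t + R)\<^sup>2" for t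
    using assms by (simp add: power_mult_distrib[symmetric] field_simps)
  then show ?thesis
    using assms by (simp add: jap_vec quad_weight_def distrib_left sum_distrib_left power_divide)
qed

text \<open>Substituting \<xi> = \<eta> + (R,...,R) centres the transform at the origin. The phase
  so created is constant in \<eta> and of modulus 1, and R^2 taken out of the symbol base gives
  R^s.\<close>

lemma bessel_wave_packet:
  fixes x :: "real^'n::finite"
  assumes R: "0 < R"
  shows "norm (bessel_fun s (wave_packet R) x) = R powr s * norm (fourier_kernel 1
     (\<lambda>\<eta>. of_real (quad_weight ((1 / R)\<^sup>2) (1 / R) 1 \<eta> powr (s / 2)) * fourier_kernel (- 1) (wave_packet 0) \<eta>) x)"
proof -
  let ?G = "fourier_kernel (- 1) (wave_packet 0)"
  let ?e = "(\<chi> i. R) :: real^'n"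
  let ?F = "\<lambda>\<xi>. of_real (jap \<xi> powr (s / 2)) * ?G (\<xi> - ?e) * exp (\<i> * of_real (1 * (\<xi> \<bullet> x)))"
  let ?q = "\<lambda>\<eta>::real^'n. quad_weight ((1 / R)\<^sup>2) (1 / R) 1 \<eta> powr (s / 2)"
  have G: "?G \<in> schwartz" by (intro schwartz_fourier_kernel schwartz_wave_packet) simp
  have "continuous_on UNIV (\<lambda>\<xi>. ?G (\<xi> - ?e))"
    by (rule continuous_on_compose2[OF smooth_continuous[OF schwartz_smooth[OF G]]])
       (simp_all add: continuous_on_diff)
  moreover have "continuous_on UNIV (\<lambda>\<xi>::real^'n. jap \<xi> powr (s / 2))"
    by (intro continuous_on_powr continuous_on_jap continuous_on_const) (simp add: jap_pos less_imp_neq[symmetric])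
  moreover have "continuous_on UNIV (\<lambda>\<xi>. exp (\<i> * of_real (1 * (\<xi> \<bullet> x))))"
    by (intro continuous_intros)
  ultimately have "continuous_on UNIV ?F"
    by (intro continuous_on_mult continuous_on_of_real)
  then have m: "?F \<in> borel_measurable borel" by (rule continuous_borel)
  have "(LINT \<xi>|lborel. ?F \<xi>) = (LINT \<eta>|lborel. ?F (\<eta> + ?e))"
    by (rule lborel_integral_shift(1)[OF m, symmetric])
  also have "\<dots> = (LINT \<eta>|lborel. (of_real (R powr s) * exp (\<i> * of_real (1 * (?e \<bullet> x)))) *
      (of_real (?q \<eta>) * ?G \<eta> * exp (\<i> * of_real (1 * (\<eta> \<bullet> x)))))"
  proof (intro Bochner_Integration.integral_cong refl)
    fix \<eta> :: "real^'n"
    have "0 \<le> quad_weight ((1 / R)\<^sup>2) (1 / R) 1 \<eta>"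
      by (simp add: quad_weight_def sum_nonneg)
    moreover have "(R\<^sup>2) powr (s / 2) = R powr s"
    proof -
      have "(R\<^sup>2) powr (s / 2) = (R powr 2) powr (s / 2)" using R by simp
      also have "\<dots> = R powr s" by (simp only: powr_powr) simp
      finally show ?thesis .
    qed
    ultimately have "jap (\<eta> + ?e) powr (s / 2) = R powr s * ?q \<eta>"
      using R by (simp add: jap_shift_eq_quad_weight powr_mult)
    moreover have "exp (\<i> * of_real (1 * ((\<eta> + ?e) \<bullet> x))) = exp (\<i> * of_real (1 * (?e \<bullet> x))) * exp (\<i> * of_real (1 * (\<eta> \<bullet> x)))"
      unfolding exp_add[symmetric] by (simp add: inner_add_left distrib_left add.commute)
    ultimately show "?F (\<eta> + ?e) = (of_real (R powr s) * exp (\<i> * of_real (1 * (?e \<bullet> x)))) *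
      (of_real (?q \<eta>) * ?G \<eta> * exp (\<i> * of_real (1 * (\<eta> \<bullet> x))))"
      by (simp only: add_diff_cancel_right' of_real_mult mult_ac)
  qed
  also have "\<dots> = (of_real (R powr s) * exp (\<i> * of_real (1 * (?e \<bullet> x)))) *
      (LINT \<eta>|lborel. of_real (?q \<eta>) * ?G \<eta> * exp (\<i> * of_real (1 * (\<eta> \<bullet> x))))"
    by (rule integral_mult_right_zero)
  finally have "norm (LINT \<xi>|lborel. ?F \<xi>) = R powr s * norm (LINT \<eta>|lborel. of_real (?q \<eta>) * ?G \<eta> * exp (\<i> * of_real (1 * (\<eta> \<bullet> x))))"
    by (simp add: norm_mult)
  then show ?thesis
    by (simp add: bessel_fun_def fourier_wave_packet[of R] fourier_kernel_def[of 1] norm_mult)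
qed

lemma Lp_norm_bessel_wave_packet:
  assumes p: "1 \<le> p"
  shows "\<exists>B\<ge>0. \<forall>R\<ge>1. Lp_fun_norm p (bessel_fun s (wave_packet R :: real^'n::finite \<Rightarrow> complex)) \<le> B * R powr s"
proof -
  \<comment> \<open>Indexing by all reals through 1 + |r| keeps the scale 1/(1 + |r|) in (0, 1]
    without a side condition; a given R \<ge> 1 is reached at r = R - 1.\<close>
  define H where "H r = fourier_kernel 1 (\<lambda>\<eta>::real^'n. of_real (quad_weight ((1 / (1 + \<bar>r\<bar>))\<^sup>2) (1 / (1 + \<bar>r\<bar>)) 1 \<eta> powr (s / 2))
      * fourier_kernel (- 1) (wave_packet 0) \<eta>)" for r :: real
  have *: "(\<lambda>r::real. fourier_kernel (- 1) (wave_packet 0 :: real^'n \<Rightarrow> complex)) \<in> schwartz_family"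
    unfolding schwartz_iff_family[symmetric] by (intro schwartz_fourier_kernel schwartz_wave_packet) simp
  have "H \<in> schwartz_family"
    unfolding H_def[abs_def]
    by (intro schwartz_family_fourier_kernel[where c = 1] schwartz_family_shifted_weight_powr *) (auto simp: divide_le_eq)
  then obtain C where C: "0 \<le> C" "\<And>r x. jap x ^ CARD('n) * norm (H r x) \<le> C"
    using schwartz_family_bound by metis
  have "Lp_fun_norm p (bessel_fun s (wave_packet R :: real^'n \<Rightarrow> complex)) \<le> (C * jap_integral TYPE('n) powr (1 / p)) * R powr s"
    if R: "1 \<le> R" for R
  proof -
    have "jap x ^ CARD('n) * norm (bessel_fun s (wave_packet R) x) \<le> C * R powr s" for x :: "real^'n"
    proof -
      have "norm (bessel_fun s (wave_packet R) x) = R powr s * norm (H (R - 1) x)"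
        using R by (subst bessel_wave_packet) (auto simp: H_def)
      then show ?thesis
        using mult_left_mono[OF C(2)[of x "R - 1"], of "R powr s"] by (simp add: mult_ac)
    qed
    then have "Lp_fun_norm p (bessel_fun s (wave_packet R :: real^'n \<Rightarrow> complex)) \<le> (C * R powr s) * jap_integral TYPE('n) powr (1 / p)"
      by (intro Lp_fun_norm_jap_bound p schwartz_measurable schwartz_bessel_fun schwartz_wave_packet) (auto simp: C)
    then show ?thesis by (simp add: mult_ac)
  qed
  then show ?thesis using C(1) by (intro exI[of _ "C * jap_integral TYPE('n) powr (1 / p)"]) auto
qed

section \<open>Choice of constants and conclusion\<close>

lemma mi_deriv_cmult:
  assumes "smooth f"
  shows "mi_deriv \<alpha> (\<lambda>x. a * f x) = (\<lambda>x. a * mi_deriv \<alpha> f x)"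
proof -
  have "foldr partial_deriv js (\<lambda>x. a * f x) = (\<lambda>x. a * foldr partial_deriv js f x)" for js
    by (induction js) (simp_all add: partial_deriv_cmult smooth_differentiable smooth_foldr assms)
  then show ?thesis by (simp add: mi_deriv_def)
qed

theorem theorem3p1:
  fixes s p :: real and \<alpha> :: "'n::finite multi_index"
  assumes "1 < p" and "0 < s" and "real (mi_order \<alpha>) < s"
  shows "\<exists>c\<^sub>0::real. c\<^sub>0 > 0 \<and>
    (\<forall>E>0. \<forall>\<delta>. 0 < \<delta> \<longrightarrow> \<delta> < E \<longrightarrow>
      (\<exists>f :: 'n functional. f \<in> bessel_space s p \<and> bessel_norm s p f \<le> E \<and>
         f \<in> Lp p \<and> Lp_norm p f < \<delta> \<and>
         distr_deriv \<alpha> f \<in> Lp p \<and>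
         Lp_norm p (distr_deriv \<alpha> f)
           \<ge> c\<^sub>0 * E powr (real (mi_order \<alpha>) / s) * \<delta> powr (1 - real (mi_order \<alpha>) / s)))"
proof -
  have p: "1 \<le> p" using assms(1) by simp
  define w :: "real \<Rightarrow> real^'n \<Rightarrow> complex" where "w = wave_packet"
  have w: "w R \<in> schwartz" for R unfolding w_def by (rule schwartz_wave_packet)
  define G where "G = Lp_fun_norm p (w 0)"
  have G: "0 < G"
    unfolding G_def by (intro Lp_fun_norm_pos Lp_fun_schwartz p w) (simp add: w_def wave_packet_def)
  obtain B where B: "0 \<le> B" "\<And>R. 1 \<le> R \<Longrightarrow> Lp_fun_norm p (bessel_fun s (w R)) \<le> B * R powr s"
    using Lp_norm_bessel_wave_packet[OF p, of s] unfolding w_def by blast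
  obtain M where M: "1 \<le> M" "\<And>R x. M \<le> R \<Longrightarrow>
      R ^ mi_order \<alpha> / 2 ^ CARD('n) * norm (w 0 x) \<le> norm (mi_deriv \<alpha> (w R) x)"
    using wave_packet_deriv_lower_bound[of \<alpha>] unfolding w_def by blast
  \<comment> \<open>The first entry makes the L^p norm at most \<delta>/2, the second keeps the
    Bessel norm below E; B + 1 guards against B = 0.\<close>
  define c where "c = min (1 / (2 * G)) (1 / ((B + 1) * M powr s))"
  have c: "0 < c" using G B M by (simp add: c_def)
  have cG: "c * G < 1"
  proof -
    have "c * G \<le> 1 / (2 * G) * G" using G by (intro mult_right_mono) (auto simp: c_def)
    then show ?thesis using G by simp
  qed
  have cB: "c * (B * M powr s) \<le> 1"
  proof -
    have "c * (B * M powr s) \<le> 1 / ((B + 1) * M powr s) * ((B + 1) * M powr s)"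
      using B M by (intro mult_mono mult_right_mono) (auto simp: c_def)
    also have "\<dots> = 1" using B M by simp
    finally show ?thesis .
  qed
  \<comment> \<open>What remains of the derivative bound once the powers of E and \<delta> are split
    off; it is built only from s, p, \<alpha> and n.\<close>
  define c0 where "c0 = c * M ^ mi_order \<alpha> / 2 ^ CARD('n) * G"
  have "\<exists>f :: 'n functional. f \<in> bessel_space s p \<and> bessel_norm s p f \<le> E \<and>
         f \<in> Lp p \<and> Lp_norm p f < \<delta> \<and> distr_deriv \<alpha> f \<in> Lp p \<and>
         Lp_norm p (distr_deriv \<alpha> f) \<ge> c0 * E powr (real (mi_order \<alpha>) / s) * \<delta> powr (1 - real (mi_order \<alpha>) / s)"
    if \<delta>: "0 < \<delta>" "\<delta> < E" for E \<delta>
  proof -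
    \<comment> \<open>The frequency for which \<delta> R^s equals M^s E, so that amplitude of order
      \<delta> matches the bound E up to constants. As E/\<delta> > 1, R also passes the threshold
      M.\<close>
    define R where "R = M * (E / \<delta>) powr (1 / s)"
    have "1 \<le> (E / \<delta>) powr (1 / s)" using \<delta> assms(2) by (intro ge_one_powr_ge_zero) auto
    then have R: "M \<le> R" using mult_left_mono[of 1 "(E / \<delta>) powr (1 / s)" M] M(1) by (simp add: R_def)
    have Rs: "R powr s = M powr s * (E / \<delta>)"
      using M(1) \<delta> assms(2) by (simp add: R_def powr_mult powr_powr)
    have Ra: "R ^ mi_order \<alpha> = M ^ mi_order \<alpha> * (E / \<delta>) powr (real (mi_order \<alpha>) / s)"
      using \<delta> by (simp add: R_def power_mult_distrib powr_power)
    define f where "f x = of_real (c * \<delta>) * w R x" for x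
    have f: "f \<in> schwartz" unfolding f_def[abs_def] by (intro schwartz_cmult w)
    have c\<delta>: "0 < c * \<delta>" using c \<delta> by simp
    have norm_f: "Lp_fun_norm p f = c * \<delta> * G"
    proof -
      have "Lp_fun_norm p (w R) = G"
        unfolding G_def w_def Lp_fun_norm_def by (subst norm_wave_packet) simp
      then show ?thesis using c\<delta> unfolding f_def[abs_def] by (simp only: Lp_fun_norm_cmult[OF p] norm_of_real abs_of_pos)
    qed
    have "Lp_fun_norm p (bessel_fun s f) = c * \<delta> * Lp_fun_norm p (bessel_fun s (w R))"
      using c\<delta> unfolding f_def[abs_def] bessel_fun_cmult
      by (simp only: Lp_fun_norm_cmult[OF p] norm_of_real abs_of_pos)
    also have "\<dots> \<le> c * \<delta> * (B * R powr s)"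
      using c\<delta> M(1) R by (intro mult_left_mono B) auto
    also have "\<dots> = c * (B * M powr s) * E" using \<delta> by (simp add: Rs)
    also have "\<dots> \<le> 1 * E" using cB \<delta> by (intro mult_right_mono) auto
    finally have bessel: "Lp_fun_norm p (bessel_fun s f) \<le> E" by simp
    \<comment> \<open>\<delta> R^|\<alpha>| equals M^|\<alpha>| E^(|\<alpha>|/s) \<delta>^(1 -
      |\<alpha>|/s), the interpolation exponents.\<close>
    have "c0 * E powr (real (mi_order \<alpha>) / s) * \<delta> powr (1 - real (mi_order \<alpha>) / s)
        = c * \<delta> * (R ^ mi_order \<alpha> / 2 ^ CARD('n)) * G"
      using \<delta> by (simp add: c0_def Ra powr_divide powr_diff mult_ac)
    also have "\<dots> = Lp_fun_norm p (\<lambda>x. of_real (c * \<delta> * (R ^ mi_order \<alpha> / 2 ^ CARD('n))) * w 0 x)"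
    proof -
      have "0 \<le> c * \<delta> * (R ^ mi_order \<alpha> / 2 ^ CARD('n))" using c\<delta> R M(1) by simp
      then show ?thesis
        unfolding Lp_fun_norm_cmult[OF p] G_def norm_of_real by (simp only: abs_of_nonneg)
    qed
    also have "\<dots> \<le> Lp_fun_norm p (mi_deriv \<alpha> f)"
    proof (rule Lp_fun_norm_mono[OF p])
      show "Lp_fun p (\<lambda>x. of_real (c * \<delta> * (R ^ mi_order \<alpha> / 2 ^ CARD('n))) * w 0 x)"
        by (intro Lp_fun_schwartz p schwartz_cmult w)
      show "Lp_fun p (mi_deriv \<alpha> f)" by (intro Lp_fun_schwartz p schwartz_mi_deriv f)
      fix x
      have "0 \<le> c * \<delta> * (R ^ mi_order \<alpha> / 2 ^ CARD('n))" using c\<delta> R M(1) by simp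
      then have "norm (of_real (c * \<delta> * (R ^ mi_order \<alpha> / 2 ^ CARD('n))) * w 0 x)
          = c * \<delta> * (R ^ mi_order \<alpha> / 2 ^ CARD('n) * norm (w 0 x))"
        unfolding norm_mult norm_of_real by (simp only: abs_of_nonneg mult.assoc)
      also have "\<dots> \<le> c * \<delta> * norm (mi_deriv \<alpha> (w R) x)"
        using c\<delta> by (intro mult_left_mono M(2) R) auto
      also have "\<dots> = norm (mi_deriv \<alpha> f x)"
        using c\<delta> unfolding f_def[abs_def] mi_deriv_cmult[OF schwartz_smooth[OF w]]
        unfolding norm_mult norm_of_real by (simp only: abs_of_pos)
      finally show "norm (of_real (c * \<delta> * (R ^ mi_order \<alpha> / 2 ^ CARD('n))) * w 0 x) \<le> norm (mi_deriv \<alpha> f x)" .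
    qed
    finally have deriv: "c0 * E powr (real (mi_order \<alpha>) / s) * \<delta> powr (1 - real (mi_order \<alpha>) / s)
        \<le> Lp_fun_norm p (mi_deriv \<alpha> f)" .
    have small: "c * \<delta> * G < \<delta>" using cG \<delta> mult_strict_right_mono[of "c * G" 1 \<delta>] by (simp add: mult_ac)
    note d = distr_of_schwartz_in_Lp[OF p] Lp_norm_distr_of_schwartz[OF p]
      distr_of_schwartz_in_bessel_space[OF p] bessel_norm_distr_of_schwartz[OF p]
    show ?thesis
      by (rule exI[of _ "distr_of_fun f"])
         (simp add: d f schwartz_mi_deriv distr_deriv_distr_of_schwartz norm_f small bessel deriv)
  qed
  moreover have "0 < c0" using c G M(1) by (simp add: c0_def)
  ultimately show ?thesis by blast
qed

end
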